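(* Let $N$ be a natural number, let $B_1,\ldots,B_N$ be Blaschke products with simple zeros, the zero sequence of each of which satisfies the Carleson interpolating condition, and let $\theta=B_1\cdots B_N$. Then $\theta$ has the following property: if $T$ is an absolutely continuous polynomially bounded operator on a Hilbert space such that $\theta(T)=\mathbb O$, then $T$ is similar to a contraction.
   Context: All Hilbert spaces are complex and separable; $\mathcal B(\mathcal H,\mathcal K)$ is the space of bounded linear operators from $\mathcal H$ to $\mathcal K$, and $\mathcal B(\mathcal H)=\mathcal B(\mathcal H,\mathcal H)$. An operator $R\in\mathcal B(\mathcal H)$ is polynomially bounded if there is a constant $M>0$ such that $\|p(R)\|\le M\sup\{|p(z)|:|z|\le 1\}$ for every polynomial $p$. A contraction is an operator $T$ with $\|T\|\le 1$. Operators $R\in\mathcal B(\mathcal H)$ and $T\in\mathcal B(\mathcal K)$ are similar if there is an invertible $X\in\mathcal B(\mathcal H,\mathcal K)$ (with bounded inverse) such that $XR=TX$. A polynomially bounded operator $R\in\mathcal B(\mathcal H)$ is absolutely continuous (a.c.) if for all $x,y\in\mathcal H$ there is $h_{x,y}\in L^1(\mathbb T,m)$ ($m$ normalized Lebesgue measure on the unit circle $\mathbb T$) with $(p(R)x,y)=\int_{\mathbb T}p\,h_{x,y}\,dm$ for every polynomial $p$. For such $R$ and every $\varphi\in H^\infty$ (the algebra of bounded analytic functions on the open unit disk $\mathbb D$) the operator $\varphi(R)$ is well defined by $(\varphi(R)x,y)=\int_{\mathbb T}\varphi\,h_{x,y}\,dm$ (using boundary values of $\varphi$); this is the $H^\infty$-functional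 calculus. For $\lambda\in\mathbb D$ set $b_\lambda(z)=\frac{|\lambda|}{\lambda}\frac{\lambda-z}{1-\overline\lambda z}$, $z\in\mathbb D$ (with the usual convention $b_0(z)=z$). If $\{\lambda_n\}_n\subset\mathbb D$ is a (finite or infinite) sequence with $\sum_n(1-|\lambda_n|)<\infty$, the product $B=\prod_n b_{\lambda_n}$ converges and is called a Blaschke product; it has simple zeros if the $\lambda_n$ are pairwise distinct. Set $B_{(n)}=\prod_{k\ne n}b_{\lambda_k}$. The sequence $\{\lambda_n\}_n$ satisfies the Carleson interpolating condition if $\inf_n|B_{(n)}(\lambda_n)|>0$. *)

theory Defs
  imports "HOL-Analysis.Analysis" "HOL-Computational_Algebra.Polynomial"
begin

text \<open>
  The underlying real structure is that of the library class \<^class>\<open>real_inner\<close>; its norm is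
  \<open>sqrt (Re (cinner x x))\<close> by the axiom \<open>inner_eq_Re_cinner\<close>. The complex inner product is linear
  in its first argument.
\<close>

class complex_inner = real_inner +
  fixes scaleC :: "complex \<Rightarrow> 'a \<Rightarrow> 'a" (infixr "*\<^sub>C" 75)
    and cinner :: "'a \<Rightarrow> 'a \<Rightarrow> complex"
  assumes scaleC_add_right: "c *\<^sub>C (x + y) = c *\<^sub>C x + c *\<^sub>C y"
    and scaleC_add_left: "(c + d) *\<^sub>C x = c *\<^sub>C x + d *\<^sub>C x"
    and scaleC_scaleC: "c *\<^sub>C (d *\<^sub>C x) = (c * d) *\<^sub>C x"
    and scaleC_of_real: "complex_of_real r *\<^sub>C x = r *\<^sub>R x"
    and cinner_commute: "cinner x y = cnj (cinner y x)"
    and cinner_add_left: "cinner (x + y) z = cinner x z + cinner y z"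
    and cinner_scaleC_left: "cinner (c *\<^sub>C x) y = c * cinner x y"
    and inner_eq_Re_cinner: "inner x y = Re (cinner x y)"

class complex_hilbert_space = complex_inner + complete_space +
  assumes separable: "\<exists>D. countable D \<and> (\<forall>x. \<forall>e>0. \<exists>d\<in>D. dist d x < e)"

definition bounded_clinear :: "('a::complex_inner \<Rightarrow> 'b::complex_inner) \<Rightarrow> bool" where
  "bounded_clinear f \<longleftrightarrow> bounded_linear f \<and> (\<forall>c x. f (c *\<^sub>C x) = c *\<^sub>C f x)"

definition poly_op :: "complex poly \<Rightarrow> ('a::complex_inner \<Rightarrow> 'a) \<Rightarrow> 'a \<Rightarrow> 'a" where
  "poly_op p R x = (\<Sum>i\<le>degree p. coeff p i *\<^sub>C (R ^^ i) x)"

definition polynomially_bounded :: "('a::complex_inner \<Rightarrow> 'a) \<Rightarrow> bool" where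
  "polynomially_bounded R \<longleftrightarrow> bounded_clinear R \<and>
     (\<exists>M>0. \<forall>p. onorm (poly_op p R) \<le> M * (SUP z\<in>cball 0 1. cmod (poly p z)))"

definition contraction :: "('a::complex_inner \<Rightarrow> 'a) \<Rightarrow> bool" where
  "contraction T \<longleftrightarrow> bounded_clinear T \<and> onorm T \<le> 1"

definition similar_operators ::
    "('a::complex_inner \<Rightarrow> 'a) \<Rightarrow> ('b::complex_inner \<Rightarrow> 'b) \<Rightarrow> bool" where
  "similar_operators R T \<longleftrightarrow>
     (\<exists>X Y. bounded_clinear X \<and> bounded_clinear Y \<and> Y \<circ> X = id \<and> X \<circ> Y = id \<and> X \<circ> R = T \<circ> X)"

text \<open>
  HOL cannot quantify existentially over the type of the space on which the contraction acts, so
  the contraction is taken on the same space. Nothing is lost: if \<open>X R = C X\<close> with an invertible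
  \<open>X\<close> into another Hilbert space and \<open>X = U |X|\<close> is the polar decomposition, then \<open>U\<close> is unitary
  and \<open>R\<close> is similar to the contraction \<open>U\<^sup>* C U\<close> on the original space.
\<close>

definition similar_to_contraction :: "('a::complex_inner \<Rightarrow> 'a) \<Rightarrow> bool" where
  "similar_to_contraction R \<longleftrightarrow> (\<exists>C :: 'a \<Rightarrow> 'a. contraction C \<and> similar_operators R C)"

definition circle_measure :: "complex measure" where
  "circle_measure =
     distr (uniform_measure lborel {0..2 * pi}) (restrict_space borel (sphere 0 1)) cis"

definition represents :: "(complex \<Rightarrow> complex) \<Rightarrow> ('a::complex_inner \<Rightarrow> 'a) \<Rightarrow> 'a \<Rightarrow> 'a \<Rightarrow> bool" where
  "represents h R x y \<longleftrightarrow> integrable circle_measure h \<and>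
     (\<forall>p. cinner (poly_op p R x) y = (LINT \<zeta>|circle_measure. poly p \<zeta> * h \<zeta>))"

definition absolutely_continuous_operator :: "('a::complex_inner \<Rightarrow> 'a) \<Rightarrow> bool" where
  "absolutely_continuous_operator R \<longleftrightarrow> (\<forall>x y. \<exists>h. represents h R x y)"

text \<open>
  Radial limits; for a bounded analytic function on the disk they exist almost everywhere on the
  circle. Only the values of \<open>\<phi>\<close> in the open disk matter.
\<close>

definition boundary_value :: "(complex \<Rightarrow> complex) \<Rightarrow> complex \<Rightarrow> complex" where
  "boundary_value \<phi> \<zeta> = Lim (at_left (1::real)) (\<lambda>r. \<phi> (complex_of_real r * \<zeta>))"

text \<open>
  \<open>\<phi>(R)\<close> for a bounded analytic function \<open>\<phi>\<close> on the open unit disk and an absolutely continuous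
  polynomially bounded \<open>R\<close>. The functions \<open>h\<close> representing \<open>R\<close> at \<open>x, y\<close> are not unique, but
  all of them give the same integral against \<open>\<phi>\<close>.
\<close>

definition hinf_calculus ::
    "(complex \<Rightarrow> complex) \<Rightarrow> ('a::complex_inner \<Rightarrow> 'a) \<Rightarrow> 'a \<Rightarrow> 'a" where
  "hinf_calculus \<phi> R = (THE A. bounded_clinear A \<and>
     (\<forall>x y h. represents h R x y \<longrightarrow>
        cinner (A x) y = (LINT \<zeta>|circle_measure. boundary_value \<phi> \<zeta> * h \<zeta>)))"

text \<open>
  A finite or infinite sequence is a function \<open>a\<close> restricted to an index set \<open>I \<subseteq> \<nat>\<close>; deleting
  the \<open>n\<close>-th term is then passing to \<open>I - {n}\<close>.
\<close>

definition blaschke_factor :: "complex \<Rightarrow> complex \<Rightarrow> complex" where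
  "blaschke_factor l z =
     (if l = 0 then z else complex_of_real (cmod l) / l * ((l - z) / (1 - cnj l * z)))"

definition blaschke_sequence :: "nat set \<Rightarrow> (nat \<Rightarrow> complex) \<Rightarrow> bool" where
  "blaschke_sequence I a \<longleftrightarrow> (\<forall>n\<in>I. cmod (a n) < 1) \<and> (\<lambda>n. 1 - cmod (a n)) summable_on I"

definition blaschke_product :: "nat set \<Rightarrow> (nat \<Rightarrow> complex) \<Rightarrow> complex \<Rightarrow> complex" where
  "blaschke_product I a z = (\<Prod>n. if n \<in> I then blaschke_factor (a n) z else 1)"

text \<open>The infimum is taken in \<^typ>\<open>ereal\<close>, so that it is positive for the empty sequence.\<close>

definition carleson_condition :: "nat set \<Rightarrow> (nat \<Rightarrow> complex) \<Rightarrow> bool" where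
  "carleson_condition I a \<longleftrightarrow>
     (INF n\<in>I. ereal (cmod (blaschke_product (I - {n}) a (a n)))) > 0"

end

theory Submission
  imports Defs "HOL-Complex_Analysis.Complex_Analysis"
begin

text \<open>
  Let \<open>\<Theta>\<^sub>n\<close> be finite partial products of \<open>\<theta>\<close>. As \<open>\<theta>(T) = 0\<close>, the operators \<open>(\<theta> / \<Theta>\<^sub>n)(T)\<close> map into
  the null spaces of \<open>\<Theta>\<^sub>n(T)\<close> and tend weakly to the identity, so the union of these null spaces is
  dense. On the null space of \<open>\<Theta>\<^sub>n(T)\<close> consider the quadratic form
  \<open>\<Sum>\<^sub>\<lambda> \<Sum>\<^sub>m \<parallel>G\<^sub>\<lambda>(T) b\<^sub>\<lambda>(T)\<^sup>m x\<parallel>\<^sup>2\<close>, where \<open>\<lambda>\<close> ranges over the zeros of \<open>\<Theta>\<^sub>n\<close>, \<open>m\<close> is less than the number of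
  zeros close to \<open>\<lambda>\<close>, and \<open>G\<^sub>\<lambda>\<close> is the Blaschke product of the zeros that are not close to \<open>\<lambda>\<close> times
  one of P. Jones's interpolating functions, for which \<open>\<Sum>\<^sub>\<lambda> \<bar>G\<^sub>\<lambda>\<bar> \<le> 1\<close> on the disk. Averaging over signs
  gives upper bounds for such square functions. Conversely, in each of the \<open>N\<close> interpolating sequences
  some combination of the \<open>G\<^sub>\<lambda>\<close> equals \<open>1\<close> at the zeros of that sequence, and the product of the
  corresponding \<open>N\<close> differences from \<open>1\<close> vanishes on the null space; this gives a lower bound. Every
  \<open>\<lambda>\<close>-part of the form is decreased by \<open>b\<^sub>\<lambda>(T)\<close>, hence by \<open>T\<close>. All bounds are independent of \<open>n\<close>,
  so a cluster point of the forms is an equivalent inner product in which \<open>T\<close> is a contraction.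
\<close>

subsection \<open>Complex inner product spaces\<close>

text \<open>The hypothesis speaks of radial limits of \<open>\<theta>\<close>, the estimates of
  finite products. They are joined by almost everywhere convergence of partial products on the
  circle, along a subsequence, which comes from a weak type maximal inequality and makes the weak
  limits computable. Zeros of different sequences may be arbitrarily close or coincide, so no single
  interpolation problem splits the null space; this is why powers of
  \<open>b\<^sub>\<lambda>(T)\<close> enter. Applying \<open>b\<^sub>\<lambda>(T)\<close> shifts the
  sum over \<open>m\<close> by one, hence only its new last term must be dominated by the lost first
  one. On the null space the product of the factors close to \<open>\<lambda>\<close> kills
  \<open>G\<^sub>\<lambda>(T) x\<close>, and the corresponding power of
  \<open>b\<^sub>\<lambda>\<close> differs from a unimodular multiple of it by at most
  \<open>1 / M\<close> on the disk. So the constant \<open>M\<close> of polynomial boundedness,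
  however large, is beaten by the choice of what counts as close. Since \<open>M\<close> controls
  one scalar function at a time, square functions are accessible only through a bound for the sum of
  moduli, which survives every choice of signs.\<close>

lemma scaleC_zero_right [simp]: "c *\<^sub>C (0::'a::complex_inner) = 0"
  using scaleC_add_right[of c 0 0] by simp

lemma scaleC_one [simp]:
  fixes x :: "'a::complex_inner"
  shows "1 *\<^sub>C x = x"
  using scaleC_of_real[of 1 x] by simp

lemma scaleC_zero_left [simp]:
  fixes x :: "'a::complex_inner"
  shows "0 *\<^sub>C x = 0"
  using scaleC_of_real[of 0 x] by simp

lemma scaleC_minus_left:
  fixes x :: "'a::complex_inner"
  shows "(- c) *\<^sub>C x = - (c *\<^sub>C x)"
  using scaleC_add_left[of c "- c" x] by (simp add: eq_neg_iff_add_eq_0 add.commute)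

lemma scaleC_minus_right:
  fixes x :: "'a::complex_inner"
  shows "c *\<^sub>C (- x) = - (c *\<^sub>C x)"
  using scaleC_add_right[of c x "- x"] by (simp add: eq_neg_iff_add_eq_0 add.commute)

lemma scaleC_diff_right:
  fixes x y :: "'a::complex_inner"
  shows "c *\<^sub>C (x - y) = c *\<^sub>C x - c *\<^sub>C y"
  using scaleC_add_right[of c x "- y"] by (simp add: scaleC_minus_right)

lemma scaleC_sum_right:
  fixes f :: "'b \<Rightarrow> 'a::complex_inner"
  shows "c *\<^sub>C (\<Sum>i\<in>A. f i) = (\<Sum>i\<in>A. c *\<^sub>C f i)"
  by (induction A rule: infinite_finite_induct) (auto simp: scaleC_add_right)

lemma cinner_zero_left [simp]:
  fixes y :: "'a::complex_inner"
  shows "cinner 0 y = 0"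
  using cinner_add_left[of 0 0 y] by simp

lemma cinner_minus_left:
  fixes x y :: "'a::complex_inner"
  shows "cinner (- x) y = - cinner x y"
  using cinner_add_left[of x "- x" y] by (simp add: eq_neg_iff_add_eq_0 add.commute)

lemma cinner_diff_left:
  fixes x y z :: "'a::complex_inner"
  shows "cinner (x - y) z = cinner x z - cinner y z"
  using cinner_add_left[of x "- y" z] by (simp add: cinner_minus_left)

lemma cinner_scaleC_right:
  fixes x y :: "'a::complex_inner"
  shows "cinner x (c *\<^sub>C y) = cnj c * cinner x y"
  by (metis cinner_commute cinner_scaleC_left complex_cnj_mult)

text \<open>Recovers the complex inner product from the real one, so that limits and continuity can
  be taken over from \<open>inner\<close>.\<close>

lemma cinner_eq_Complex:
  fixes x y :: "'a::complex_inner"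
  shows "cinner x y = Complex (inner x y) (inner x (\<i> *\<^sub>C y))"
  by (simp add: complex_eq_iff inner_eq_Re_cinner cinner_scaleC_right)

lemma inner_scaleC_scaleC:
  fixes x y :: "'a::complex_inner"
  shows "inner (c *\<^sub>C x) (c *\<^sub>C y) = (cmod c)\<^sup>2 * inner x y"
proof -
  have "cinner (c *\<^sub>C x) (c *\<^sub>C y) = complex_of_real ((cmod c)\<^sup>2) * cinner x y"
    by (simp only: cinner_scaleC_left cinner_scaleC_right complex_norm_square mult_ac)
  thus ?thesis unfolding inner_eq_Re_cinner by simp
qed

lemma norm_scaleC [simp]:
  fixes x :: "'a::complex_inner"
  shows "norm (c *\<^sub>C x) = cmod c * norm x"
proof -
  have "(norm (c *\<^sub>C x))\<^sup>2 = (cmod c * norm x)\<^sup>2"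
    using inner_scaleC_scaleC[of c x x] by (simp add: power2_norm_eq_inner power_mult_distrib)
  thus ?thesis by (subst (asm) power2_eq_iff_nonneg) auto
qed

lemma cmod_cinner_le:
  fixes x y :: "'a::complex_inner"
  shows "cmod (cinner x y) \<le> norm x * norm y"
proof (cases "cinner x y = 0")
  case False
  \<comment> \<open>A unimodular multiple of \<open>x\<close> makes the inner product real and
    nonnegative; then the real Cauchy-Schwarz inequality suffices.\<close>
  define u where "u = cnj (cinner x y) / cmod (cinner x y)"
  have u: "cmod u = 1" using False by (simp add: u_def norm_divide)
  have "cinner (u *\<^sub>C x) y = cmod (cinner x y)"
    using False complex_norm_square[of "cinner x y", symmetric]
    by (simp add: u_def cinner_scaleC_left power2_eq_square mult.commute)
  hence "cmod (cinner x y) = inner (u *\<^sub>C x) y" by (simp add: inner_eq_Re_cinner)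
  also have "\<dots> \<le> norm (u *\<^sub>C x) * norm y" by (rule norm_cauchy_schwarz)
  finally show ?thesis by (simp add: u)
qed simp

lemma tendsto_scaleC:
  fixes f :: "'b \<Rightarrow> 'a::complex_inner"
  assumes "(f \<longlongrightarrow> l) F"
  shows "((\<lambda>x. c *\<^sub>C f x) \<longlongrightarrow> c *\<^sub>C l) F"
proof -
  have "((\<lambda>x. c *\<^sub>C (f x - l)) \<longlongrightarrow> 0) F"
    using tendsto_mult_right_zero[OF tendsto_norm_zero[OF LIM_zero[OF assms]], of "cmod c"]
    by - (rule tendsto_norm_zero_cancel, simp)
  thus ?thesis by (simp add: scaleC_diff_right LIM_zero_iff)
qed

lemma tendsto_cinner_left:
  fixes f :: "'b \<Rightarrow> 'a::complex_inner"
  assumes "(f \<longlongrightarrow> l) F"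
  shows "((\<lambda>x. cinner (f x) y) \<longlongrightarrow> cinner l y) F"
  unfolding cinner_eq_Complex by (intro tendsto_Complex tendsto_inner assms tendsto_const)

lemma bounded_clinear_linear: "bounded_clinear f \<Longrightarrow> bounded_linear f"
  by (simp add: bounded_clinear_def)

lemma bounded_clinear_scaleC: "bounded_clinear f \<Longrightarrow> f (c *\<^sub>C x) = c *\<^sub>C f x"
  by (simp add: bounded_clinear_def)

lemmas bounded_clinear_simps =
  linear_add[OF bounded_linear.linear[OF bounded_clinear_linear]]
  linear_diff[OF bounded_linear.linear[OF bounded_clinear_linear]]
  linear_0[OF bounded_linear.linear[OF bounded_clinear_linear]]
  linear_sum[OF bounded_linear.linear[OF bounded_clinear_linear]]

lemma bounded_clinearI:
  assumes "\<And>x y. f (x + y) = f x + f y" "\<And>c x. f (c *\<^sub>C x) = c *\<^sub>C f x"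
    "\<And>x. norm (f x) \<le> K * norm x"
  shows "bounded_clinear f"
  unfolding bounded_clinear_def
  using assms by (auto intro!: bounded_linear_intro[where K = K] simp: mult.commute simp flip: scaleC_of_real)

lemma bounded_clinear_ident: "bounded_clinear (\<lambda>x. x)"
  by (simp add: bounded_clinear_def)

lemma bounded_clinear_compose:
  "bounded_clinear f \<Longrightarrow> bounded_clinear g \<Longrightarrow> bounded_clinear (\<lambda>x. f (g x))"
  by (simp add: bounded_clinear_def bounded_linear_compose)

lemma bounded_clinear_funpow:
  fixes f :: "'a::complex_inner \<Rightarrow> 'a"
  assumes "bounded_clinear f"
  shows "bounded_clinear (f ^^ n)"
proof (induction n)
  case 0
  have "f ^^ 0 = (\<lambda>x. x)" by (simp add: fun_eq_iff)
  thus ?case using bounded_clinear_ident by metis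
next
  case (Suc n)
  thus ?case using bounded_clinear_compose[OF assms, of "f ^^ n"] by (simp add: o_def)
qed

lemma bounded_clinear_sum:
  "(\<And>i. i \<in> A \<Longrightarrow> bounded_clinear (f i)) \<Longrightarrow> bounded_clinear (\<lambda>x. \<Sum>i\<in>A. f i x)"
  by (auto simp: bounded_clinear_def scaleC_sum_right intro!: bounded_linear_sum sum.cong)

lemma bounded_clinear_scaleC_left:
  assumes "bounded_clinear f" shows "bounded_clinear (\<lambda>x. c *\<^sub>C f x)"
proof -
  obtain K where K: "\<And>x. norm (f x) \<le> norm x * K"
    using bounded_linear.bounded[OF bounded_clinear_linear[OF assms]] by blast
  show ?thesis
  proof (rule bounded_clinearI)
    show "norm (c *\<^sub>C f x) \<le> cmod c * K * norm x" for x
      using mult_left_mono[OF K[of x], of "cmod c"] by (simp add: mult_ac)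
  qed (simp_all add: bounded_clinear_simps[OF assms] bounded_clinear_scaleC[OF assms]
      scaleC_add_right scaleC_scaleC mult.commute)
qed

subsection \<open>Orthogonality, the Riesz representation and adjoints\<close>

text \<open>A sequence in \<open>W\<close> whose distances to \<open>x\<close> tend to the infimum
  is Cauchy by the parallelogram law, and \<open>y\<close> is the difference between
  \<open>x\<close> and its limit. Both the Riesz representation and the density of the null spaces
  rest on this.\<close>

lemma closed_subspace_orthogonal:
  fixes W :: "'a::{real_inner, complete_space} set"
  assumes "subspace W" "closed W" "x \<notin> W"
  obtains y where "y \<noteq> 0" "\<And>w. w \<in> W \<Longrightarrow> inner w y = 0"
proof -
  define d where "d = (INF w\<in>W. norm (x - w))"
  have W0: "0 \<in> W" using assms(1) by (rule subspace_0)
  have bdd: "bdd_below ((\<lambda>w. norm (x - w)) ` W)" by (auto intro: bdd_belowI[of _ 0])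
  have dle: "d \<le> norm (x - w)" if "w \<in> W" for w
    unfolding d_def using bdd that by (rule cINF_lower)
  have d0: "d \<ge> 0" unfolding d_def using W0 by (intro cINF_greatest) auto
  have "\<exists>w\<in>W. norm (x - w) < d + e" if "e > 0" for e
    using W0 that bdd cINF_less_iff[of W "\<lambda>w. norm (x - w)" "d + e"] by (auto simp: d_def)
  hence "\<forall>n. \<exists>w\<in>W. norm (x - w) < d + 1 / Suc n" by simp
  then obtain w where w: "\<And>n. w n \<in> W" "\<And>n. norm (x - w n) < d + 1 / Suc n" by metis
  \<comment> \<open>\<open>e n\<close> bounds the excess of \<open>(d + 1 / Suc n)\<^sup>2\<close>
    over \<open>d\<^sup>2\<close>, with the square of \<open>1 / Suc n\<close> replaced by
    \<open>1 / Suc n\<close>.\<close>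
  define e where "e n = (2 * d + 1) / Suc n" for n
  have sq: "(norm (x - w n))\<^sup>2 \<le> d\<^sup>2 + e n" for n
  proof -
    have "(norm (x - w n))\<^sup>2 \<le> (d + 1 / Suc n)\<^sup>2"
      using w(2)[of n] by (intro power_mono) auto
    also have "\<dots> = d\<^sup>2 + (2 * d) / Suc n + (1 / Suc n) * (1 / Suc n)"
      by (simp only: power2_sum) (simp add: power2_eq_square)
    also have "(1 / Suc n) * (1 / Suc n) \<le> 1 / real (Suc n)"
      using mult_left_le[of "1 / real (Suc n)" "1 / real (Suc n)"] by simp
    finally show ?thesis by (simp add: e_def add_divide_distrib)
  qed
  have dist: "(norm (w m - w n))\<^sup>2 \<le> 2 * e m + 2 * e n" for m n
  proof -
    \<comment> \<open>The midpoint lies in \<open>W\<close>, so its distance to \<open>x\<close> is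
      at least \<open>d\<close>; the parallelogram law turns this into smallness of
      \<open>w m - w n\<close>.\<close>
    have "(1/2) *\<^sub>R (w m + w n) \<in> W"
      using w(1) assms(1) by (simp add: subspace_add subspace_scale)
    hence "d\<^sup>2 \<le> (norm (x - (1/2) *\<^sub>R (w m + w n)))\<^sup>2" using dle d0 by (intro power_mono)
    moreover have "(norm (w m - w n))\<^sup>2 + 4 * (norm (x - (1/2) *\<^sub>R (w m + w n)))\<^sup>2 =
        2 * (norm (x - w m))\<^sup>2 + 2 * (norm (x - w n))\<^sup>2"
      by (simp add: power2_norm_eq_inner inner_diff_left inner_diff_right inner_add_left
          inner_add_right inner_commute algebra_simps)
    ultimately show ?thesis using sq[of m] sq[of n] by linarith
  qed
  have "Cauchy w"
  proof (rule metric_CauchyI)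
    fix r :: real assume r: "r > 0"
    have "e \<longlonglongrightarrow> (2 * d + 1) * 0"
      unfolding e_def divide_inverse by (intro tendsto_intros LIMSEQ_inverse_real_of_nat)
    hence "eventually (\<lambda>n. e n < r\<^sup>2 / 4) sequentially"
      using r by (intro order_tendstoD(2)) auto
    then obtain M where M: "\<And>n. n \<ge> M \<Longrightarrow> e n < r\<^sup>2 / 4"
      by (auto simp: eventually_sequentially)
    have "dist (w m) (w n) < r" if "m \<ge> M" "n \<ge> M" for m n
    proof -
      have "(norm (w m - w n))\<^sup>2 < r\<^sup>2"
        using dist[of m n] M[OF that(1)] M[OF that(2)] by linarith
      thus ?thesis using r by (simp add: dist_norm power2_less_imp_less)
    qed
    thus "\<exists>M. \<forall>m\<ge>M. \<forall>n\<ge>M. dist (w m) (w n) < r" by blast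
  qed
  then obtain w0 where w0: "w \<longlonglongrightarrow> w0" using Cauchy_convergent convergent_def by blast
  have w0W: "w0 \<in> W" using closed_sequentially[OF assms(2) w(1) w0] .
  define y where "y = x - w0"
  have "(\<lambda>n. norm (x - w n)) \<longlonglongrightarrow> norm y" unfolding y_def by (intro tendsto_intros w0)
  moreover have "(\<lambda>n. d + inverse (real (Suc n))) \<longlonglongrightarrow> d + 0"
    by (intro tendsto_intros LIMSEQ_inverse_real_of_nat)
  ultimately have "norm y \<le> d + 0"
    by (rule LIMSEQ_le) (use w(2) in \<open>auto simp: inverse_eq_divide intro!: less_imp_le\<close>)
  hence yd: "norm y \<le> d" by simp
  have "inner v y = 0" if v: "v \<in> W" for v
  proof (cases "v = 0")
    case False
    \<comment> \<open>This \<open>t\<close> minimises the norm of \<open>y - t *\<^sub>R v\<close>;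
      since no point of \<open>W\<close> is nearer to \<open>x\<close> than \<open>w0\<close>, the
      gain must vanish.\<close>
    define t where "t = inner v y / (norm v)\<^sup>2"
    have "w0 + t *\<^sub>R v \<in> W" using w0W v assms(1) by (simp add: subspace_add subspace_scale)
    from dle[OF this] have "norm y \<le> norm (y - t *\<^sub>R v)"
      using yd by (simp add: y_def algebra_simps)
    hence "(norm y)\<^sup>2 \<le> (norm (y - t *\<^sub>R v))\<^sup>2" by (intro power_mono) auto
    also have "\<dots> = (norm y)\<^sup>2 - 2 * t * inner v y + t\<^sup>2 * (norm v)\<^sup>2"
      by (simp add: power2_norm_eq_inner inner_diff_left inner_diff_right inner_commute
          algebra_simps power2_eq_square[of t])
    also have "\<dots> = (norm y)\<^sup>2 - (inner v y)\<^sup>2 / (norm v)\<^sup>2"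
      using False by (simp add: t_def power2_eq_square field_simps)
    finally have "(inner v y)\<^sup>2 / (norm v)\<^sup>2 \<le> 0" by simp
    thus ?thesis using False by (simp add: divide_le_0_iff not_less)
  qed simp
  moreover have "y \<noteq> 0" using w0W assms(3) by (auto simp: y_def)
  ultimately show ?thesis using that by blast
qed

lemma riesz_representation:
  fixes f :: "'a::{real_inner, complete_space} \<Rightarrow> real"
  assumes "bounded_linear f"
  obtains z where "\<And>x. f x = inner x z"
proof (cases "\<forall>x. f x = 0")
  case True
  thus ?thesis using that[of 0] by simp
next
  case False
  interpret bounded_linear f by fact
  obtain x where x: "f x \<noteq> 0" using False by blast
  define W where "W = {w. f w = 0}"
  have "subspace W" by (auto simp: W_def subspace_def add scaleR)
  moreover have "closed W" unfolding W_def
    by (intro closed_Collect_eq linear_continuous_on assms continuous_on_const)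
  ultimately obtain y where y: "y \<noteq> 0" "\<And>w. w \<in> W \<Longrightarrow> inner w y = 0"
    using closed_subspace_orthogonal[of W x] x by (auto simp: W_def)
  have fy: "f y \<noteq> 0" using y(1) y(2)[of y] by (auto simp: W_def)
  show ?thesis
  proof (rule that[of "(f y / (norm y)\<^sup>2) *\<^sub>R y"])
    fix v
    have "v - (f v / f y) *\<^sub>R y \<in> W" using fy by (simp add: W_def diff scaleR)
    hence "inner v y = f v / f y * (norm y)\<^sup>2"
      using y(2) by (fastforce simp: inner_diff_left power2_norm_eq_inner)
    thus "f v = inner v ((f y / (norm y)\<^sup>2) *\<^sub>R y)" using fy y(1) by simp
  qed
qed

text \<open>The adjoint is taken for the real inner product; the same identity at
  \<open>\<i> *\<^sub>C x\<close> shows that the imaginary parts agree too.\<close>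

lemma bounded_clinear_adjoint:
  fixes A :: "'a::complex_hilbert_space \<Rightarrow> 'b::complex_inner"
  assumes "bounded_clinear A"
  obtains A' where "\<And>x y. cinner (A x) y = cinner x (A' y)" "\<And>x y. inner (A x) y = inner x (A' y)"
proof -
  have "\<exists>z. \<forall>x. inner (A x) y = inner x z" for y
    using riesz_representation[OF bounded_linear_compose[OF
        bounded_linear_inner_left bounded_clinear_linear[OF assms]], of y] by metis
  then obtain A' where A': "\<And>x y. inner (A x) y = inner x (A' y)" by metis
  have "cinner (A x) y = cinner x (A' y)" for x y
  proof -
    have *: "Im (cinner u v) = - inner (\<i> *\<^sub>C u) v" for u v :: "'c::complex_inner"
      by (simp add: inner_eq_Re_cinner cinner_scaleC_left)
    have "Im (cinner (A x) y) = Im (cinner x (A' y))"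
      by (simp add: * A' flip: bounded_clinear_scaleC[OF assms])
    moreover have "Re (cinner (A x) y) = Re (cinner x (A' y))"
      using A' by (simp add: inner_eq_Re_cinner)
    ultimately show ?thesis by (rule complex_eqI[rotated])
  qed
  thus ?thesis using that A' by blast
qed

text \<open>The limit of the sesquilinear forms is bounded by the same constant, so the Riesz
  representation yields an operator. This is how operators for boundary functions on the circle are
  obtained, where only scalar integrals converge.\<close>

lemma weak_limit_operator:
  fixes A :: "nat \<Rightarrow> 'a::complex_hilbert_space \<Rightarrow> 'a"
  assumes A: "\<And>n. bounded_clinear (A n)" "\<And>n x. norm (A n x) \<le> M * norm x"
    and conv: "\<And>x y. convergent (\<lambda>n. cinner (A n x) y)"
  obtains L where "bounded_clinear L" "\<And>x y. (\<lambda>n. cinner (A n x) y) \<longlonglongrightarrow> cinner (L x) y"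
proof -
  define l where "l x y = lim (\<lambda>n. cinner (A n x) y)" for x y
  have l: "(\<lambda>n. cinner (A n x) y) \<longlonglongrightarrow> l x y" for x y
    unfolding l_def using conv by (simp add: convergent_LIMSEQ_iff)
  have lim_unique: "l x y = c" if "(\<lambda>n. cinner (A n x) y) \<longlonglongrightarrow> c" for x y c
    using LIMSEQ_unique[OF l that] .
  have bound: "cmod (l x y) \<le> M * norm x * norm y" for x y
  proof (rule LIMSEQ_le_const2[OF tendsto_norm[OF l]])
    have "cmod (cinner (A n x) y) \<le> M * norm x * norm y" for n
      using cmod_cinner_le[of "A n x" y] mult_right_mono[OF A(2)[of n x], of "norm y"] by simp
    thus "\<exists>N. \<forall>n\<ge>N. cmod (cinner (A n x) y) \<le> M * norm x * norm y" by blast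
  qed
  have add: "l x (y + z) = l x y + l x z" for x y z
    by (rule lim_unique, subst (1) cinner_commute, subst cinner_add_left, subst complex_cnj_add,
        subst (1 2) cinner_commute[symmetric]) (intro tendsto_intros l)
  have scale: "l x (c *\<^sub>C y) = cnj c * l x y" for x y c
    by (rule lim_unique, subst cinner_scaleC_right) (intro tendsto_intros l)
  have "\<exists>z. \<forall>y. Re (l x y) = inner y z" for x
  proof -
    have "bounded_linear (\<lambda>y. Re (l x y))"
    proof (rule bounded_linear_intro[where K = "M * norm x"])
      show "norm (Re (l x y)) \<le> norm y * (M * norm x)" for y
        using bound[of x y] abs_Re_le_cmod[of "l x y"] by (simp add: mult_ac)
      show "Re (l x (r *\<^sub>R y)) = r *\<^sub>R Re (l x y)" for r y
        using scale[of x "complex_of_real r" y] by (simp add: scaleC_of_real)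
    qed (simp add: add)
    thus ?thesis using riesz_representation by metis
  qed
  then obtain L where L0: "\<And>x y. Re (l x y) = inner y (L x)" by metis
  have L: "l x y = cinner (L x) y" for x y
  proof (rule complex_eqI)
    show "Re (l x y) = Re (cinner (L x) y)" 
      using L0[of x y] by (metis inner_commute inner_eq_Re_cinner)
    have "Im (l x y) = Re (l x (\<i> *\<^sub>C y))" by (simp add: scale)
    also have "\<dots> = Im (cinner (L x) y)"
      unfolding L0 by (simp add: inner_commute cinner_eq_Complex)
    finally show "Im (l x y) = Im (cinner (L x) y)" .
  qed
  have ext: "u = v" if "\<And>y. cinner u y = cinner v y" for u v :: 'a
    using that[of "u - v"] by (metis cinner_diff_left eq_iff_diff_eq_0 inner_eq_Re_cinner
        inner_eq_zero_iff zero_complex.simps(1))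
  have "bounded_clinear L"
  proof (rule bounded_clinearI)
    show "L (x + y) = L x + L y" for x y
    proof (rule ext)
      show "cinner (L (x + y)) z = cinner (L x + L y) z" for z
        unfolding L[symmetric] cinner_add_left
        by (rule lim_unique, simp add: bounded_clinear_simps[OF A(1)] cinner_add_left)
           (intro tendsto_intros l)
    qed
    show "L (c *\<^sub>C x) = c *\<^sub>C L x" for c x
    proof (rule ext)
      show "cinner (L (c *\<^sub>C x)) z = cinner (c *\<^sub>C L x) z" for z
        unfolding L[symmetric] cinner_scaleC_left
        by (rule lim_unique, simp add: bounded_clinear_scaleC[OF A(1)] cinner_scaleC_left)
           (intro tendsto_intros l)
    qed
    show "norm (L x) \<le> M * norm x" for x
    proof (cases "L x = 0")
      case True
      have "0 \<le> M * norm x" using A(2)[of 0 x] norm_ge_zero order_trans by blast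
      thus ?thesis using True by simp
    next
      case False
      have "norm (L x) * norm (L x) = Re (l x (L x))"
        by (simp add: L0 power2_norm_eq_inner flip: power2_eq_square)
      also have "\<dots> \<le> M * norm x * norm (L x)"
        using bound[of x "L x"] complex_Re_le_cmod order_trans by blast
      finally show ?thesis using False by simp
    qed
  qed
  thus ?thesis using that l L by simp
qed

section \<open>Square roots of operators, and similarity from an equivalent inner product\<close>

instance complex_hilbert_space \<subseteq> banach ..

lemma scaleR_scaleC_commute:
  fixes x :: "'a::complex_inner"
  shows "r *\<^sub>R (c *\<^sub>C x) = c *\<^sub>C (r *\<^sub>R x)"
  by (simp add: scaleC_scaleC mult.commute flip: scaleC_of_real)

text \<open>Solving \<open>z = v + Y z\<close> by Banach's fixed point theorem gives the inverse of
  \<open>1 - Y\<close> at \<open>v\<close>.\<close>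

lemma neumann_inverse:
  fixes Y :: "'a::banach \<Rightarrow>\<^sub>L 'a"
  assumes "norm Y < 1"
  obtains Z where "\<And>x. Z (x - Y x) = x" "\<And>x. Z x - Y (Z x) = x" "bounded_linear Z"
proof -
  have ex1: "\<exists>!z. v + Y z = z" for v
  proof -
    have "dist (v + Y z) (v + Y w) \<le> norm Y * dist z w" for z w
      using norm_blinfun[of Y "z - w"] by (simp add: dist_norm blinfun.diff_right)
    thus ?thesis
      using Banach_fix[of UNIV "norm Y" "\<lambda>z. v + Y z"] assms by (auto simp: complete_UNIV)
  qed
  define Z where "Z v = (THE z. v + Y z = z)" for v
  have Z: "v + Y (Z v) = Z v" for v unfolding Z_def using theI'[OF ex1] .
  have Zeq: "Z v = z" if "v + Y z = z" for v z using ex1 Z that by blast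
  have 1: "Z x - Y (Z x) = x" for x using Z[of x] by (simp add: algebra_simps)
  have 2: "Z (x - Y x) = x" for x by (rule Zeq) simp
  have "bounded_linear Z"
  proof (rule bounded_linear_intro[where K = "1 / (1 - norm Y)"])
    show "Z (x + y) = Z x + Z y" for x y
      by (rule Zeq) (metis Z add.assoc add.left_commute blinfun.add_right)
    show "Z (r *\<^sub>R x) = r *\<^sub>R Z x" for r x
      by (rule Zeq) (metis Z blinfun.scaleR_right scaleR_add_right)
    show "norm (Z x) \<le> norm x * (1 / (1 - norm Y))" for x
    proof -
      have "norm (Z x) \<le> norm x + norm Y * norm (Z x)"
        by (metis Z norm_blinfun norm_triangle_le add_left_mono)
      thus ?thesis using assms by (simp add: field_simps)
    qed
  qed
  thus ?thesis using that 1 2 by blast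
qed

text \<open>
  The square root of \<open>1 - A\<close> is \<open>1 - Y\<close>, where \<open>Y\<close> is the fixed point of \<open>Y \<mapsto> (A + Y\<^sup>2) / 2\<close>.
\<close>

lemma square_root_one_minus:
  fixes A :: "'a::complex_hilbert_space \<Rightarrow>\<^sub>L 'a"
  assumes "norm A < 1" and sym: "\<And>x y. inner (A x) y = inner x (A y)"
    and com: "\<And>c x. A (c *\<^sub>C x) = c *\<^sub>C A x"
  obtains Y :: "'a \<Rightarrow>\<^sub>L 'a" where "norm Y < 1" "\<And>x y. inner (Y x) y = inner x (Y y)"
    "\<And>c x. Y (c *\<^sub>C x) = c *\<^sub>C Y x" "\<And>x. x - Y x - Y (x - Y x) = x - A x"
proof -
  define a where "a = norm A"
  \<comment> \<open>The smaller fixed point of the scalar map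
    \<open>\<rho> \<mapsto> (a + \<rho> * \<rho>) / 2\<close>: the ball of radius \<open>r\<close>
    is mapped into itself, and there the operator map has Lipschitz constant
    \<open>r < 1\<close>.\<close>
  define r where "r = 1 - sqrt (1 - a)"
  have a: "0 \<le> a" "a < 1" using assms by (auto simp: a_def)
  have r: "0 \<le> r" "r < 1" "(a + r * r) / 2 = r"
    using a by (auto simp: r_def algebra_simps diff_divide_distrib add_divide_distrib)
  \<comment> \<open>Symmetry and complex linearity are conditions on the complete set, so the fixed
    point inherits them.\<close>
  define S where "S = {Y :: 'a \<Rightarrow>\<^sub>L 'a. norm Y \<le> r \<and>
    (\<forall>x y. inner (blinfun_apply Y x) y = inner x (blinfun_apply Y y)) \<and>
    (\<forall>c x. blinfun_apply Y (c *\<^sub>C x) = c *\<^sub>C blinfun_apply Y x)}"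
  define \<Phi> where "\<Phi> Y = (1/2) *\<^sub>R (A + (Y o\<^sub>L Y))" for Y :: "'a \<Rightarrow>\<^sub>L 'a"
  have ev: "((\<lambda>n. blinfun_apply (Y n) x) \<longlongrightarrow> L x) sequentially"
    if "Y \<longlonglongrightarrow> L" for Y :: "nat \<Rightarrow> 'a \<Rightarrow>\<^sub>L 'a" and L x
    using that by (intro tendsto_intros)
  have closed: "closed S"
    unfolding closed_sequential_limits
  proof (intro allI impI, elim conjE)
    fix Y L assume Y: "\<forall>n. Y n \<in> S" and lim: "Y \<longlonglongrightarrow> L"
    have "norm L \<le> r"
      by (rule LIMSEQ_le_const2[OF tendsto_norm[OF lim]]) (use Y in \<open>auto simp: S_def\<close>)
    moreover have "inner (L x) y = inner x (L y)" for x y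
    proof (rule LIMSEQ_unique)
      show "(\<lambda>n. inner (Y n x) y) \<longlonglongrightarrow> inner (L x) y" by (intro tendsto_intros ev lim)
      have "(\<lambda>n. inner x (Y n y)) \<longlonglongrightarrow> inner x (L y)" by (intro tendsto_intros ev lim)
      thus "(\<lambda>n. inner (Y n x) y) \<longlonglongrightarrow> inner x (L y)" using Y by (simp add: S_def)
    qed
    moreover have "L (c *\<^sub>C x) = c *\<^sub>C L x" for c x
    proof (rule LIMSEQ_unique)
      show "(\<lambda>n. Y n (c *\<^sub>C x)) \<longlonglongrightarrow> L (c *\<^sub>C x)" by (intro ev lim)
      have "(\<lambda>n. c *\<^sub>C Y n x) \<longlonglongrightarrow> c *\<^sub>C L x" by (intro tendsto_scaleC ev lim)
      thus "(\<lambda>n. Y n (c *\<^sub>C x)) \<longlonglongrightarrow> c *\<^sub>C L x" using Y by (simp add: S_def)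
    qed
    ultimately show "L \<in> S" by (simp add: S_def)
  qed
  have "\<exists>!Y\<in>S. \<Phi> Y = Y"
  proof (rule Banach_fix[of _ r])
    show "complete S" using closed by (simp add: complete_eq_closed)
    show "S \<noteq> {}" using r by (auto simp: S_def intro!: exI[of _ 0])
    show "\<Phi> ` S \<subseteq> S"
    proof safe
      fix Y assume Y: "Y \<in> S"
      have "norm (Y o\<^sub>L Y) \<le> r * r"
        using norm_blinfun_compose[of Y Y] Y r by (smt (verit) S_def mem_Collect_eq mult_mono norm_ge_zero)
      hence "norm (\<Phi> Y) \<le> r"
        using norm_triangle_ineq[of A "Y o\<^sub>L Y"] r by (simp add: \<Phi>_def a_def)
      thus "\<Phi> Y \<in> S" using Y sym com
        by (simp add: S_def \<Phi>_def blinfun.add_left blinfun.scaleR_left inner_add_left inner_add_right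
            scaleC_add_right scaleR_add_right scaleR_scaleC_commute)
    qed
    show "dist (\<Phi> Y) (\<Phi> Z) \<le> r * dist Y Z" if "Y \<in> S" "Z \<in> S" for Y Z
    proof -
      have "\<Phi> Y - \<Phi> Z = (1/2) *\<^sub>R ((Y o\<^sub>L (Y - Z)) + ((Y - Z) o\<^sub>L Z))"
        by (rule blinfun_eqI) (simp add: \<Phi>_def blinfun.add_left blinfun.diff_left blinfun.diff_right
            blinfun.scaleR_left algebra_simps)
      moreover have "norm (Y o\<^sub>L (Y - Z)) \<le> r * norm (Y - Z)" "norm ((Y - Z) o\<^sub>L Z) \<le> norm (Y - Z) * r"
        using norm_blinfun_compose[of Y "Y - Z"] norm_blinfun_compose[of "Y - Z" Z] that
        by (auto simp: S_def elim!: order_trans intro!: mult_right_mono mult_left_mono)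
      ultimately show ?thesis
        using norm_triangle_ineq[of "Y o\<^sub>L (Y - Z)" "(Y - Z) o\<^sub>L Z"] by (simp add: dist_norm mult.commute[of _ r])
    qed
  qed (use r in auto)
  then obtain Y where Y: "Y \<in> S" "\<Phi> Y = Y" by blast
  have "2 *\<^sub>R Y x = A x + Y (Y x)" for x
  proof -
    have "2 *\<^sub>R \<Phi> Y = A + (Y o\<^sub>L Y)" by (simp add: \<Phi>_def)
    hence "blinfun_apply (2 *\<^sub>R \<Phi> Y) x = blinfun_apply (A + (Y o\<^sub>L Y)) x" by simp
    thus ?thesis unfolding Y by (simp add: blinfun.add_left blinfun.scaleR_left)
  qed
  hence "x - Y x - Y (x - Y x) = x - A x" for x
    by (simp add: blinfun.diff_right scaleR_2 algebra_simps)
  thus ?thesis using that[of Y] Y r by (auto simp: S_def)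
qed

text \<open>Represent \<open>s\<close> by a symmetric operator \<open>Q\<close>, scale it to
  \<open>1 - A\<close> with \<open>norm A < 1\<close>, and let \<open>X\<close> be its square root.
  Then \<open>(norm (X x))\<^sup>2 = s x x / L\<close>, so \<open>X\<close> carries the new inner
  product to a multiple of the given one and \<open>T\<close> to a contraction. The hypothesis
  \<open>rot\<close> makes \<open>Q\<close> commute with \<open>\<i>\<close>, hence complex
  linear.\<close>

lemma similar_to_contraction_if_equivalent_form:
  fixes T :: "'a::complex_hilbert_space \<Rightarrow> 'a" and s :: "'a \<Rightarrow> 'a \<Rightarrow> real"
  assumes T: "bounded_clinear T"
    and add: "\<And>x y z. s (x + y) z = s x z + s y z" and scale: "\<And>r x y. s (r *\<^sub>R x) y = r * s x y"
    and sym: "\<And>x y. s x y = s y x" and rot: "\<And>x y. s (\<i> *\<^sub>C x) (\<i> *\<^sub>C y) = s x y"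
    and lower: "\<And>x. c * (norm x)\<^sup>2 \<le> s x x" and upper: "\<And>x y. \<bar>s x y\<bar> \<le> C * (norm x * norm y)"
    and contr: "\<And>x. s (T x) (T x) \<le> s x x" and c: "c > 0"
  shows "similar_to_contraction T"
proof -
  \<comment> \<open>The maximum guarantees \<open>0 < D\<close> and \<open>c \<le> D\<close>, also
    on the zero space, where \<open>C\<close> may be negative.\<close>
  define D where "D = max C c"
  have D: "D > 0" "c \<le> D" using c by (auto simp: D_def)
  have upper': "\<bar>s x y\<bar> \<le> D * (norm x * norm y)" for x y
    using order_trans[OF upper[of x y], of "D * (norm x * norm y)"]
    by (simp add: D_def mult_right_mono)
  have "\<exists>z. \<forall>y. s x y = inner y z" for x
  proof (rule riesz_representation)
    show "bounded_linear (s x)"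
      by (rule bounded_linear_intro[where K = "D * norm x"])
         (use upper' in \<open>auto simp: sym[of x] add scale mult_ac\<close>)
  qed blast
  then obtain Q where Q0: "\<And>x y. s x y = inner y (Q x)" by metis
  have Q: "s x y = inner (Q x) y" for x y by (simp add: Q0 inner_commute)
  have ext: "u = v" if "\<And>y. inner u y = inner v y" for u v :: 'a
    using that[of "u - v"] by (metis eq_iff_diff_eq_0 inner_diff_left inner_eq_zero_iff)
  have Qadd: "Q (x + y) = Q x + Q y" for x y
    by (rule ext) (simp add: inner_add_left add flip: Q)
  have Qscale: "Q (r *\<^sub>R x) = r *\<^sub>R Q x" for r x
    by (rule ext) (simp add: scale flip: Q)
  have Qi: "Q (\<i> *\<^sub>C x) = \<i> *\<^sub>C Q x" for x
  proof (rule ext)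
    fix y
    have "inner (Q (\<i> *\<^sub>C x)) y = s (\<i> *\<^sub>C x) (\<i> *\<^sub>C ((-\<i>) *\<^sub>C y))"
      unfolding scaleC_scaleC by (simp add: Q)
    also have "\<dots> = inner (\<i> *\<^sub>C Q x) (\<i> *\<^sub>C ((-\<i>) *\<^sub>C y))"
      unfolding rot inner_scaleC_scaleC by (simp add: Q)
    finally show "inner (Q (\<i> *\<^sub>C x)) y = inner (\<i> *\<^sub>C Q x) y"
      unfolding scaleC_scaleC by simp
  qed
  have Qc: "Q (z *\<^sub>C x) = z *\<^sub>C Q x" for z x
  proof -
    have *: "z *\<^sub>C v = Re z *\<^sub>R v + Im z *\<^sub>R (\<i> *\<^sub>C v)" for v :: 'a
      unfolding scaleC_of_real[symmetric] scaleC_scaleC scaleC_add_left[symmetric]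
      by (simp add: complex_eq mult.commute flip: complex_eq)
    show ?thesis unfolding * Qadd Qscale Qi ..
  qed
  have Qnorm: "norm (Q x) \<le> D * norm x" for x
  proof -
    have "norm (Q x) * norm (Q x) \<le> (D * norm x) * norm (Q x)"
      using upper'[of x "Q x"] by (simp add: Q power2_norm_eq_inner mult_ac flip: power2_eq_square)
    thus ?thesis using D by (cases "Q x = 0") auto
  qed
  \<comment> \<open>This \<open>L\<close> minimises the bound
    \<open>1 - 2 * c / L + D\<^sup>2 / L\<^sup>2\<close> for the squared norm of
    \<open>1 - Q / L\<close>; the minimum is \<open>1 - (c / D)\<^sup>2\<close>.\<close>
  define L where "L = D\<^sup>2 / c"
  define k where "k = sqrt (1 - (c / D)\<^sup>2)"
  have cD: "0 \<le> 1 - (c / D)\<^sup>2" "0 < (c / D)\<^sup>2" using c D by (auto simp: power_le_one_iff)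
  hence k: "0 \<le> k" "k < 1" by (auto simp: k_def)
  have L: "L > 0" using c D by (simp add: L_def)
  have An: "norm (x - (1 / L) *\<^sub>R Q x) \<le> norm x * k" for x
  proof -
    have "(norm (x - (1 / L) *\<^sub>R Q x))\<^sup>2 = (norm x)\<^sup>2 - 2 * s x x / L + (norm (Q x))\<^sup>2 / L\<^sup>2"
      by (simp add: power2_norm_eq_inner inner_diff_left inner_diff_right Q inner_commute power2_eq_square[of L])
    also have "\<dots> \<le> (norm x)\<^sup>2 - 2 * (c * (norm x)\<^sup>2) / L + (D * norm x)\<^sup>2 / L\<^sup>2"
      using lower[of x] Qnorm[of x] L by (intro add_mono diff_mono divide_right_mono power_mono) auto
    also have "\<dots> = (norm x)\<^sup>2 * (1 - (c / D)\<^sup>2)"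
      using c D by (simp add: L_def field_simps power2_eq_square)
    finally have "norm (x - (1 / L) *\<^sub>R Q x) \<le> sqrt ((norm x)\<^sup>2 * (1 - (c / D)\<^sup>2))"
      by (rule real_le_rsqrt)
    thus ?thesis by (simp add: k_def real_sqrt_mult)
  qed
  have bl: "bounded_linear (\<lambda>x. x - (1 / L) *\<^sub>R Q x)"
    by (rule bounded_linear_intro[where K = k])
       (use An in \<open>auto simp: Qadd Qscale algebra_simps\<close>)
  define A where "A = Blinfun (\<lambda>x. x - (1 / L) *\<^sub>R Q x)"
  have A: "A x = x - (1 / L) *\<^sub>R Q x" for x
    unfolding A_def by (simp add: bounded_linear_Blinfun_apply[OF bl])
  obtain Y :: "'a \<Rightarrow>\<^sub>L 'a" where Y: "norm Y < 1" "\<And>x y. inner (Y x) y = inner x (Y y)"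
    "\<And>c x. Y (c *\<^sub>C x) = c *\<^sub>C Y x" "\<And>x. x - Y x - Y (x - Y x) = x - A x"
  proof (rule square_root_one_minus[of A])
    show "norm A < 1"
      using norm_blinfun_bound[of k A] An k by (simp add: A mult.commute)
    show "inner (A x) y = inner x (A y)" for x y
      using sym[of x y] by (simp add: A inner_diff_left inner_diff_right Q inner_commute)
    show "A (c *\<^sub>C x) = c *\<^sub>C A x" for c x
      by (simp add: A Qc scaleC_diff_right scaleR_scaleC_commute)
  qed blast
  obtain Z where Z: "\<And>x. Z (x - Y x) = x" "\<And>x. Z x - Y (Z x) = x" "bounded_linear Z"
    using neumann_inverse[OF Y(1)] by blast
  define X where "X x = x - Y x" for x
  have X: "bounded_clinear X"
    unfolding bounded_clinear_def X_def
    by (auto intro!: bounded_linear_sub blinfun.bounded_linear_right simp: Y(3) scaleC_diff_right)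
  have ZX: "Z (X x) = x" and XZ: "X (Z x) = x" for x using Z by (auto simp: X_def)
  have cZ: "bounded_clinear Z"
    unfolding bounded_clinear_def using Z(3) by (metis XZ ZX X bounded_clinear_scaleC)
  have nX: "(norm (X x))\<^sup>2 = s x x / L" for x
  proof -
    have "(norm (X x))\<^sup>2 = inner (x - Y x - Y (x - Y x)) x"
      unfolding X_def power2_norm_eq_inner inner_diff_left[of _ _ x] inner_diff_right Y(2) ..
    also have "\<dots> = s x x / L" unfolding Y(4) by (simp add: A Q)
    finally show ?thesis .
  qed
  define K where "K x = X (T (Z x))" for x
  have K: "bounded_clinear K" unfolding K_def
    by (intro bounded_clinear_compose[OF X] bounded_clinear_compose[OF T] cZ)
  have Kn: "norm (K x) \<le> 1 * norm x" for x
  proof -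
    have "(norm (K x))\<^sup>2 \<le> (norm (X (Z x)))\<^sup>2"
      unfolding K_def nX using contr L by (intro divide_right_mono) auto
    thus ?thesis by (simp add: XZ power2_le_iff_abs_le)
  qed
  have "contraction K" unfolding contraction_def using K onorm_bound[of 1, OF _ Kn] by simp
  moreover have "similar_operators T K" unfolding similar_operators_def
    by (rule exI[of _ X], rule exI[of _ Z]) (simp add: X cZ fun_eq_iff ZX XZ K_def)
  ultimately show ?thesis unfolding similar_to_contraction_def by blast
qed

subsection \<open>Functional calculus for functions analytic on the closed disk\<close>

text \<open>By compactness a function analytic on the closed disk is holomorphic on a disk of radius
  \<open>1 + e\<close>; the coefficients are therefore absolutely summable, which gives uniform
  approximation by polynomials.\<close>

lemma analytic_on_cball_power_series:
  fixes f :: "complex \<Rightarrow> complex"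
  assumes "f analytic_on cball 0 1"
  obtains c where "summable (\<lambda>n. norm (c n))"
    "\<And>z. cmod z \<le> 1 \<Longrightarrow> (\<lambda>n. c n * z ^ n) sums f z"
proof -
  obtain S where S: "open S" "cball 0 1 \<subseteq> S" "f holomorphic_on S"
    using assms analytic_on_holomorphic by metis
  obtain e where e: "e > 0" "(\<Union>x\<in>cball 0 1. ball x e) \<subseteq> S"
    using compact_subset_open_imp_ball_epsilon_subset[OF compact_cball S(1,2)] by blast
  have sub: "ball 0 (1 + e) \<subseteq> S"
  proof
    fix z :: complex assume z: "z \<in> ball 0 (1 + e)"
    show "z \<in> S"
    proof (cases "cmod z \<le> 1")
      case True
      thus ?thesis using S(2) by (auto simp: mem_cball)
    next
      case False
      \<comment> \<open>\<open>sgn z\<close> is the point of the closed disk nearest to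
        \<open>z\<close>.\<close>
      have "sgn z \<in> cball 0 1" "dist (sgn z) z < e"
      proof -
        have "z = of_real (cmod z) * sgn z" using False by (auto simp: sgn_eq)
        moreover have "z \<noteq> 0" using False by auto
        ultimately have "sgn z - z = of_real (1 - cmod z) * sgn z"
          by (metis (no_types) mult.commute mult.right_neutral of_real_1 of_real_diff right_diff_distrib)
        hence "dist (sgn z) z = cmod z - 1" using False \<open>z \<noteq> 0\<close>
          by (simp add: dist_norm norm_mult norm_sgn del: of_real_diff)
        thus "dist (sgn z) z < e" using z by simp
        show "sgn z \<in> cball 0 1" by (simp add: norm_sgn)
      qed
      thus ?thesis using e(2) by (meson UN_I in_mono mem_ball)
    qed
  qed
  define c where "c n = (deriv ^^ n) f 0 / fact n" for n
  have s: "(\<lambda>n. c n * z ^ n) sums f z" if "z \<in> ball 0 (1 + e)" for z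
    using holomorphic_power_series[OF holomorphic_on_subset[OF S(3) sub] that] by (simp add: c_def)
  have "summable (\<lambda>n. c n * (of_real (1 + e/2)) ^ n)"
    using s[of "of_real (1 + e/2)"] e(1) sums_summable by (force simp del: of_real_add)
  hence "summable (\<lambda>n. norm (c n * 1 ^ n))"
    by (rule powser_insidea) (use e(1) in \<open>simp del: of_real_add\<close>)
  hence "summable (\<lambda>n. norm (c n))" by simp
  thus ?thesis using that s e(1) by auto
qed

definition poly_approx :: "(nat \<Rightarrow> complex poly) \<Rightarrow> (complex \<Rightarrow> complex) \<Rightarrow> bool" where
  "poly_approx p f \<longleftrightarrow> uniform_limit (cball 0 1) (\<lambda>n z. poly (p n) z) f sequentially"

lemma poly_approx_exists:
  assumes "f analytic_on cball 0 1"
  shows "\<exists>p. poly_approx p f"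
proof -
  obtain c where c: "summable (\<lambda>n. norm (c n))" "\<And>z. cmod z \<le> 1 \<Longrightarrow> (\<lambda>n. c n * z ^ n) sums f z"
    using analytic_on_cball_power_series[OF assms] by blast
  define p where "p n = (\<Sum>i<n. monom (c i) i)" for n
  have "uniform_limit (cball 0 1) (\<lambda>n z. \<Sum>i<n. c i * z ^ i) (\<lambda>z. \<Sum>i. c i * z ^ i) sequentially"
    using c(1) by (intro Weierstrass_m_test)
      (auto simp: norm_mult norm_power intro!: mult_right_le_one_le power_le_one)
  moreover have "(\<Sum>i. c i * z ^ i) = f z" if "z \<in> cball 0 1" for z
    using c(2)[of z] that by (simp add: sums_iff)
  ultimately have "poly_approx p f" unfolding poly_approx_def uniform_limit_iff
    by (simp add: p_def poly_sum poly_monom)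
  thus ?thesis by blast
qed

lemma poly_op_eq_sum:
  assumes "degree p \<le> n"
  shows "poly_op p R x = (\<Sum>i\<le>n. coeff p i *\<^sub>C (R ^^ i) x)"
  unfolding poly_op_def using assms
  by (intro sum.mono_neutral_left) (auto simp: coeff_eq_0)

lemma poly_op_add: "poly_op (p + q) R x = poly_op p R x + poly_op q R x"
proof -
  define n where "n = max (degree p) (degree q)"
  have "degree (p + q) \<le> n" "degree p \<le> n" "degree q \<le> n"
    by (auto simp: n_def degree_add_le)
  thus ?thesis by (simp add: poly_op_eq_sum[of _ n] scaleC_add_left sum.distrib)
qed

lemma poly_op_smult: "poly_op (smult c p) R x = c *\<^sub>C poly_op p R x"
  by (simp add: poly_op_eq_sum[OF degree_smult_le] poly_op_def scaleC_sum_right scaleC_scaleC)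

lemma poly_op_0 [simp]: "poly_op 0 R x = 0" by (simp add: poly_op_def)

lemma poly_op_diff: "poly_op (p - q) R x = poly_op p R x - poly_op q R x"
  using poly_op_add[of "p - q" q R x] by simp

lemma bounded_clinear_poly_op: "bounded_clinear R \<Longrightarrow> bounded_clinear (poly_op p R)"
  unfolding poly_op_def
  by (intro bounded_clinear_sum bounded_clinear_scaleC_left bounded_clinear_funpow)

lemma poly_op_pCons:
  assumes "bounded_clinear R"
  shows "poly_op (pCons a p) R x = a *\<^sub>C x + R (poly_op p R x)"
proof -
  have "poly_op (pCons a p) R x = (\<Sum>i\<le>Suc (degree p). coeff (pCons a p) i *\<^sub>C (R ^^ i) x)"
    by (rule poly_op_eq_sum) (simp add: degree_pCons_le)
  also have "\<dots> = a *\<^sub>C x + (\<Sum>i\<le>degree p. coeff p i *\<^sub>C R ((R ^^ i) x))"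
    by (subst sum.atMost_Suc_shift) simp
  finally show ?thesis
    by (simp add: poly_op_def bounded_clinear_simps[OF assms] bounded_clinear_scaleC[OF assms])
qed

lemma poly_op_mult:
  assumes "bounded_clinear R"
  shows "poly_op (p * q) R x = poly_op p R (poly_op q R x)"
proof (induction p)
  case (pCons a p)
  thus ?case by (simp add: poly_op_add poly_op_smult poly_op_pCons[OF assms])
qed simp

text \<open>Quantifying over all approximating sequences makes the value depend on \<open>f\<close>
  only through its values on the closed disk. Where no sequence of polynomials approximates
  \<open>f\<close>, the value is unspecified.\<close>

definition disk_calculus :: "('a::complex_inner \<Rightarrow> 'a) \<Rightarrow> (complex \<Rightarrow> complex) \<Rightarrow> 'a \<Rightarrow> 'a" where
  "disk_calculus T f x = (THE y. \<forall>p. poly_approx p f \<longrightarrow> (\<lambda>n. poly_op (p n) T x) \<longlonglongrightarrow> y)"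

locale poly_bounded =
  fixes T :: "'a::complex_hilbert_space \<Rightarrow> 'a" and M :: real
  assumes clinear_T: "bounded_clinear T" and M_pos: "M > 0"
    and onorm_poly_op: "\<And>p. onorm (poly_op p T) \<le> M * (SUP z\<in>cball 0 1. cmod (poly p z))"
begin

abbreviation calc where "calc \<equiv> disk_calculus T"

lemma norm_poly_op_le:
  assumes "\<And>z. cmod z \<le> 1 \<Longrightarrow> cmod (poly p z) \<le> K"
  shows "norm (poly_op p T x) \<le> M * K * norm x"
proof -
  have "norm (poly_op p T x) \<le> onorm (poly_op p T) * norm x"
    by (intro onorm bounded_clinear_linear bounded_clinear_poly_op clinear_T)
  also have "onorm (poly_op p T) \<le> M * (SUP z\<in>cball 0 1. cmod (poly p z))" by (rule onorm_poly_op)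
  also have "(SUP z\<in>cball 0 1. cmod (poly p z)) \<le> K"
    using assms by (intro cSUP_least) auto
  finally show ?thesis using M_pos by (simp add: mult_left_mono mult_right_mono)
qed

text \<open>The bound holds for all \<open>x\<close> at once, so that it can be applied to vectors
  that change with \<open>n\<close>, as in the product rule.\<close>

lemma poly_approx_bound:
  assumes "poly_approx p f" "\<And>z. cmod z \<le> 1 \<Longrightarrow> cmod (f z) \<le> K" "e > 0"
  shows "eventually (\<lambda>n. \<forall>x. norm (poly_op (p n) T x) \<le> M * (K + e) * norm x) sequentially"
proof -
  have "eventually (\<lambda>n. \<forall>z\<in>cball 0 1. dist (poly (p n) z) (f z) < e) sequentially"
    using uniform_limitD[OF assms(1)[unfolded poly_approx_def] assms(3)] .
  thus ?thesis
  proof eventually_elim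
    case (elim n)
    show ?case
    proof (intro allI norm_poly_op_le)
      fix z :: complex assume "cmod z \<le> 1"
      thus "cmod (poly (p n) z) \<le> K + e"
        using elim assms(2)[of z] norm_triangle_sub[of "poly (p n) z" "f z"] by (force simp: dist_norm)
    qed
  qed
qed

lemma poly_approx_0:
  assumes "poly_approx p (\<lambda>_. 0)"
  shows "(\<lambda>n. poly_op (p n) T x) \<longlonglongrightarrow> 0"
proof (rule LIMSEQ_I)
  fix r :: real assume r: "r > 0"
  \<comment> \<open>Adding 1 keeps the denominator of \<open>e\<close> positive when
    \<open>x = 0\<close>.\<close>
  define l where "l = norm x + 1"
  have l: "l > 0" "norm x \<le> l" using norm_ge_zero[of x] by (simp_all add: l_def del: norm_ge_zero)
  define e where "e = r / (2 * M * l)"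
  have e: "e > 0" using r M_pos l by (simp add: e_def)
  have "M * (0 + e) * norm x \<le> M * e * l"
    using e M_pos l by (intro mult_mono) auto
  also have "\<dots> = r / 2" using M_pos l by (simp add: e_def)
  finally have *: "M * (0 + e) * norm x < r" using r by simp
  have "eventually (\<lambda>n. norm (poly_op (p n) T x) < r) sequentially"
    using poly_approx_bound[OF assms _ e, of 0] * by (auto elim!: eventually_mono intro: le_less_trans)
  thus "\<exists>N. \<forall>n\<ge>N. norm (poly_op (p n) T x - 0) < r" by (simp add: eventually_sequentially)
qed

lemma poly_approx_Cauchy:
  assumes "poly_approx p f"
  shows "Cauchy (\<lambda>n. poly_op (p n) T x)"
proof (rule CauchyI)
  fix r :: real assume r: "r > 0"
  define l where "l = norm x + 1"
  have l: "l > 0" "norm x \<le> l" using norm_ge_zero[of x] by (simp_all add: l_def del: norm_ge_zero)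
  define e where "e = r / (2 * M * l)"
  have e: "e > 0" using r M_pos l by (simp add: e_def)
  have "M * e * norm x \<le> M * e * l"
    using e M_pos l by (intro mult_mono) auto
  also have "\<dots> = r / 2" using M_pos l by (simp add: e_def)
  finally have *: "M * e * norm x < r" using r by simp
  have "eventually (\<lambda>n. \<forall>z\<in>cball 0 1. dist (poly (p n) z) (f z) < e / 2) sequentially"
    using uniform_limitD[OF assms(1)[unfolded poly_approx_def], of "e / 2"] e by simp
  then obtain N where N: "\<And>n z. n \<ge> N \<Longrightarrow> cmod z \<le> 1 \<Longrightarrow> dist (poly (p n) z) (f z) < e / 2"
    unfolding eventually_sequentially by (metis mem_cball_0)
  have "norm (poly_op (p m) T x - poly_op (p n) T x) < r" if "m \<ge> N" "n \<ge> N" for m n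
  proof -
    have "norm (poly_op (p m - p n) T x) \<le> M * e * norm x"
    proof (rule norm_poly_op_le)
      fix z :: complex assume z: "cmod z \<le> 1"
      have "dist (poly (p m) z) (poly (p n) z) < e"
        using N[OF that(1) z] N[OF that(2) z] by (rule dist_triangle_half_l)
      thus "cmod (poly (p m - p n) z) \<le> e" by (simp add: dist_norm)
    qed
    thus ?thesis using * by (simp add: poly_op_diff)
  qed
  thus "\<exists>N. \<forall>m\<ge>N. \<forall>n\<ge>N. norm (poly_op (p m) T x - poly_op (p n) T x) < r" by blast
qed

lemma calc_limit:
  assumes "f analytic_on cball 0 1" "poly_approx p f"
  shows "(\<lambda>n. poly_op (p n) T x) \<longlonglongrightarrow> calc f x"
proof -
  obtain q where q: "poly_approx q f" using poly_approx_exists[OF assms(1)] ..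
  obtain y where y: "(\<lambda>n. poly_op (q n) T x) \<longlonglongrightarrow> y"
    using Cauchy_convergent[OF poly_approx_Cauchy[OF q]] convergent_def by blast
  have all: "(\<lambda>n. poly_op (p n) T x) \<longlonglongrightarrow> y" if p: "poly_approx p f" for p
  proof -
    have "poly_approx (\<lambda>n. p n - q n) (\<lambda>_. 0)"
      using uniform_limit_minus[OF p[unfolded poly_approx_def] q[unfolded poly_approx_def]]
      by (simp add: poly_approx_def)
    from tendsto_add[OF poly_approx_0[OF this, of x] y] show ?thesis by (simp add: poly_op_diff)
  qed
  have "\<forall>p. poly_approx p f \<longrightarrow> (\<lambda>n. poly_op (p n) T x) \<longlonglongrightarrow> calc f x"
    unfolding disk_calculus_def
    by (rule theI[of _ y]) (use all q LIMSEQ_unique in blast)+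
  thus ?thesis using assms(2) by blast
qed

lemma calc_bound:
  assumes f: "f analytic_on cball 0 1" and K: "\<And>z. cmod z \<le> 1 \<Longrightarrow> cmod (f z) \<le> K"
  shows "norm (calc f x) \<le> M * K * norm x"
proof -
  obtain p where p: "poly_approx p f" using poly_approx_exists[OF f] ..
  have "norm (calc f x) \<le> M * (K + e) * norm x" if "e > 0" for e
  proof (rule tendsto_upperbound[OF tendsto_norm[OF calc_limit[OF f p]]])
    show "\<forall>\<^sub>F n in sequentially. norm (poly_op (p n) T x) \<le> M * (K + e) * norm x"
      using poly_approx_bound[OF p K that] by (rule eventually_mono) auto
  qed simp
  note * = this
  show ?thesis
  proof (rule tendsto_lowerbound[of "\<lambda>e. M * (K + e) * norm x" _ "at_right 0"])
    have "((\<lambda>e. M * (K + e) * norm x) \<longlongrightarrow> M * (K + 0) * norm x) (at_right 0)"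
      by (intro tendsto_intros)
    thus "((\<lambda>e. M * (K + e) * norm x) \<longlongrightarrow> M * K * norm x) (at_right 0)" by simp
    show "\<forall>\<^sub>F e in at_right 0. norm (calc f x) \<le> M * (K + e) * norm x"
      using * by (auto simp: eventually_at_right_less intro: eventually_at_rightI[of 0 1])
  qed simp
qed

lemma calc_bounded_clinear:
  assumes f: "f analytic_on cball 0 1"
  shows "bounded_clinear (calc f)"
proof -
  obtain p where p: "poly_approx p f" using poly_approx_exists[OF f] ..
  note lim = calc_limit[OF f p]
  note P = bounded_clinear_poly_op[OF clinear_T]
  have "compact (f ` cball 0 1)"
    by (intro compact_continuous_image holomorphic_on_imp_continuous_on
        analytic_imp_holomorphic f compact_cball)
  then obtain K where K: "\<And>z. cmod z \<le> 1 \<Longrightarrow> cmod (f z) \<le> K"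
    using compact_imp_bounded[of "f ` cball 0 1"] unfolding bounded_iff by fastforce
  show ?thesis
  proof (rule bounded_clinearI)
    show "calc f (x + y) = calc f x + calc f y" for x y
    proof (rule LIMSEQ_unique[OF lim])
      show "(\<lambda>n. poly_op (p n) T (x + y)) \<longlonglongrightarrow> calc f x + calc f y"
        unfolding bounded_clinear_simps(1)[OF P] by (intro tendsto_intros lim)
    qed
    show "calc f (c *\<^sub>C x) = c *\<^sub>C calc f x" for c x
    proof (rule LIMSEQ_unique[OF lim])
      show "(\<lambda>n. poly_op (p n) T (c *\<^sub>C x)) \<longlonglongrightarrow> c *\<^sub>C calc f x"
        unfolding bounded_clinear_scaleC[OF P] by (intro tendsto_scaleC lim)
    qed
    show "norm (calc f x) \<le> (M * K) * norm x" for x using calc_bound[OF f K] .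
  qed
qed

lemma calc_cong:
  assumes "\<And>z. cmod z \<le> 1 \<Longrightarrow> f z = g z"
  shows "calc f = calc g"
proof -
  have "poly_approx p f \<longleftrightarrow> poly_approx p g" for p
    unfolding poly_approx_def using assms by (intro uniform_limit_cong') auto
  thus ?thesis by (simp add: disk_calculus_def fun_eq_iff)
qed

lemma poly_analytic: "poly p analytic_on S" for p :: "complex poly"
  by (induction p) (auto simp: poly_pCons intro!: analytic_intros)

lemma calc_poly: "calc (poly p) = poly_op p T"
proof
  fix x
  have "poly_approx (\<lambda>_. p) (poly p)" by (simp add: poly_approx_def uniform_limit_const)
  from calc_limit[OF _ this, of x] show "calc (poly p) x = poly_op p T x"
    by (simp add: LIMSEQ_const_iff poly_analytic)
qed

lemma calc_const: "calc (\<lambda>_. c) x = c *\<^sub>C x"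
  using fun_cong[OF calc_poly[of "[:c:]"], of x] calc_cong[of "poly [:c:]" "\<lambda>z. c"] by (simp add: poly_op_def)

lemma calc_ident: "calc (\<lambda>z. z) x = T x"
  using fun_cong[OF calc_poly[of "[:0, 1:]"], of x] calc_cong[of "poly [:0, 1:]" "\<lambda>z. z"] by (simp add: poly_op_def)

lemma calc_add:
  assumes f: "f analytic_on cball 0 1" and g: "g analytic_on cball 0 1"
  shows "calc (\<lambda>z. f z + g z) x = calc f x + calc g x"
proof -
  obtain p q where p: "poly_approx p f" and q: "poly_approx q g"
    using poly_approx_exists f g by metis
  have pq: "poly_approx (\<lambda>n. p n + q n) (\<lambda>z. f z + g z)"
    using uniform_limit_add[OF p[unfolded poly_approx_def] q[unfolded poly_approx_def]]
    by (simp add: poly_approx_def)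
  have "(\<lambda>n. poly_op (p n) T x + poly_op (q n) T x) \<longlonglongrightarrow> calc f x + calc g x"
    by (intro tendsto_intros calc_limit p q f g)
  from LIMSEQ_unique[OF calc_limit[OF _ pq] this[folded poly_op_add]]
  show ?thesis by (simp add: analytic_intros f g)
qed

lemma calc_mult:
  assumes f: "f analytic_on cball 0 1" and g: "g analytic_on cball 0 1"
  shows "calc (\<lambda>z. f z * g z) x = calc f (calc g x)"
proof -
  obtain p q where p: "poly_approx p f" and q: "poly_approx q g"
    using poly_approx_exists f g by metis
  have bd: "bounded (h ` cball 0 1)" if "h analytic_on cball 0 1" for h :: "complex \<Rightarrow> complex"
    by (intro compact_imp_bounded compact_continuous_image holomorphic_on_imp_continuous_on
        analytic_imp_holomorphic that compact_cball)
  have pq: "poly_approx (\<lambda>n. p n * q n) (\<lambda>z. f z * g z)"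
    using uniform_lim_mult[OF p[unfolded poly_approx_def] q[unfolded poly_approx_def] bd[OF f] bd[OF g]]
    by (simp add: poly_approx_def)
  obtain K where K: "\<And>z. cmod z \<le> 1 \<Longrightarrow> cmod (f z) \<le> K"
    using bd[OF f] unfolding bounded_iff by fastforce
  \<comment> \<open>This is the part of the error where the inner vector varies with
    \<open>n\<close>; it is small because the operators \<open>poly_op (p n) T\<close> are
    eventually uniformly bounded.\<close>
  have "(\<lambda>n. poly_op (p n) T (poly_op (q n) T x - calc g x)) \<longlonglongrightarrow> 0"
  proof (rule Lim_null_comparison)
    show "\<forall>\<^sub>F n in sequentially. norm (poly_op (p n) T (poly_op (q n) T x - calc g x))
        \<le> M * (K + 1) * norm (poly_op (q n) T x - calc g x)"
      using poly_approx_bound[OF p K zero_less_one] by (rule eventually_mono) auto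
    show "(\<lambda>n. M * (K + 1) * norm (poly_op (q n) T x - calc g x)) \<longlonglongrightarrow> 0"
      by (intro tendsto_mult_right_zero tendsto_norm_zero LIM_zero calc_limit g q)
  qed
  from tendsto_add[OF this calc_limit[OF f p, of "calc g x"]]
  have "(\<lambda>n. poly_op (p n * q n) T x) \<longlonglongrightarrow> calc f (calc g x)"
    by (simp add: bounded_clinear_simps[OF bounded_clinear_poly_op[OF clinear_T]] poly_op_mult[OF clinear_T])
  from LIMSEQ_unique[OF calc_limit[OF _ pq] this] show ?thesis by (simp add: analytic_intros f g)
qed

lemma calc_commute:
  assumes "f analytic_on cball 0 1" "g analytic_on cball 0 1"
  shows "calc f (calc g x) = calc g (calc f x)"
  using calc_mult[OF assms, of x] calc_mult[OF assms(2,1), of x] by (simp add: mult.commute)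

lemma calc_scale:
  assumes "f analytic_on cball 0 1"
  shows "calc (\<lambda>z. c * f z) x = c *\<^sub>C calc f x"
  using calc_mult[OF _ assms, of "\<lambda>_. c" x] by (simp add: calc_const)

lemma calc_diff:
  assumes "f analytic_on cball 0 1" "g analytic_on cball 0 1"
  shows "calc (\<lambda>z. f z - g z) x = calc f x - calc g x"
  using calc_add[OF assms(1), of "\<lambda>z. (-1) * g z" x] calc_scale[OF assms(2), of "-1" x] assms
  by (simp add: scaleC_minus_left analytic_intros)

lemma calc_sum:
  assumes "\<And>i. i \<in> A \<Longrightarrow> f i analytic_on cball 0 1"
  shows "calc (\<lambda>z. \<Sum>i\<in>A. f i z) x = (\<Sum>i\<in>A. calc (f i) x)"
  using assms
  by (induction A rule: infinite_finite_induct) (simp_all add: calc_const calc_add analytic_on_sum)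

end

subsection \<open>The circle measure and Poisson integrals\<close>

lemma space_circle [simp]: "space circle_measure = sphere 0 1"
  by (simp add: circle_measure_def)

lemma sets_circle: "sets circle_measure = sets (restrict_space borel (sphere 0 1))"
  by (simp add: circle_measure_def)

lemma measurable_cis_circle:
  "cis \<in> uniform_measure lborel {0..2 * pi} \<rightarrow>\<^sub>M restrict_space borel (sphere 0 1)"
proof (rule measurable_restrict_space2)
  have "cis \<in> borel_measurable borel"
    by (intro borel_measurable_continuous_onI continuous_intros)
  thus "cis \<in> borel_measurable (uniform_measure lborel {0..2 * pi})" by simp
qed auto

lemma emeasure_circle_space [simp]: "emeasure circle_measure (sphere 0 1) = 1"
proof -
  have "emeasure circle_measure (sphere 0 1) = 
      emeasure (uniform_measure lborel {0..2*pi}) (cis -` sphere 0 1 \<inter> space (uniform_measure lborel {0..2*pi}))"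
    unfolding circle_measure_def
    by (rule emeasure_distr[OF measurable_cis_circle]) (simp add: sets_restrict_space image_iff, rule bexI[of _ UNIV], auto)
  also have "cis -` sphere 0 1 \<inter> space (uniform_measure lborel {0..2*pi}) = UNIV" by auto
  also have "emeasure (uniform_measure lborel {0..2*pi}) UNIV = 1"
    by (subst emeasure_uniform_measure) (auto simp: ennreal_divide_self)
  finally show ?thesis .
qed

interpretation circle: finite_measure circle_measure
  by standard simp

lemma borel_measurable_circle_continuous:
  fixes f :: "complex \<Rightarrow> 'b::topological_space"
  assumes "continuous_on (sphere 0 1) f"
  shows "f \<in> borel_measurable circle_measure"
  using borel_measurable_continuous_on_restrict[OF assms]
  by (simp only: measurable_cong_sets[OF sets_circle refl])

lemma AE_circle_norm: "AE \<zeta> in circle_measure. cmod \<zeta> = 1"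
  by (rule AE_I2) simp

lemma integrable_circle_bounded:
  fixes f :: "complex \<Rightarrow> 'b::{banach, second_countable_topology}"
  assumes "f \<in> borel_measurable circle_measure" "\<And>\<zeta>. cmod \<zeta> = 1 \<Longrightarrow> norm (f \<zeta>) \<le> K"
  shows "integrable circle_measure f"
  by (rule circle.integrable_const_bound[of _ K, OF AE_I2 assms(1)]) (simp add: assms(2))

lemma integrable_circle_continuous:
  fixes f :: "complex \<Rightarrow> 'b::{banach, second_countable_topology}"
  assumes "continuous_on (sphere 0 1) f"
  shows "integrable circle_measure f"
proof -
  have "compact (f ` sphere 0 1)" using assms by (intro compact_continuous_image) auto
  then obtain K where "\<And>\<zeta>. cmod \<zeta> = 1 \<Longrightarrow> norm (f \<zeta>) \<le> K"
    using compact_imp_bounded[of "f ` sphere 0 1"] unfolding bounded_iff by fastforce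
  thus ?thesis using borel_measurable_circle_continuous[OF assms] by (rule integrable_circle_bounded[rotated])
qed

text \<open>The average over an angle is the form in which Cauchy's integral formula is
  available.\<close>

lemma integral_circle_eq:
  fixes f :: "complex \<Rightarrow> complex"
  assumes "continuous_on (sphere 0 1) f"
  shows "(LINT \<zeta>|circle_measure. f \<zeta>) = integral {0..2*pi} (\<lambda>t. f (cis t)) / (2 * pi)"
proof -
  have c: "continuous_on {0..2*pi} (\<lambda>t. f (cis t))"
    by (rule continuous_on_compose2[OF assms]) (auto intro!: continuous_intros)
  have m: "f \<in> borel_measurable (restrict_space borel (sphere 0 1))"
    using borel_measurable_continuous_on_restrict[OF assms] .
  have mc: "(\<lambda>t. f (cis t)) \<in> borel_measurable lborel"
    using measurable_compose[OF measurable_cis_circle m]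
    by (simp only: measurable_cong_sets[OF sets_uniform_measure refl])
  have "(LINT \<zeta>|circle_measure. f \<zeta>) = (LINT t|uniform_measure lborel {0..2*pi}. f (cis t))"
    unfolding circle_measure_def by (rule integral_distr[OF measurable_cis_circle m])
  also have "\<dots> = (LINT t|lborel. (indicat_real {0..2*pi} t / (2*pi)) *\<^sub>R f (cis t))"
  proof -
    have "uniform_measure lborel {0..2*pi} = density lborel (\<lambda>t. ennreal (indicat_real {0..2*pi} t / (2*pi)))"
      unfolding uniform_measure_def
      by (intro arg_cong[of _ _ "density lborel"] ext)
        (auto simp: indicator_def divide_ennreal[symmetric])
    thus ?thesis using mc by (simp add: integral_density)
  qed
  also have "\<dots> = (LINT t|lborel. indicat_real {0..2*pi} t *\<^sub>R f (cis t)) /\<^sub>R (2*pi)"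
  proof -
    have "(\<lambda>t. (indicat_real {0..2*pi} t / (2*pi)) *\<^sub>R f (cis t)) =
        (\<lambda>t. inverse (2*pi) *\<^sub>R (indicat_real {0..2*pi} t *\<^sub>R f (cis t)))"
      by (simp only: scaleR_scaleR divide_inverse mult.commute)
    thus ?thesis by (simp only: integral_scaleR_right)
  qed
  also have "(LINT t|lborel. indicat_real {0..2*pi} t *\<^sub>R f (cis t)) = integral {0..2*pi} (\<lambda>t. f (cis t))"
    using set_borel_integral_eq_integral(2)[of "{0..2*pi}" "\<lambda>t. f (cis t)"]
      borel_integrable_atLeastAtMost'[OF c] by (simp add: set_lebesgue_integral_def)
  finally show ?thesis by (simp add: scaleR_conv_of_real field_simps)
qed

text \<open>Cauchy's integral formula: on the circle \<open>d\<zeta> = \<i> * \<zeta> dt\<close>, so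
  \<open>\<zeta> / (\<zeta> - z)\<close> is the Cauchy kernel with respect to normalised arc
  length.\<close>

lemma mean_value_circle:
  assumes "f analytic_on cball 0 1"
    and that: "cmod z < 1"
  shows "(LINT \<zeta>|circle_measure. f \<zeta> * (\<zeta> / (\<zeta> - z))) = f z"
proof -
  have hol: "f holomorphic_on cball 0 1" using analytic_imp_holomorphic[OF assms(1)] .
  have cont: "continuous_on (cball 0 1) f" using holomorphic_on_imp_continuous_on[OF hol] .
  have "continuous_on (sphere 0 1) (\<lambda>\<zeta>. f \<zeta> * (\<zeta> / (\<zeta> - z)))"
    using that by (intro continuous_intros continuous_on_subset[OF cont]) auto
  hence "(LINT \<zeta>|circle_measure. f \<zeta> * (\<zeta> / (\<zeta> - z))) =
      integral {0..2*pi} (\<lambda>t. f (cis t) * (cis t / (cis t - z))) / (2 * pi)"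
    by (rule integral_circle_eq)
  also have "integral {0..2*pi} (\<lambda>t. f (cis t) * (cis t / (cis t - z))) = 2 * pi * f z"
  proof -
    have "((\<lambda>u. f u / (u - z)) has_contour_integral (2 * of_real pi * \<i> * f z)) (circlepath 0 1)"
      by (rule Cauchy_integral_circlepath)
        (use cont hol that in \<open>auto intro: holomorphic_on_subset\<close>)
    hence "((\<lambda>t. f (cis t) / (cis t - z) * \<i> * cis t) has_integral (2 * of_real pi * \<i> * f z)) {0..2*pi}"
      unfolding circlepath_def by (subst (asm) has_contour_integral_part_circlepath_iff) (auto simp: mult_ac)
    hence "((\<lambda>t. (- \<i>) * (f (cis t) / (cis t - z) * \<i> * cis t)) has_integral (- \<i>) * (2 * of_real pi * \<i> * f z)) {0..2*pi}"
      by (rule has_integral_mult_right)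
    hence "((\<lambda>t. f (cis t) * (cis t / (cis t - z))) has_integral 2 * pi * f z) {0..2*pi}"
      by (simp add: mult_ac)
    thus ?thesis by (rule integral_unique)
  qed
  finally show ?thesis by simp
qed

text \<open>For \<open>cmod w = 1\<close> this is the Poisson kernel; for \<open>cmod w < 1\<close> it is its harmonic extension in \<open>w\<close>.\<close>

definition poisson :: "complex \<Rightarrow> complex \<Rightarrow> real" where
  "poisson z w = (1 - (cmod z * cmod w)\<^sup>2) / (cmod (1 - cnj z * w))\<^sup>2"

lemma one_minus_cnj_mult_neq_0:
  assumes "cmod z < 1" "cmod w \<le> 1"
  shows "1 - cnj z * w \<noteq> 0"
proof
  assume "1 - cnj z * w = 0"
  hence "cmod (cnj z * w) = 1" by simp
  moreover have "cmod z * cmod w < 1"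
    using assms by (metis mult_left_le norm_ge_zero order.strict_trans1)
  ultimately show False by (simp add: norm_mult)
qed

lemma poisson_eq_Re:
  assumes "cmod z < 1" "cmod w \<le> 1"
  shows "poisson z w = Re ((1 + cnj z * w) / (1 - cnj z * w))"
proof -
  have "Re ((1 + u) / (1 - u)) = (1 - (cmod u)\<^sup>2) / (cmod (1 - u))\<^sup>2" for u
    unfolding cmod_power2 Re_divide by (simp add: power2_eq_square algebra_simps)
  from this[of "cnj z * w"] show ?thesis by (simp add: poisson_def norm_mult)
qed

lemma poisson_nonneg: "cmod z < 1 \<Longrightarrow> cmod w \<le> 1 \<Longrightarrow> 0 \<le> poisson z w"
  unfolding poisson_def
  by (intro divide_nonneg_nonneg) (auto intro!: power_le_one mult_le_one)

text \<open>Cauchy's formula is applied to \<open>g\<close>, which equals \<open>f\<close> at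
  \<open>z\<close>. On the circle
  \<open>\<zeta> / (\<zeta> - z) = 1 / (1 - z * cnj \<zeta>)\<close>, and this completes the extra
  factor of \<open>g\<close> to the Poisson kernel.\<close>

lemma poisson_formula:
  assumes f: "f analytic_on cball 0 1" and z: "cmod z < 1"
  shows "(LINT \<zeta>|circle_measure. f \<zeta> * of_real (poisson z \<zeta>)) = f z"
proof -
  define g where "g w = f w * ((1 - z * cnj z) / (1 - cnj z * w))" for w
  have g: "g analytic_on cball 0 1"
    unfolding g_def using one_minus_cnj_mult_neq_0[OF z]
    by (intro analytic_intros f) auto
  have "(LINT \<zeta>|circle_measure. f \<zeta> * of_real (poisson z \<zeta>)) =
      (LINT \<zeta>|circle_measure. g \<zeta> * (\<zeta> / (\<zeta> - z)))"
  proof (rule Bochner_Integration.integral_cong[OF refl])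
    fix \<zeta> assume "\<zeta> \<in> space circle_measure"
    hence n: "cmod \<zeta> = 1" by simp
    hence zz: "\<zeta> * cnj \<zeta> = 1" by (simp add: complex_norm_square[symmetric])
    have nz: "1 - cnj z * \<zeta> \<noteq> 0" using one_minus_cnj_mult_neq_0[OF z, of \<zeta>] n by simp
    have nz2: "\<zeta> - z \<noteq> 0" using z n by auto
    have "of_real ((cmod (1 - cnj z * \<zeta>))\<^sup>2) = (1 - cnj z * \<zeta>) * (1 - z * cnj \<zeta>)"
      unfolding complex_norm_square by simp
    moreover have "\<zeta> * (1 - z * cnj \<zeta>) = \<zeta> - z" using zz by (simp add: algebra_simps)
    hence "1 - z * cnj \<zeta> = (\<zeta> - z) / \<zeta>"
      using n by (metis nonzero_mult_div_cancel_left norm_zero zero_neq_one)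
    ultimately show "f \<zeta> * of_real (poisson z \<zeta>) = g \<zeta> * (\<zeta> / (\<zeta> - z))"
      unfolding poisson_def g_def using n nz nz2 complex_norm_square[of z]
      by (auto simp: power_mult_distrib)
  qed
  also have "\<dots> = g z" by (rule mean_value_circle[OF g z])
  also have "g z = f z"
    using one_minus_cnj_mult_neq_0[OF z, of z] z by (simp add: g_def mult.commute)
  finally show ?thesis .
qed

lemma continuous_poisson:
  assumes "cmod z < 1"
  shows "continuous_on (sphere 0 1) (poisson z)"
  unfolding poisson_def using one_minus_cnj_mult_neq_0[OF assms]
  by (intro continuous_intros) auto

lemma integral_poisson: "cmod z < 1 \<Longrightarrow> (LINT \<zeta>|circle_measure. poisson z \<zeta>) = 1"
  using poisson_formula[of "\<lambda>_. 1" z] by (simp add: analytic_intros flip: of_real_eq_iff)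

lemma poisson_commute: "poisson z w = poisson w z"
proof -
  have "cnj (1 - cnj z * w) = 1 - cnj w * z" by (simp add: mult.commute)
  hence "cmod (1 - cnj z * w) = cmod (1 - cnj w * z)" by (metis complex_mod_cnj)
  thus ?thesis by (simp add: poisson_def mult.commute)
qed

text \<open>The semigroup property: \<open>poisson z\<close> is the real part of a function analytic
  on the closed disk, to which the Poisson formula at \<open>w\<close> applies.\<close>

lemma integral_poisson_poisson:
  assumes "cmod z < 1" "cmod w < 1"
  shows "(LINT \<zeta>|circle_measure. poisson z \<zeta> * poisson w \<zeta>) = poisson z w"
proof -
  define f where "f u = (1 + cnj z * u) / (1 - cnj z * u)" for u
  have f: "f analytic_on cball 0 1"
    unfolding f_def using one_minus_cnj_mult_neq_0[OF assms(1)]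
    by (intro analytic_intros) auto
  have cont: "continuous_on (sphere 0 1) f"
    by (rule continuous_on_subset[OF holomorphic_on_imp_continuous_on[OF analytic_imp_holomorphic[OF f]]]) auto
  have "poisson z w = Re (f w)" using assms by (simp add: poisson_eq_Re f_def)
  also have "f w = (LINT \<zeta>|circle_measure. f \<zeta> * of_real (poisson w \<zeta>))"
    using poisson_formula[OF f assms(2)] by simp
  also have "Re \<dots> = (LINT \<zeta>|circle_measure. Re (f \<zeta> * of_real (poisson w \<zeta>)))"
    by (intro integral_Re[symmetric] integrable_circle_continuous continuous_intros cont continuous_poisson assms)
  also have "\<dots> = (LINT \<zeta>|circle_measure. poisson z \<zeta> * poisson w \<zeta>)"
  proof (rule Bochner_Integration.integral_cong[OF refl])
    fix \<zeta> assume "\<zeta> \<in> space circle_measure"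
    hence "poisson z \<zeta> = Re (f \<zeta>)" using assms by (simp add: poisson_eq_Re f_def)
    thus "Re (f \<zeta> * of_real (poisson w \<zeta>)) = poisson z \<zeta> * poisson w \<zeta>" by simp
  qed
  finally show ?thesis ..
qed

text \<open>Moving the point with the larger radius \<open>s\<close> out to the circle costs a
  factor 8: 4 from the denominators, as \<open>e \<le> 2 * d\<close>, and 2 from the numerators, as
  \<open>r * r \<le> r * s\<close>.\<close>

lemma poisson_dilation_le:
  assumes "cmod \<zeta> = 1" "cmod \<xi> = 1" "0 \<le> r" "r \<le> s" "s < 1"
  shows "poisson (of_real r * \<zeta>) (of_real s * \<xi>) \<le> 8 * poisson (of_real r * \<zeta>) \<xi>"
proof -
  define u where "u = cnj \<zeta> * \<xi>"
  have u: "cmod u = 1" using assms by (simp add: u_def norm_mult)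
  define d where "d = cmod (1 - of_real (r * s) * u)"
  define e where "e = cmod (1 - of_real r * u)"
  have rs: "r * s < 1" "0 \<le> r * s" "r * s \<le> r" using assms
    by (auto intro: le_less_trans[OF mult_left_le] mult_left_le)
  have d: "1 - r * s \<le> d"
    using norm_triangle_ineq2[of 1 "of_real (r * s) * u"] u rs by (simp add: d_def norm_mult del: of_real_mult)
  have "1 - of_real r * u = (1 - of_real (r * s) * u) - of_real (r * (1 - s)) * u" by (simp add: algebra_simps)
  hence "e \<le> d + cmod (of_real (r * (1 - s)) * u)"
    unfolding e_def d_def by (metis norm_triangle_ineq4)
  also have "cmod (of_real (r * (1 - s)) * u) = r * (1 - s)"
    using u assms by (simp add: norm_mult del: of_real_mult of_real_diff)
  also have "r * (1 - s) \<le> 1 - s" using assms by (intro mult_left_le_one_le) auto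
  also have "1 - s \<le> 1 - r * s" using assms by (simp add: mult_left_le_one_le)
  also have "1 - r * s \<le> d" by (rule d)
  finally have ed: "e \<le> 2 * d" by simp
  have "0 < e"
    using norm_triangle_ineq2[of 1 "of_real r * u"] u assms by (auto simp: e_def norm_mult)
  have num: "1 - (r * s)\<^sup>2 \<le> 2 * (1 - r\<^sup>2)"
  proof -
    have "r * r \<le> r * s" using assms by (intro mult_left_mono) auto
    hence "(r * r)\<^sup>2 \<le> (r * s)\<^sup>2" using assms by (intro power_mono) auto
    moreover have "(1 - r\<^sup>2) * (1 + r\<^sup>2) \<le> (1 - r\<^sup>2) * 2"
      using assms by (intro mult_left_mono) (auto simp: power_le_one)
    ultimately show ?thesis by (simp add: power2_eq_square algebra_simps)
  qed
  have "poisson (of_real r * \<zeta>) (of_real s * \<xi>) = (1 - (r * s)\<^sup>2) / d\<^sup>2"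
    using assms by (simp add: poisson_def d_def u_def norm_mult mult_ac)
  also have "\<dots> \<le> 2 * (1 - r\<^sup>2) / (e\<^sup>2 / 4)"
  proof (rule frac_le[OF _ num])
    show "e\<^sup>2 / 4 \<le> d\<^sup>2" using power_mono[OF ed, of 2] \<open>0 < e\<close> by (simp add: power_mult_distrib)
  qed (use \<open>0 < e\<close> assms in \<open>auto simp: power_le_one\<close>)
  also have "\<dots> = 8 * poisson (of_real r * \<zeta>) \<xi>"
    using assms by (simp add: poisson_def e_def u_def norm_mult mult_ac)
  finally show ?thesis .
qed

subsection \<open>A weak type inequality for the radial maximal function\<close>

abbreviation circle_product :: "(complex \<times> complex) measure" where
  "circle_product \<equiv> circle_measure \<Otimes>\<^sub>M circle_measure"

text \<open>Bounded measurable functions and kernels on the circle are closed under products,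
  sections and partial integrals, so every use of Fubini's theorem below reduces to membership in
  these classes.\<close>

definition bounded_kernel :: "(complex \<Rightarrow> complex \<Rightarrow> real) \<Rightarrow> bool" where
  "bounded_kernel k \<longleftrightarrow> case_prod k \<in> borel_measurable circle_product \<and>
     (\<exists>K. \<forall>\<zeta> \<xi>. cmod \<zeta> = 1 \<longrightarrow> cmod \<xi> = 1 \<longrightarrow> \<bar>k \<zeta> \<xi>\<bar> \<le> K)"

definition bounded_fun :: "(complex \<Rightarrow> real) \<Rightarrow> bool" where
  "bounded_fun f \<longleftrightarrow> f \<in> borel_measurable circle_measure \<and> (\<exists>K. \<forall>\<zeta>. cmod \<zeta> = 1 \<longrightarrow> \<bar>f \<zeta>\<bar> \<le> K)"

interpretation circle_pair: pair_sigma_finite circle_measure circle_measure ..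

lemma finite_measure_circle_product: "finite_measure circle_product"
  by (intro finite_measure_pair_measure circle.finite_measure_axioms)

lemma bounded_fun_integrable: "bounded_fun f \<Longrightarrow> integrable circle_measure f"
  unfolding bounded_fun_def by (metis integrable_circle_bounded real_norm_def)

lemma bounded_kernel_integrable:
  assumes "bounded_kernel k"
  shows "integrable circle_product (case_prod k)"
proof -
  interpret finite_measure circle_product by (rule finite_measure_circle_product)
  obtain K where "\<And>\<zeta> \<xi>. cmod \<zeta> = 1 \<Longrightarrow> cmod \<xi> = 1 \<Longrightarrow> \<bar>k \<zeta> \<xi>\<bar> \<le> K"
    using assms unfolding bounded_kernel_def by metis
  thus ?thesis
    by (intro integrable_const_bound[of _ K]) (use assms in \<open>auto simp: space_pair_measure bounded_kernel_def\<close>)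
qed

lemma bounded_kernel_Fubini:
  assumes "bounded_kernel k"
  shows "(LINT \<zeta>|circle_measure. LINT \<xi>|circle_measure. k \<zeta> \<xi>) =
    (LINT \<xi>|circle_measure. LINT \<zeta>|circle_measure. k \<zeta> \<xi>)"
  using circle_pair.Fubini_integral[OF bounded_kernel_integrable[OF assms]] by simp

lemma bounded_kernel_section:
  assumes "bounded_kernel k" "cmod \<zeta> = 1"
  shows "bounded_fun (k \<zeta>)"
proof -
  have "(\<lambda>\<xi>. case_prod k (\<zeta>, \<xi>)) \<in> borel_measurable circle_measure"
    by (rule measurable_compose[OF measurable_Pair1']) (use assms in \<open>auto simp: bounded_kernel_def\<close>)
  thus ?thesis using assms by (auto simp: bounded_kernel_def bounded_fun_def)
qed

lemma bounded_kernel_swap: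
  assumes "bounded_kernel k"
  shows "bounded_kernel (\<lambda>\<zeta> \<xi>. k \<xi> \<zeta>)"
proof -
  have "(\<lambda>p. case_prod k (case p of (x, y) \<Rightarrow> (y, x))) \<in> borel_measurable circle_product"
    by (rule measurable_compose[OF measurable_pair_swap']) (use assms in \<open>auto simp: bounded_kernel_def\<close>)
  moreover have "(\<lambda>p. case_prod k (case p of (x, y) \<Rightarrow> (y, x))) = case_prod (\<lambda>\<zeta> \<xi>. k \<xi> \<zeta>)"
    by auto
  ultimately show ?thesis using assms by (auto simp: bounded_kernel_def)
qed

lemma bounded_kernel_fst:
  assumes "bounded_fun f"
  shows "bounded_kernel (\<lambda>\<zeta> \<xi>. f \<zeta>)"
  using assms measurable_compose[OF measurable_fst, of f circle_measure borel circle_measure]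
  by (auto simp: bounded_kernel_def bounded_fun_def case_prod_unfold)

lemma bounded_kernel_snd:
  assumes "bounded_fun f"
  shows "bounded_kernel (\<lambda>\<zeta> \<xi>. f \<xi>)"
  using bounded_kernel_swap[OF bounded_kernel_fst[OF assms]] .

lemma bounded_kernel_mult:
  assumes "bounded_kernel k" "bounded_kernel l"
  shows "bounded_kernel (\<lambda>\<zeta> \<xi>. k \<zeta> \<xi> * l \<zeta> \<xi>)"
proof -
  obtain K L where K: "\<And>\<zeta> \<xi>. cmod \<zeta> = 1 \<Longrightarrow> cmod \<xi> = 1 \<Longrightarrow> \<bar>k \<zeta> \<xi>\<bar> \<le> K"
    and L: "\<And>\<zeta> \<xi>. cmod \<zeta> = 1 \<Longrightarrow> cmod \<xi> = 1 \<Longrightarrow> \<bar>l \<zeta> \<xi>\<bar> \<le> L"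
    using assms unfolding bounded_kernel_def by metis
  have "\<bar>k \<zeta> \<xi> * l \<zeta> \<xi>\<bar> \<le> \<bar>K\<bar> * \<bar>L\<bar>" if "cmod \<zeta> = 1" "cmod \<xi> = 1" for \<zeta> \<xi>
    unfolding abs_mult using K[OF that] L[OF that] by (intro mult_mono) auto
  thus ?thesis using assms by (auto simp: bounded_kernel_def case_prod_unfold intro!: borel_measurable_times)
qed

lemma bounded_fun_integral:
  assumes "bounded_kernel k"
  shows "bounded_fun (\<lambda>\<zeta>. LINT \<xi>|circle_measure. k \<zeta> \<xi>)"
proof -
  obtain K where K: "\<And>\<zeta> \<xi>. cmod \<zeta> = 1 \<Longrightarrow> cmod \<xi> = 1 \<Longrightarrow> \<bar>k \<zeta> \<xi>\<bar> \<le> K"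
    using assms unfolding bounded_kernel_def by metis
  have "\<bar>LINT \<xi>|circle_measure. k \<zeta> \<xi>\<bar> \<le> K" if "cmod \<zeta> = 1" for \<zeta>
  proof -
    have "\<bar>LINT \<xi>|circle_measure. k \<zeta> \<xi>\<bar> \<le> (LINT \<xi>|circle_measure. \<bar>k \<zeta> \<xi>\<bar>)"
      by (rule integral_abs_bound)
    also have "\<dots> \<le> (LINT \<xi>|circle_measure. K)"
      by (intro integral_mono integrable_abs bounded_fun_integrable[OF bounded_kernel_section[OF assms that]])
        (use K that in auto)
    finally show ?thesis by (simp add: measure_def)
  qed
  moreover have "(\<lambda>\<zeta>. LINT \<xi>|circle_measure. k \<zeta> \<xi>) \<in> borel_measurable circle_measure"
    by (rule circle.borel_measurable_lebesgue_integral) (use assms in \<open>simp add: bounded_kernel_def\<close>)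
  ultimately show ?thesis by (auto simp: bounded_fun_def)
qed

lemma bounded_fun_mult:
  assumes "bounded_fun f" "bounded_fun g"
  shows "bounded_fun (\<lambda>\<zeta>. f \<zeta> * g \<zeta>)"
  using bounded_kernel_section[OF bounded_kernel_mult[OF bounded_kernel_snd[OF assms(1)]
    bounded_kernel_snd[OF assms(2)]], of 1] by simp

lemma bounded_fun_continuous:
  assumes "continuous_on (sphere 0 1) f"
  shows "bounded_fun f"
proof -
  have "compact (f ` sphere 0 1)" using assms by (intro compact_continuous_image) auto
  then obtain K where "\<And>\<zeta>. cmod \<zeta> = 1 \<Longrightarrow> norm (f \<zeta>) \<le> K"
    using compact_imp_bounded[of "f ` sphere 0 1"] unfolding bounded_iff by fastforce
  thus ?thesis using borel_measurable_circle_continuous[OF assms] by (auto simp: bounded_fun_def)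
qed

lemma poisson_abs_le:
  assumes "cmod z \<le> \<rho>" "\<rho> < 1" "cmod w = 1"
  shows "\<bar>poisson z w\<bar> \<le> 1 / (1 - \<rho>)\<^sup>2"
proof -
  have "1 - \<rho> \<le> cmod (1 - cnj z * w)"
    using norm_triangle_ineq2[of 1 "cnj z * w"] assms by (simp add: norm_mult)
  hence "(1 - \<rho>)\<^sup>2 \<le> (cmod (1 - cnj z * w))\<^sup>2" using assms by (intro power_mono) auto
  moreover have "0 < (1 - \<rho>)\<^sup>2" using assms by simp
  moreover have "0 \<le> 1 - (cmod z * cmod w)\<^sup>2" "1 - (cmod z * cmod w)\<^sup>2 \<le> 1"
    using assms by (auto simp: power_le_one)
  ultimately show ?thesis unfolding poisson_def abs_divide by (intro frac_le) auto
qed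

lemma cmod_le_poisson_integral:
  assumes "f analytic_on cball 0 1" "cmod z < 1"
  shows "cmod (f z) \<le> (LINT w|circle_measure. poisson z w * cmod (f w))"
proof -
  have "cmod (f z) \<le> (LINT w|circle_measure. cmod (f w * of_real (poisson z w)))"
    unfolding poisson_formula[OF assms, symmetric] by (rule integral_norm_bound)
  also have "\<dots> = (LINT w|circle_measure. poisson z w * cmod (f w))"
    by (rule Bochner_Integration.integral_cong)
      (use assms in \<open>auto simp: norm_mult poisson_nonneg mult.commute\<close>)
  finally show ?thesis .
qed

text \<open>
  The radius is linearised by a measurable choice \<open>z(\<zeta>)\<close> on the radius of \<open>\<zeta>\<close>. By the semigroup
  property of the Poisson kernel, the square of the adjoint of \<open>f \<mapsto> f(z(\<zeta>))\<close> at the indicator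
  function of \<open>E\<close> has the kernel \<open>poisson (z \<zeta>) (z \<xi>)\<close>, whose integral over \<open>E \<times> E\<close> is at most
  \<open>16 |E|\<close>.
\<close>

lemma weak_type_radial:
  fixes f :: "complex \<Rightarrow> complex"
  assumes f: "f analytic_on cball 0 1" and R: "finite R" "R \<noteq> {}" "R \<subseteq> {0..<1::real}" and e: "e > 0"
  shows "measure circle_measure {\<zeta>. cmod \<zeta> = 1 \<and> (\<exists>r\<in>R. cmod (f (of_real r * \<zeta>)) > e)}
    \<le> 16 / e\<^sup>2 * (LINT \<zeta>|circle_measure. (cmod (f \<zeta>))\<^sup>2)"
proof -
  define A where "A r = {\<zeta>. cmod \<zeta> = 1 \<and> cmod (f (of_real r * \<zeta>)) > e}" for r
  define E where "E = {\<zeta>. cmod \<zeta> = 1 \<and> (\<exists>r\<in>R. cmod (f (of_real r * \<zeta>)) > e)}"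
  have contf: "continuous_on (cball 0 1) f"
    by (intro holomorphic_on_imp_continuous_on analytic_imp_holomorphic f)
  have A: "A r \<in> sets circle_measure" if "r \<in> R" for r
  proof -
    have "r \<in> {0..<1}" using that R(3) by blast
    hence "continuous_on (sphere 0 1) (\<lambda>\<zeta>. cmod (f (of_real r * \<zeta>)))"
      by (intro continuous_intros continuous_on_compose2[OF contf]) (auto simp: norm_mult)
    hence "{\<zeta> \<in> space circle_measure. cmod (f (of_real r * \<zeta>)) > e} \<in> sets circle_measure"
      by (intro borel_measurable_less borel_measurable_const borel_measurable_circle_continuous)
    moreover have "A r = {\<zeta> \<in> space circle_measure. cmod (f (of_real r * \<zeta>)) > e}"
      by (auto simp: A_def)
    ultimately show ?thesis by simp
  qed
  have E_eq: "E = (\<Union>r\<in>R. A r)" by (auto simp: E_def A_def)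
  have E: "E \<in> sets circle_measure" unfolding E_eq using A R(1) by (intro sets.finite_UN) auto
  \<comment> \<open>The largest radius in \<open>R\<close> at which the modulus exceeds
    \<open>e\<close>, and 0 where there is none. The value 0 on \<open>E\<close> is consistent, as
    then the radius 0 itself lies in \<open>R\<close> and satisfies the inequality.\<close>
  define rad where "rad \<zeta> = Max ((\<lambda>r. r * indicat_real (A r) \<zeta>) ` R)" for \<zeta>
  have rad_m: "rad \<in> borel_measurable circle_measure"
    unfolding rad_def using A R(1) by (intro borel_measurable_Max) auto
  define \<rho> where "\<rho> = Max R"
  have \<rho>: "0 \<le> \<rho>" "\<rho> < 1" using R by (auto simp: \<rho>_def Max_ge_iff)
  have rad: "0 \<le> rad \<zeta>" "rad \<zeta> \<le> \<rho>" for \<zeta>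
  proof -
    have "rad \<zeta> \<in> (\<lambda>r. r * indicat_real (A r) \<zeta>) ` R" unfolding rad_def using R by (intro Max_in) auto
    then obtain r where r: "r \<in> R" "rad \<zeta> = r * indicat_real (A r) \<zeta>" by blast
    have "r \<in> {0..<1}" "r \<le> \<rho>" using r R by (auto simp: \<rho>_def)
    thus "0 \<le> rad \<zeta>" "rad \<zeta> \<le> \<rho>" using \<rho> r(2) by (auto simp: indicator_def)
  qed
  have radE: "cmod (f (of_real (rad \<zeta>) * \<zeta>)) > e" if \<zeta>E: "\<zeta> \<in> E" for \<zeta>
  proof -
    obtain r where r: "r \<in> R" "\<zeta> \<in> A r" using \<zeta>E by (auto simp: E_eq)
    have "rad \<zeta> \<in> (\<lambda>r. r * indicat_real (A r) \<zeta>) ` R" unfolding rad_def using R by (intro Max_in) auto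
    then obtain s where s: "s \<in> R" "rad \<zeta> = s * indicat_real (A s) \<zeta>" by blast
    have "r * indicat_real (A r) \<zeta> \<le> rad \<zeta>" unfolding rad_def using R(1) r(1) by (intro Max_ge finite_imageI imageI)
    hence le: "r \<le> s * indicat_real (A s) \<zeta>" using r s by simp
    show ?thesis
    proof (cases "\<zeta> \<in> A s")
      case True
      thus ?thesis using s by (simp add: A_def)
    next
      case False
      hence "r = 0" using le r R(3) by force
      thus ?thesis using False s r by (simp add: A_def)
    qed
  qed
  define z where "z \<zeta> = of_real (rad \<zeta>) * \<zeta>" for \<zeta>
  have zn: "cmod (z \<zeta>) \<le> \<rho>" "cmod (z \<zeta>) < 1" if "cmod \<zeta> = 1" for \<zeta>
    using rad[of \<zeta>] \<rho> that by (auto simp: z_def norm_mult)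
  have id_m: "(\<lambda>\<zeta>. \<zeta>) \<in> borel_measurable circle_measure"
    by (intro borel_measurable_circle_continuous continuous_intros)
  have z_m: "z \<in> borel_measurable circle_measure"
    unfolding z_def
    by (intro borel_measurable_times id_m measurable_compose[OF rad_m]
        borel_measurable_continuous_onI continuous_intros)
  define k where "k \<zeta> w = indicat_real E \<zeta> * poisson (z \<zeta>) w" for \<zeta> w
  have indE: "bounded_fun (indicat_real E)"
    using E by (auto simp: bounded_fun_def indicator_def intro!: exI[of _ 1])
  have P: "bounded_kernel (\<lambda>\<zeta> w. poisson (z \<zeta>) w)"
  proof -
    have [measurable]: "(\<lambda>p. z (fst p)) \<in> borel_measurable circle_product"
      by (rule measurable_compose[OF measurable_fst z_m])
    have [measurable]: "snd \<in> borel_measurable circle_product"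
      by (rule measurable_compose[OF measurable_snd id_m])
    have [measurable]: "(\<lambda>p. cnj (z (fst p))) \<in> borel_measurable circle_product"
      by (rule measurable_compose[OF measurable_compose[OF measurable_fst z_m]])
        (intro borel_measurable_continuous_onI continuous_intros)
    have "(\<lambda>p. poisson (z (fst p)) (snd p)) \<in> borel_measurable circle_product"
      unfolding poisson_def by measurable
    moreover have "\<bar>poisson (z \<zeta>) w\<bar> \<le> 1 / (1 - \<rho>)\<^sup>2" if "cmod \<zeta> = 1" "cmod w = 1" for \<zeta> w
      using poisson_abs_le zn \<rho> that by blast
    ultimately show ?thesis by (auto simp: bounded_kernel_def case_prod_unfold)
  qed
  have k: "bounded_kernel k" unfolding k_def by (intro bounded_kernel_mult bounded_kernel_fst indE P)
  have k0: "0 \<le> k \<zeta> w" if "cmod \<zeta> = 1" "cmod w = 1" for \<zeta> w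
    using that by (simp add: k_def poisson_nonneg zn)
  have F: "bounded_fun (\<lambda>w. cmod (f w))"
    by (intro bounded_fun_continuous continuous_intros continuous_on_subset[OF contf]) auto
  define u where "u w = (LINT \<zeta>|circle_measure. k \<zeta> w)" for w
  have u: "bounded_fun u" unfolding u_def by (rule bounded_fun_integral[OF bounded_kernel_swap[OF k]])
  have mE: "(LINT \<zeta>|circle_measure. indicat_real E \<zeta>) = measure circle_measure E"
  proof -
    have "E \<inter> sphere 0 1 = E" by (auto simp: E_def)
    thus ?thesis using E by simp
  qed
  \<comment> \<open>Pairing \<open>cmod (f w)\<close> with \<open>u\<close> integrates the Poisson
    majorant of \<open>f\<close> at the chosen points over \<open>E\<close>, where it exceeds
    \<open>e\<close>.\<close>
  have step1: "e * measure circle_measure E \<le> (LINT w|circle_measure. cmod (f w) * u w)"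
  proof -
    have kF: "bounded_kernel (\<lambda>\<zeta> w. k \<zeta> w * cmod (f w))"
      by (intro bounded_kernel_mult k bounded_kernel_snd F)
    have "e * measure circle_measure E = (LINT \<zeta>|circle_measure. e * indicat_real E \<zeta>)"
      using mE by simp
    also have "\<dots> \<le> (LINT \<zeta>|circle_measure. LINT w|circle_measure. k \<zeta> w * cmod (f w))"
    proof (rule integral_mono)
      show "integrable circle_measure (\<lambda>\<zeta>. e * indicat_real E \<zeta>)"
        using bounded_fun_integrable[OF indE] by simp
      show "integrable circle_measure (\<lambda>\<zeta>. LINT w|circle_measure. k \<zeta> w * cmod (f w))"
        by (intro bounded_fun_integrable bounded_fun_integral kF)
      fix \<zeta> assume "\<zeta> \<in> space circle_measure"
      hence \<zeta>: "cmod \<zeta> = 1" by simp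
      show "e * indicat_real E \<zeta> \<le> (LINT w|circle_measure. k \<zeta> w * cmod (f w))"
        using radE[of \<zeta>] cmod_le_poisson_integral[OF f zn(2)[OF \<zeta>]]
        by (cases "\<zeta> \<in> E") (auto simp: k_def z_def)
    qed
    also have "\<dots> = (LINT w|circle_measure. LINT \<zeta>|circle_measure. k \<zeta> w * cmod (f w))"
      by (rule bounded_kernel_Fubini[OF kF])
    finally show ?thesis by (simp add: u_def mult.commute)
  qed
  have step2: "(LINT w|circle_measure. u w * u w) \<le> 16 * measure circle_measure E"
  proof -
    have ku: "bounded_kernel (\<lambda>\<zeta> w. k \<zeta> w * u w)"
      by (intro bounded_kernel_mult k bounded_kernel_snd u)
    have kE: "bounded_kernel (\<lambda>\<zeta> \<xi>. k \<zeta> \<xi> * indicat_real E \<xi>)"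
      by (intro bounded_kernel_mult k bounded_kernel_snd indE)
    define b where "b = (LINT \<zeta>|circle_measure. LINT \<xi>|circle_measure. k \<zeta> \<xi> * indicat_real E \<xi>)"
    have b: "b \<le> measure circle_measure E"
    proof -
      have "b \<le> (LINT \<zeta>|circle_measure. indicat_real E \<zeta>)" unfolding b_def
      proof (rule integral_mono)
        show "integrable circle_measure (\<lambda>\<zeta>. LINT \<xi>|circle_measure. k \<zeta> \<xi> * indicat_real E \<xi>)"
          by (intro bounded_fun_integrable bounded_fun_integral kE)
        show "integrable circle_measure (indicat_real E)" by (rule bounded_fun_integrable[OF indE])
        fix \<zeta> assume "\<zeta> \<in> space circle_measure"
        hence \<zeta>: "cmod \<zeta> = 1" by simp
        have "(LINT \<xi>|circle_measure. k \<zeta> \<xi> * indicat_real E \<xi>) \<le> (LINT \<xi>|circle_measure. k \<zeta> \<xi>)"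
          by (intro integral_mono bounded_fun_integrable bounded_kernel_section[OF kE \<zeta>]
              bounded_kernel_section[OF k \<zeta>])
            (use k0[OF \<zeta>] in \<open>auto simp: indicator_def\<close>)
        also have "\<dots> = indicat_real E \<zeta>"
          using integral_poisson[OF zn(2)[OF \<zeta>]] by (simp add: k_def)
        finally show "(LINT \<xi>|circle_measure. k \<zeta> \<xi> * indicat_real E \<xi>) \<le> indicat_real E \<zeta>" .
      qed
      thus ?thesis by (simp only: mE)
    qed
    have "(LINT w|circle_measure. u w * u w) =
        (LINT w|circle_measure. LINT \<zeta>|circle_measure. k \<zeta> w * u w)"
      by (simp add: u_def)
    also have "\<dots> = (LINT \<zeta>|circle_measure. LINT w|circle_measure. k \<zeta> w * u w)"
      by (rule bounded_kernel_Fubini[OF ku, symmetric])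
    also have "\<dots> \<le> (LINT \<zeta>|circle_measure. 8 * (LINT \<xi>|circle_measure. k \<zeta> \<xi> * indicat_real E \<xi>)
        + 8 * (LINT \<xi>|circle_measure. k \<xi> \<zeta> * indicat_real E \<zeta>))"
    proof (rule integral_mono)
      show "integrable circle_measure (\<lambda>\<zeta>. LINT w|circle_measure. k \<zeta> w * u w)"
        by (intro bounded_fun_integrable bounded_fun_integral ku)
      show "integrable circle_measure (\<lambda>\<zeta>. 8 * (LINT \<xi>|circle_measure. k \<zeta> \<xi> * indicat_real E \<xi>)
        + 8 * (LINT \<xi>|circle_measure. k \<xi> \<zeta> * indicat_real E \<zeta>))"
        by (intro Bochner_Integration.integrable_add integrable_mult_right
            bounded_fun_integrable bounded_fun_integral kE bounded_kernel_swap[OF kE])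
      fix \<zeta> assume "\<zeta> \<in> space circle_measure"
      hence \<zeta>: "cmod \<zeta> = 1" by simp
      have kk: "bounded_kernel (\<lambda>\<xi> w. k \<zeta> w * k \<xi> w)"
        by (intro bounded_kernel_mult k bounded_kernel_snd bounded_kernel_section[OF k \<zeta>])
      have "(LINT w|circle_measure. k \<zeta> w * u w) =
          (LINT w|circle_measure. LINT \<xi>|circle_measure. k \<zeta> w * k \<xi> w)"
        by (simp add: u_def)
      also have "\<dots> = (LINT \<xi>|circle_measure. LINT w|circle_measure. k \<zeta> w * k \<xi> w)"
        by (rule bounded_kernel_Fubini[OF kk, symmetric])
      also have "\<dots> \<le> (LINT \<xi>|circle_measure. 8 * (k \<zeta> \<xi> * indicat_real E \<xi>) + 8 * (k \<xi> \<zeta> * indicat_real E \<zeta>))"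
      proof (rule integral_mono)
        show "integrable circle_measure (\<lambda>\<xi>. LINT w|circle_measure. k \<zeta> w * k \<xi> w)"
          by (intro bounded_fun_integrable bounded_fun_integral kk)
        show "integrable circle_measure (\<lambda>\<xi>. 8 * (k \<zeta> \<xi> * indicat_real E \<xi>) + 8 * (k \<xi> \<zeta> * indicat_real E \<zeta>))"
          by (intro Bochner_Integration.integrable_add integrable_mult_right
            bounded_fun_integrable bounded_kernel_section[OF kE \<zeta>] bounded_kernel_section[OF bounded_kernel_swap[OF kE] \<zeta>])
        fix \<xi> assume "\<xi> \<in> space circle_measure"
        hence \<xi>: "cmod \<xi> = 1" by simp
        have "(LINT w|circle_measure. k \<zeta> w * k \<xi> w) =
            indicat_real E \<zeta> * indicat_real E \<xi> * (LINT w|circle_measure. poisson (z \<zeta>) w * poisson (z \<xi>) w)"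
          by (simp add: k_def mult_ac flip: integral_mult_right_zero)
        also have "\<dots> = indicat_real E \<zeta> * indicat_real E \<xi> * poisson (z \<zeta>) (z \<xi>)"
          by (simp add: integral_poisson_poisson zn \<zeta> \<xi>)
        \<comment> \<open>The point with the larger radius is moved to the circle. Adding both
          alternatives keeps the bound symmetric, and over \<open>E \<times> E\<close> each summand
          integrates to at most \<open>8 * measure circle_measure E\<close>.\<close>
        also have "poisson (z \<zeta>) (z \<xi>) \<le> 8 * poisson (z \<zeta>) \<xi> + 8 * poisson (z \<xi>) \<zeta>"
        proof (cases "rad \<zeta> \<le> rad \<xi>")
          case True
          have "poisson (z \<zeta>) (z \<xi>) \<le> 8 * poisson (z \<zeta>) \<xi>"
            unfolding z_def by (rule poisson_dilation_le) (use \<zeta> \<xi> True rad[of \<zeta>] rad[of \<xi>] \<rho> in auto)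
          thus ?thesis using poisson_nonneg[OF zn(2)[OF \<xi>], of \<zeta>] \<zeta> by simp
        next
          case False
          have "poisson (z \<xi>) (z \<zeta>) \<le> 8 * poisson (z \<xi>) \<zeta>"
            unfolding z_def by (rule poisson_dilation_le) (use \<zeta> \<xi> False rad[of \<zeta>] rad[of \<xi>] \<rho> in auto)
          thus ?thesis using poisson_nonneg[OF zn(2)[OF \<zeta>], of \<xi>] \<xi> by (simp add: poisson_commute[of "z \<zeta>" "z \<xi>"])
        qed
        finally show "(LINT w|circle_measure. k \<zeta> w * k \<xi> w) \<le>
            8 * (k \<zeta> \<xi> * indicat_real E \<xi>) + 8 * (k \<xi> \<zeta> * indicat_real E \<zeta>)"
          by (simp add: k_def mult_left_mono algebra_simps indicator_def split: if_splits)
      qed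
      also have "\<dots> = 8 * (LINT \<xi>|circle_measure. k \<zeta> \<xi> * indicat_real E \<xi>)
        + 8 * (LINT \<xi>|circle_measure. k \<xi> \<zeta> * indicat_real E \<zeta>)"
        using bounded_fun_integrable[OF bounded_kernel_section[OF kE \<zeta>]]
          bounded_fun_integrable[OF bounded_kernel_section[OF bounded_kernel_swap[OF kE] \<zeta>]]
        by (subst Bochner_Integration.integral_add) (simp_all only: integrable_mult_right integral_mult_right_zero)
      finally show "(LINT w|circle_measure. k \<zeta> w * u w) \<le> 8 * (LINT \<xi>|circle_measure. k \<zeta> \<xi> * indicat_real E \<xi>)
        + 8 * (LINT \<xi>|circle_measure. k \<xi> \<zeta> * indicat_real E \<zeta>)" .
    qed
    also have "\<dots> = 8 * b + 8 * (LINT \<zeta>|circle_measure. LINT \<xi>|circle_measure. k \<xi> \<zeta> * indicat_real E \<zeta>)"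
      unfolding b_def
      using bounded_fun_integrable[OF bounded_fun_integral[OF kE]]
          bounded_fun_integrable[OF bounded_fun_integral[OF bounded_kernel_swap[OF kE]]]
      by (subst Bochner_Integration.integral_add) (simp_all only: integrable_mult_right integral_mult_right_zero)
    also have "(LINT \<zeta>|circle_measure. LINT \<xi>|circle_measure. k \<xi> \<zeta> * indicat_real E \<zeta>) = b"
      unfolding b_def by (rule bounded_kernel_Fubini[OF kE, symmetric])
    finally show ?thesis using b by simp
  qed
  \<comment> \<open>In \<open>x * y \<le> t / 2 * x\<^sup>2 + y\<^sup>2 / (2 * t)\<close> this
    \<open>t\<close> turns the bound for \<open>u\<close> into half of the left-hand side, where it
    is absorbed.\<close>
  define t where "t = 16 / e"
  have t: "t > 0" using e by (simp add: t_def)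
  have "e * measure circle_measure E \<le> (LINT w|circle_measure. cmod (f w) * u w)" by (rule step1)
  also have "\<dots> \<le> (LINT w|circle_measure. t / 2 * (cmod (f w) * cmod (f w)) + 1 / (2 * t) * (u w * u w))"
  proof (rule integral_mono)
    show "integrable circle_measure (\<lambda>w. cmod (f w) * u w)"
      by (intro bounded_fun_integrable bounded_fun_mult F u)
    show "integrable circle_measure (\<lambda>w. t / 2 * (cmod (f w) * cmod (f w)) + 1 / (2 * t) * (u w * u w))"
      by (intro Bochner_Integration.integrable_add integrable_mult_right bounded_fun_integrable bounded_fun_mult F u)
    show "cmod (f w) * u w \<le> t / 2 * (cmod (f w) * cmod (f w)) + 1 / (2 * t) * (u w * u w)" for w
    proof -
      have "0 \<le> (t * cmod (f w) - u w)\<^sup>2 / (2 * t)" using t by simp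
      also have "\<dots> = t / 2 * (cmod (f w) * cmod (f w)) + 1 / (2 * t) * (u w * u w) - cmod (f w) * u w"
        using t by (simp add: power2_eq_square field_simps)
      finally show ?thesis by simp
    qed
  qed
  also have "\<dots> = t / 2 * (LINT w|circle_measure. cmod (f w) * cmod (f w)) + 1 / (2 * t) * (LINT w|circle_measure. u w * u w)"
    using bounded_fun_integrable[OF bounded_fun_mult[OF F F]] bounded_fun_integrable[OF bounded_fun_mult[OF u u]]
    by (subst Bochner_Integration.integral_add) (simp_all only: integrable_mult_right integral_mult_right_zero)
  also have "\<dots> \<le> t / 2 * (LINT w|circle_measure. cmod (f w) * cmod (f w)) + 1 / (2 * t) * (16 * measure circle_measure E)"
    using step2 t by (intro add_left_mono mult_left_mono) auto
  finally have "e * measure circle_measure E \<le> 8 / e * (LINT w|circle_measure. cmod (f w) * cmod (f w)) + e / 2 * measure circle_measure E"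
    using e by (simp add: t_def)
  hence "measure circle_measure E \<le> 16 / e\<^sup>2 * (LINT w|circle_measure. cmod (f w) * cmod (f w))"
    using e by (simp add: field_simps power2_eq_square)
  thus ?thesis by (simp add: E_def power2_eq_square)
qed

subsection \<open>Finite Blaschke products\<close>

lemma cmod_blaschke_factor: "cmod (blaschke_factor l z) = cmod (l - z) / cmod (1 - cnj l * z)"
  by (auto simp: blaschke_factor_def norm_mult norm_divide)

lemma blaschke_factor_analytic:
  assumes "cmod l < 1"
  shows "blaschke_factor l analytic_on cball 0 1"
proof (cases "l = 0")
  case True
  thus ?thesis by (simp add: blaschke_factor_def[abs_def] analytic_on_ident)
next
  case False
  have "(\<lambda>z. complex_of_real (cmod l) / l * ((l - z) / (1 - cnj l * z))) analytic_on cball 0 1"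
    using one_minus_cnj_mult_neq_0[OF assms] False by (intro analytic_intros) auto
  thus ?thesis using False by (simp add: blaschke_factor_def[abs_def])
qed

lemma one_minus_cmod_blaschke_factor:
  assumes "1 - cnj l * z \<noteq> 0"
  shows "1 - (cmod (blaschke_factor l z))\<^sup>2 = (1 - (cmod l)\<^sup>2) * (1 - (cmod z)\<^sup>2) / (cmod (1 - cnj l * z))\<^sup>2"
proof -
  have "(cmod (1 - cnj l * z))\<^sup>2 - (cmod (l - z))\<^sup>2 = (1 - (cmod l)\<^sup>2) * (1 - (cmod z)\<^sup>2)"
    unfolding cmod_power2 by (simp add: power2_eq_square algebra_simps)
  thus ?thesis using assms by (simp add: cmod_blaschke_factor power_divide field_simps)
qed

lemma cmod_blaschke_factor_le_1:
  assumes "cmod l < 1" "cmod z \<le> 1"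
  shows "cmod (blaschke_factor l z) \<le> 1"
proof -
  have "0 \<le> 1 - (cmod (blaschke_factor l z))\<^sup>2"
    unfolding one_minus_cmod_blaschke_factor[OF one_minus_cnj_mult_neq_0[OF assms]]
    using assms by (intro divide_nonneg_nonneg mult_nonneg_nonneg) (auto simp: power_le_one)
  thus ?thesis by (simp add: power_le_one_iff abs_square_le_1)
qed

lemma cmod_blaschke_factor_less_1:
  assumes "cmod l < 1" "cmod z < 1"
  shows "cmod (blaschke_factor l z) < 1"
proof -
  have "0 < 1 - (cmod (blaschke_factor l z))\<^sup>2"
    unfolding one_minus_cmod_blaschke_factor[OF one_minus_cnj_mult_neq_0[OF assms(1) less_imp_le[OF assms(2)]]]
    using assms one_minus_cnj_mult_neq_0[OF assms(1) less_imp_le[OF assms(2)]]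
    by (intro divide_pos_pos mult_pos_pos) (auto simp: power_less_one_iff abs_square_less_1)
  thus ?thesis by (simp add: abs_square_less_1)
qed

lemma cmod_blaschke_factor_eq_1:
  assumes "cmod l < 1" "cmod z = 1"
  shows "cmod (blaschke_factor l z) = 1"
proof -
  have "1 - (cmod (blaschke_factor l z))\<^sup>2 = 0"
    using one_minus_cmod_blaschke_factor[OF one_minus_cnj_mult_neq_0[OF assms(1)], of z] assms by simp
  thus ?thesis by (simp add: power2_eq_1_iff) (smt (verit) norm_ge_zero)
qed

lemma blaschke_factor_0: "blaschke_factor l 0 = of_real (cmod l)"
  by (simp add: blaschke_factor_def)

lemma blaschke_factor_self: "blaschke_factor l l = 0"
  by (simp add: blaschke_factor_def)

lemma cmod_blaschke_factor_commute:
  "cmod (blaschke_factor l z) = cmod (blaschke_factor z l)"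
proof -
  have "cnj (1 - cnj l * z) = 1 - cnj z * l" by (simp add: mult.commute)
  hence "cmod (1 - cnj l * z) = cmod (1 - cnj z * l)" by (metis complex_mod_cnj)
  thus ?thesis by (simp add: cmod_blaschke_factor norm_minus_commute)
qed

text \<open>Makes the product of the factors converge whenever the numbers \<open>1 - cmod l\<close>
  are summable.\<close>

lemma cmod_one_minus_blaschke_factor_le:
  assumes "cmod l < 1" "cmod z < 1"
  shows "cmod (1 - blaschke_factor l z) \<le> 2 / (1 - cmod z) * (1 - cmod l)"
proof (cases "l = 0")
  case True
  have "cmod (1 - z) \<le> 1 + cmod z" using norm_triangle_ineq4[of 1 z] by simp
  also have "\<dots> \<le> 2 / (1 - cmod z)" using assms by (simp add: field_simps)
  finally show ?thesis using True by (simp add: blaschke_factor_def)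
next
  case False
  have nz: "1 - cnj l * z \<noteq> 0" using one_minus_cnj_mult_neq_0 assms by simp
  have "l * cnj l = of_real (cmod l) * of_real (cmod l)"
    using complex_norm_square[of l] by (simp add: power2_eq_square)
  hence "1 - blaschke_factor l z = of_real (1 - cmod l) * (1 + of_real (cmod l) / l * z) / (1 - cnj l * z)"
    using False nz unfolding blaschke_factor_def
    by (simp add: field_simps)
  hence "cmod (1 - blaschke_factor l z) = (1 - cmod l) * cmod (1 + of_real (cmod l) / l * z) / cmod (1 - cnj l * z)"
    using assms by (simp add: norm_mult norm_divide del: of_real_diff)
  also have "\<dots> \<le> (1 - cmod l) * 2 / (1 - cmod z)"
  proof (intro frac_le mult_left_mono)
    have "cmod (1 + of_real (cmod l) / l * z) \<le> 1 + cmod (of_real (cmod l) / l * z)"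
      by (rule order_trans[OF norm_triangle_ineq]) simp
    also have "cmod (of_real (cmod l) / l * z) = cmod z" using False by (simp add: norm_mult norm_divide)
    finally show "cmod (1 + of_real (cmod l) / l * z) \<le> 2" using assms by simp
    have "cmod l * cmod z \<le> cmod z" using assms by (simp add: mult_left_le_one_le)
    thus "1 - cmod z \<le> cmod (1 - cnj l * z)"
      using norm_triangle_ineq2[of 1 "cnj l * z"] by (simp add: norm_mult)
  qed (use assms in auto)
  finally show ?thesis by (simp add: mult.commute)
qed

text \<open>The index type is arbitrary, so that equal zeros belonging to different sequences are
  counted separately.\<close>

definition finite_blaschke :: "('i \<Rightarrow> complex) \<Rightarrow> 'i set \<Rightarrow> complex \<Rightarrow> complex" where
  "finite_blaschke l S z = (\<Prod>i\<in>S. blaschke_factor (l i) z)"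

lemma finite_blaschke_analytic:
  "(\<And>i. i \<in> S \<Longrightarrow> cmod (l i) < 1) \<Longrightarrow> finite_blaschke l S analytic_on cball 0 1"
  unfolding finite_blaschke_def[abs_def] by (intro analytic_on_prod blaschke_factor_analytic)

lemma cmod_finite_blaschke_le_1:
  "(\<And>i. i \<in> S \<Longrightarrow> cmod (l i) < 1) \<Longrightarrow> cmod z \<le> 1 \<Longrightarrow> cmod (finite_blaschke l S z) \<le> 1"
  unfolding finite_blaschke_def prod_norm[symmetric]
  by (intro prod_le_1) (auto simp: cmod_blaschke_factor_le_1)

lemma cmod_finite_blaschke_eq_1:
  "(\<And>i. i \<in> S \<Longrightarrow> cmod (l i) < 1) \<Longrightarrow> cmod z = 1 \<Longrightarrow> cmod (finite_blaschke l S z) = 1"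
  unfolding finite_blaschke_def prod_norm[symmetric]
  by (intro prod.neutral) (auto simp: cmod_blaschke_factor_eq_1)

lemma finite_blaschke_mult_diff:
  assumes "finite S" "U \<subseteq> S"
  shows "finite_blaschke l S z = finite_blaschke l U z * finite_blaschke l (S - U) z"
  unfolding finite_blaschke_def using prod.subset_diff[OF assms(2,1)] by (simp add: mult.commute)

lemma one_minus_finite_blaschke_0:
  assumes "\<And>i. i \<in> S \<Longrightarrow> cmod (l i) < 1"
  shows "1 - Re (finite_blaschke l S 0) \<le> (\<Sum>i\<in>S. 1 - cmod (l i))"
proof -
  have "1 - Re (finite_blaschke l S 0) = Re (1 - finite_blaschke l S 0)" by simp
  also have "\<dots> \<le> cmod ((\<Prod>i\<in>S. 1) - (\<Prod>i\<in>S. blaschke_factor (l i) 0))"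
    by (simp add: finite_blaschke_def complex_Re_le_cmod del: minus_complex.simps)
  also have "\<dots> \<le> (\<Sum>i\<in>S. cmod (1 - blaschke_factor (l i) 0))"
    by (rule norm_prod_diff) (use assms in \<open>auto simp: cmod_blaschke_factor_le_1\<close>)
  also have "\<dots> = (\<Sum>i\<in>S. 1 - cmod (l i))"
  proof (rule sum.cong[OF refl])
    fix i assume "i \<in> S"
    have "cmod (1 - blaschke_factor (l i) 0) = cmod (of_real (1 - cmod (l i)))"
      by (simp add: blaschke_factor_0)
    also have "\<dots> = 1 - cmod (l i)" using assms[OF \<open>i \<in> S\<close>] by (simp del: of_real_diff)
    finally show "cmod (1 - blaschke_factor (l i) 0) = 1 - cmod (l i)" .
  qed
  finally show ?thesis .
qed

text \<open>Schwarz's lemma after the disk automorphism that exchanges 0 and \<open>w\<close>. The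
  difference of two values has modulus at most 2; dividing by 3 gives the strict bound that
  Schwarz's lemma asks for.\<close>

lemma schwarz_pick_weak:
  assumes f: "f holomorphic_on ball 0 1" "\<And>z. cmod z < 1 \<Longrightarrow> cmod (f z) \<le> 1"
    and zw: "cmod z < 1" "cmod w < 1"
  shows "cmod (f z - f w) \<le> 3 * cmod (blaschke_factor w z)"
proof -
  define \<phi> where "\<phi> u = (w - u) / (1 - cnj w * u)" for u
  have nz: "1 - cnj w * u \<noteq> 0" if "cmod u < 1" for u
    using one_minus_cnj_mult_neq_0[OF zw(2)] that by simp
  have \<phi>n: "cmod (\<phi> u) = cmod (blaschke_factor w u)" for u
    by (simp add: \<phi>_def cmod_blaschke_factor norm_divide)
  have \<phi>: "cmod (\<phi> u) < 1" if "cmod u < 1" for u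
    unfolding \<phi>n using zw(2) that by (rule cmod_blaschke_factor_less_1)
  have inv: "\<phi> (\<phi> u) = u" if u: "cmod u < 1" for u
  proof -
    have "w - \<phi> u = u * (1 - cnj w * w) / (1 - cnj w * u)"
      using nz[OF u] by (simp add: \<phi>_def field_simps)
    moreover have "1 - cnj w * \<phi> u = (1 - cnj w * w) / (1 - cnj w * u)"
      using nz[OF u] by (simp add: \<phi>_def field_simps)
    ultimately have "\<phi> (\<phi> u) = (u * (1 - cnj w * w) / (1 - cnj w * u)) / ((1 - cnj w * w) / (1 - cnj w * u))"
      by (simp add: \<phi>_def[of "\<phi> u"])
    thus ?thesis using nz[OF u] nz[OF zw(2)] by simp
  qed
  define g where "g u = (f (\<phi> u) - f w) / 3" for u
  have "cmod (g (\<phi> z)) \<le> cmod (\<phi> z)"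
  proof (rule Schwarz_Lemma(1))
    have "\<phi> holomorphic_on ball 0 1" unfolding \<phi>_def using nz by (intro holomorphic_intros) auto
    hence "(f \<circ> \<phi>) holomorphic_on ball 0 1"
      by (rule holomorphic_on_compose_gen[OF _ f(1)]) (auto simp: \<phi>)
    thus "g holomorphic_on ball 0 1" unfolding g_def o_def by (intro holomorphic_intros) auto
    show "g 0 = 0" by (simp add: g_def \<phi>_def)
    show "cmod (g u) < 1" if "cmod u < 1" for u
      using norm_triangle_ineq4[of "f (\<phi> u)" "f w"] f(2)[OF \<phi>[OF that]] f(2)[OF zw(2)]
      by (simp add: g_def norm_divide)
  qed (use \<phi> zw in auto)
  thus ?thesis using inv[OF zw(1)] by (simp add: g_def \<phi>n norm_divide)
qed

subsection \<open>Radial limits of Blaschke products\<close>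

text \<open>On the circle the product is unimodular, so the integrand is 2 minus twice the real
  part, whose mean is its value at 0. The weak type inequality turns this quantity into a bound for
  exceptional sets.\<close>

lemma integral_one_minus_finite_blaschke:
  assumes "\<And>i. i \<in> S \<Longrightarrow> cmod (l i) < 1"
  shows "(LINT \<zeta>|circle_measure. (cmod (1 - finite_blaschke l S \<zeta>))\<^sup>2) \<le> 2 * (\<Sum>i\<in>S. 1 - cmod (l i))"
proof -
  let ?b = "finite_blaschke l S"
  note b = finite_blaschke_analytic[of S l, OF assms]
  have cont: "continuous_on (sphere 0 1) ?b"
    by (rule continuous_on_subset[OF holomorphic_on_imp_continuous_on[OF analytic_imp_holomorphic[OF b]]]) auto
  have int: "integrable circle_measure ?b" by (rule integrable_circle_continuous[OF cont])
  have "(LINT \<zeta>|circle_measure. ?b \<zeta>) = ?b 0"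
    using poisson_formula[OF b, of 0] by (simp add: poisson_def)
  hence Re: "(LINT \<zeta>|circle_measure. Re (?b \<zeta>)) = Re (?b 0)"
    using integral_Re[OF int] by simp
  have "(LINT \<zeta>|circle_measure. (cmod (1 - ?b \<zeta>))\<^sup>2) = (LINT \<zeta>|circle_measure. 2 - 2 * Re (?b \<zeta>))"
  proof (rule Bochner_Integration.integral_cong[OF refl])
    fix \<zeta> assume "\<zeta> \<in> space circle_measure"
    hence "cmod (?b \<zeta>) = 1" using cmod_finite_blaschke_eq_1[of S l \<zeta>] assms by simp
    hence "(Re (?b \<zeta>))\<^sup>2 + (Im (?b \<zeta>))\<^sup>2 = 1" by (metis cmod_power2 one_power2)
    thus "(cmod (1 - ?b \<zeta>))\<^sup>2 = 2 - 2 * Re (?b \<zeta>)"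
      unfolding cmod_power2 by (simp add: power2_eq_square algebra_simps)
  qed
  also have "\<dots> = 2 - 2 * Re (?b 0)"
    using int Re by (subst Bochner_Integration.integral_diff) (auto simp: measure_def)
  also have "\<dots> \<le> 2 * (\<Sum>i\<in>S. 1 - cmod (l i))"
    using one_minus_finite_blaschke_0[of S l, OF assms] by simp
  finally show ?thesis .
qed

text \<open>The weak Schwarz-Pick inequality is uniform in \<open>n\<close> and survives the
  pointwise limit; its right-hand side tends to 0 as \<open>z\<close> tends to
  \<open>w\<close>.\<close>

lemma blaschke_limit_continuous:
  assumes F: "\<And>n i. i \<in> F n \<Longrightarrow> cmod (l i) < 1"
    and lim: "\<And>z. cmod z < 1 \<Longrightarrow> (\<lambda>n. finite_blaschke l (F n) z) \<longlonglongrightarrow> \<theta> z"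
  shows "continuous_on (ball 0 1) \<theta>"
proof -
  have diff: "cmod (\<theta> z - \<theta> w) \<le> 3 * cmod (blaschke_factor w z)" if "cmod z < 1" "cmod w < 1" for z w
  proof (rule LIMSEQ_le_const2)
    show "(\<lambda>n. cmod (finite_blaschke l (F n) z - finite_blaschke l (F n) w)) \<longlonglongrightarrow> cmod (\<theta> z - \<theta> w)"
      by (intro tendsto_intros lim that)
    have "cmod (finite_blaschke l (F n) z - finite_blaschke l (F n) w) \<le> 3 * cmod (blaschke_factor w z)" for n
    proof (rule schwarz_pick_weak[OF _ _ that])
      show "finite_blaschke l (F n) holomorphic_on ball 0 1"
        by (rule holomorphic_on_subset[OF analytic_imp_holomorphic[OF finite_blaschke_analytic[OF F]]]) auto
      show "cmod (finite_blaschke l (F n) z) \<le> 1" if "cmod z < 1" for z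
        using that F by (intro cmod_finite_blaschke_le_1) auto
    qed
    thus "\<exists>N. \<forall>n\<ge>N. cmod (finite_blaschke l (F n) z - finite_blaschke l (F n) w) \<le> 3 * cmod (blaschke_factor w z)"
      by blast
  qed
  show ?thesis
  proof (rule continuous_on_eq_continuous_within[THEN iffD2], intro ballI)
    fix w :: complex assume w: "w \<in> ball 0 1"
    have "continuous_on (ball 0 1) (blaschke_factor w)"
      using w by (intro continuous_on_subset[OF holomorphic_on_imp_continuous_on[OF
          analytic_imp_holomorphic[OF blaschke_factor_analytic]]]) auto
    hence "(blaschke_factor w \<longlongrightarrow> 0) (at w within ball 0 1)"
      using w by (auto simp: continuous_on_def blaschke_factor_self dest!: bspec[of _ _ w])
    hence *: "((\<lambda>z. 3 * cmod (blaschke_factor w z)) \<longlongrightarrow> 0) (at w within ball 0 1)"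
      by (intro tendsto_mult_right_zero tendsto_norm_zero)
    have "((\<lambda>z. \<theta> z - \<theta> w) \<longlongrightarrow> 0) (at w within ball 0 1)"
    proof (rule Lim_null_comparison[OF _ *])
      show "\<forall>\<^sub>F z in at w within ball 0 1. cmod (\<theta> z - \<theta> w) \<le> 3 * cmod (blaschke_factor w z)"
        unfolding eventually_at_filter using diff w by (intro always_eventually) auto
    qed
    thus "continuous (at w within ball 0 1) \<theta>" by (simp add: continuous_within LIM_zero_iff)
  qed
qed

text \<open>The partial products satisfy
  \<open>cmod (\<Theta> k z - \<Theta> n z) \<le> cmod (1 - b k z)\<close> with the quotient
  \<open>b k\<close>, and the weak type inequality applies to \<open>1 - b k\<close>. As it handles
  finitely many radii, the bound for all radii comes from the rational ones by continuity, and that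
  for \<open>\<theta>\<close> from letting \<open>k\<close> tend to infinity.\<close>

lemma blaschke_tail_exceptional_set:
  assumes F: "\<And>n. finite (F n)" "incseq F" "\<And>n i. i \<in> F n \<Longrightarrow> cmod (l i) < 1"
    and \<eta>: "\<And>k. k \<ge> n \<Longrightarrow> (\<Sum>i\<in>F k - F n. 1 - cmod (l i)) \<le> \<eta>"
    and lim: "\<And>z. cmod z < 1 \<Longrightarrow> (\<lambda>n. finite_blaschke l (F n) z) \<longlonglongrightarrow> \<theta> z" and e: "e > 0"
  shows "\<exists>D. D \<in> sets circle_measure \<and> measure circle_measure D \<le> 32 / e\<^sup>2 * \<eta> \<and>
    (\<forall>\<zeta> r. cmod \<zeta> = 1 \<longrightarrow> \<zeta> \<notin> D \<longrightarrow> 0 \<le> r \<longrightarrow> r < 1 \<longrightarrow>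
       cmod (\<theta> (of_real r * \<zeta>) - finite_blaschke l (F n) (of_real r * \<zeta>)) \<le> e)"
proof -
  define b where "b k = finite_blaschke l (F k - F n)" for k
  define \<Theta> where "\<Theta> k = finite_blaschke l (F k)" for k
  define Q where "Q = (\<rat> \<inter> {0..<1::real})"
  define q where "q = from_nat_into Q"
  have Q: "range q = Q"
  proof -
    have "countable Q" unfolding Q_def using countable_rat by blast
    moreover have "(0::real) \<in> Q" by (simp add: Q_def)
    ultimately show ?thesis unfolding q_def by (metis empty_iff range_from_nat_into)
  qed
  have q: "0 \<le> q i" "q i < 1" for i
    using Q by (auto simp: Q_def)
  have b_an: "b k analytic_on cball 0 1" for k
    unfolding b_def by (rule finite_blaschke_analytic) (use F in auto)
  have b_cont: "continuous_on (cball 0 1) (b k)" for k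
    by (intro holomorphic_on_imp_continuous_on analytic_imp_holomorphic b_an)
  \<comment> \<open>The number of radii grows with \<open>k\<close>, so that every rational radius
    is eventually tested.\<close>
  define A where "A k = {\<zeta>. cmod \<zeta> = 1 \<and> (\<exists>r\<in>q ` {..k}. cmod (1 - b k (of_real r * \<zeta>)) > e)}" for k
  have A_sets: "A k \<in> sets circle_measure" for k
  proof -
    have "{\<zeta> \<in> space circle_measure. cmod (1 - b k (of_real (q i) * \<zeta>)) > e} \<in> sets circle_measure" for i
      using q[of i]
      by (intro borel_measurable_less borel_measurable_const borel_measurable_circle_continuous
          continuous_intros continuous_on_compose2[OF b_cont]) (auto simp: norm_mult)
    hence "(\<Union>i\<in>{..k}. {\<zeta> \<in> space circle_measure. cmod (1 - b k (of_real (q i) * \<zeta>)) > e}) \<in> sets circle_measure"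
      by (intro sets.finite_UN) auto
    moreover have "A k = (\<Union>i\<in>{..k}. {\<zeta> \<in> space circle_measure. cmod (1 - b k (of_real (q i) * \<zeta>)) > e})"
      by (auto simp: A_def)
    ultimately show ?thesis by simp
  qed
  have A_meas: "measure circle_measure (A k) \<le> 32 / e\<^sup>2 * \<eta>" if "k \<ge> n" for k
  proof -
    have "measure circle_measure (A k) \<le> 16 / e\<^sup>2 * (LINT \<zeta>|circle_measure. (cmod (1 - b k \<zeta>))\<^sup>2)"
      unfolding A_def
      by (rule weak_type_radial) (use q e b_an in \<open>auto intro!: analytic_intros\<close>)
    also have "\<dots> \<le> 16 / e\<^sup>2 * (2 * (\<Sum>i\<in>F k - F n. 1 - cmod (l i)))"
      unfolding b_def using F e by (intro mult_left_mono integral_one_minus_finite_blaschke) auto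
    also have "\<dots> \<le> 16 / e\<^sup>2 * (2 * \<eta>)"
      using \<eta>[OF that] e by (intro mult_left_mono) auto
    finally show ?thesis by simp
  qed
  \<comment> \<open>The points that lie in \<open>A k\<close> for all large \<open>k\<close>. The
    increasing union of the \<open>D K\<close> contains every point where the estimate fails in the
    limit, and its measure inherits the common bound of the \<open>A k\<close>.\<close>
  define D where "D K = (\<Inter>k\<in>{max n K..}. A k)" for K
  have D_sets: "D K \<in> sets circle_measure" for K
    unfolding D_def using A_sets by (intro sets.countable_INT) auto
  have D_inc: "incseq D" unfolding D_def incseq_def by (auto simp: max_def split: if_splits)
  have "(\<lambda>K. measure circle_measure (D K)) \<longlonglongrightarrow> measure circle_measure (\<Union>K. D K)"
    using D_sets D_inc by (intro circle.finite_Lim_measure_incseq) auto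
  moreover have "measure circle_measure (D K) \<le> 32 / e\<^sup>2 * \<eta>" for K
  proof -
    have "measure circle_measure (D K) \<le> measure circle_measure (A (max n K))"
      using A_sets by (intro circle.finite_measure_mono) (auto simp: D_def)
    thus ?thesis using A_meas[of "max n K"] by simp
  qed
  ultimately have meas: "measure circle_measure (\<Union>K. D K) \<le> 32 / e\<^sup>2 * \<eta>"
    by (intro LIMSEQ_le_const2) auto
  have le: "cmod (\<Theta> k z - \<Theta> n z) \<le> cmod (1 - b k z)" if "k \<ge> n" "cmod z < 1" for k z
  proof -
    have "\<Theta> k z = \<Theta> n z * b k z"
      unfolding \<Theta>_def b_def using F(1) incseqD[OF F(2) that(1)] by (intro finite_blaschke_mult_diff) auto
    hence "\<Theta> k z - \<Theta> n z = - (\<Theta> n z * (1 - b k z))" by (simp add: algebra_simps)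
    hence "cmod (\<Theta> k z - \<Theta> n z) = cmod (\<Theta> n z) * cmod (1 - b k z)" by (simp add: norm_mult)
    also have "\<dots> \<le> 1 * cmod (1 - b k z)"
      unfolding \<Theta>_def using that F by (intro mult_right_mono cmod_finite_blaschke_le_1) auto
    finally show ?thesis by simp
  qed
  have cont: "continuous_on (ball 0 1) (\<lambda>z. cmod (\<theta> z - \<Theta> n z))"
    unfolding \<Theta>_def using F
    by (intro continuous_intros blaschke_limit_continuous[of F l] lim continuous_on_subset[OF
          holomorphic_on_imp_continuous_on[OF analytic_imp_holomorphic[OF finite_blaschke_analytic]]]) auto
  have main: "cmod (\<theta> (of_real r * \<zeta>) - \<Theta> n (of_real r * \<zeta>)) \<le> e"
    if \<zeta>: "cmod \<zeta> = 1" "\<zeta> \<notin> (\<Union>K. D K)" and r: "0 \<le> r" "r < 1" for \<zeta> r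
  proof -
    have rat: "cmod (\<theta> (of_real (q i) * \<zeta>) - \<Theta> n (of_real (q i) * \<zeta>)) \<le> e" for i
    proof (rule ccontr)
      assume neg: "\<not> ?thesis"
      let ?z = "of_real (q i) * \<zeta>"
      have z: "cmod ?z < 1" using q[of i] \<zeta> by (simp add: norm_mult)
      have "(\<lambda>k. cmod (\<Theta> k ?z - \<Theta> n ?z)) \<longlonglongrightarrow> cmod (\<theta> ?z - \<Theta> n ?z)"
        unfolding \<Theta>_def by (intro tendsto_intros lim z)
      hence "eventually (\<lambda>k. e < cmod (\<Theta> k ?z - \<Theta> n ?z)) sequentially"
        using neg by (intro order_tendstoD(1)) auto
      then obtain K where K: "\<And>k. k \<ge> K \<Longrightarrow> e < cmod (\<Theta> k ?z - \<Theta> n ?z)"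
        by (auto simp: eventually_sequentially)
      have "\<zeta> \<in> D (max K i)" unfolding D_def
      proof
        fix k assume k: "k \<in> {max n (max K i)..}"
        have "e < cmod (1 - b k ?z)" using K[of k] le[of k ?z] k z by simp
        thus "\<zeta> \<in> A k" using k \<zeta> by (auto simp: A_def)
      qed
      thus False using \<zeta> by blast
    qed
    show ?thesis
    proof (rule ccontr)
      assume neg: "\<not> ?thesis"
      define g where "g r = cmod (\<theta> (of_real r * \<zeta>) - \<Theta> n (of_real r * \<zeta>))" for r
      have "continuous_on {0..<1} g" unfolding g_def
        by (rule continuous_on_compose2[OF cont]) (use \<zeta> in \<open>auto simp: norm_mult intro!: continuous_intros\<close>)
      hence "(g \<longlongrightarrow> g r) (at r within {0..<1})" using r by (simp add: continuous_on_def)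
      hence "eventually (\<lambda>s. e < g s) (at r within {0..<1})"
        by (rule order_tendstoD(1)) (use neg in \<open>simp add: g_def\<close>)
      then obtain d where d: "d > 0" "\<And>s. s \<in> {0..<1} \<Longrightarrow> s \<noteq> r \<Longrightarrow> dist s r < d \<Longrightarrow> e < g s"
        unfolding eventually_at by blast
      \<comment> \<open>A failure at radius \<open>r\<close> persists at nearby radii by continuity,
        hence at some rational radius.\<close>
      obtain s where s: "s \<in> \<rat>" "r < s" "s < min (r + d) 1"
        using Rats_dense_in_real[of r "min (r + d) 1"] d r by auto
      have "s \<in> range q" unfolding Q using s r by (simp add: Q_def)
      then obtain i where "s = q i" by blast
      thus False using rat[of i] d(2)[of s] s r by (simp add: g_def dist_real_def)
    qed
  qed
  have "(\<Union>K. D K) \<in> sets circle_measure" using D_sets by blast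
  thus ?thesis
    using meas main unfolding \<Theta>_def by (intro exI[of _ "\<Union>K. D K"] conjI allI impI) auto
qed

text \<open>Along a sparse subsequence the exceptional sets have summable measure. By Borel-Cantelli
  almost every radius is eventually outside them, and on it the finite products approximate
  \<open>\<theta>\<close> uniformly; since each of them is continuous up to the circle, the limits
  may be interchanged.\<close>

theorem blaschke_radial_limits:
  assumes F: "\<And>n. finite (F n)" "incseq F" "\<And>n i. i \<in> F n \<Longrightarrow> cmod (l i) < 1"
    and \<eta>: "\<And>n k. k \<ge> n \<Longrightarrow> (\<Sum>i\<in>F k - F n. 1 - cmod (l i)) \<le> \<eta> n" "\<eta> \<longlonglongrightarrow> 0"
    and lim: "\<And>z. cmod z < 1 \<Longrightarrow> (\<lambda>n. finite_blaschke l (F n) z) \<longlonglongrightarrow> \<theta> z"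
  obtains \<sigma> where "strict_mono \<sigma>"
    "AE \<zeta> in circle_measure. (\<lambda>n. finite_blaschke l (F (\<sigma> n)) \<zeta>) \<longlonglongrightarrow> boundary_value \<theta> \<zeta>"
proof -
  define \<epsilon> where "\<epsilon> i = (1/2::real) ^ i" for i :: nat
  have \<epsilon>: "\<epsilon> i > 0" for i by (simp add: \<epsilon>_def)
  have "\<exists>n>m. 32 / (\<epsilon> i)\<^sup>2 * \<eta> n \<le> \<epsilon> i" for i m
  proof -
    have "(\<lambda>n. 32 / (\<epsilon> i)\<^sup>2 * \<eta> n) \<longlonglongrightarrow> 32 / (\<epsilon> i)\<^sup>2 * 0" by (intro tendsto_intros \<eta>(2))
    hence "eventually (\<lambda>n. 32 / (\<epsilon> i)\<^sup>2 * \<eta> n < \<epsilon> i) sequentially"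
      using \<epsilon>[of i] by (intro order_tendstoD(2)) auto
    hence "eventually (\<lambda>n. n > m \<and> 32 / (\<epsilon> i)\<^sup>2 * \<eta> n < \<epsilon> i) sequentially"
      using eventually_gt_at_top eventually_conj by blast
    thus ?thesis by (auto simp: eventually_sequentially intro: less_imp_le)
  qed
  hence "\<forall>i m. \<exists>n. n > m \<and> 32 / (\<epsilon> i)\<^sup>2 * \<eta> n \<le> \<epsilon> i" by blast
  then obtain h where "\<forall>i m. h i m > m \<and> 32 / (\<epsilon> i)\<^sup>2 * \<eta> (h i m) \<le> \<epsilon> i" by metis
  hence h: "\<And>i m. h i m > m" "\<And>i m. 32 / (\<epsilon> i)\<^sup>2 * \<eta> (h i m) \<le> \<epsilon> i" by auto
  \<comment> \<open>\<open>h i m\<close> is an index beyond \<open>m\<close> whose tail is so small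
    that the exceptional set for the tolerance \<open>\<epsilon> i\<close> has measure at most
    \<open>\<epsilon> i\<close>.\<close>
  define \<sigma> where "\<sigma> = rec_nat (h 0 0) (\<lambda>i s. h (Suc i) s)"
  have \<sigma>_mono: "strict_mono \<sigma>" by (rule strict_monoI_Suc) (simp add: \<sigma>_def h)
  have \<sigma>: "32 / (\<epsilon> i)\<^sup>2 * \<eta> (\<sigma> i) \<le> \<epsilon> i" for i by (cases i) (use h(2) in \<open>simp_all add: \<sigma>_def\<close>)
  define g where "g i = finite_blaschke l (F (\<sigma> i))" for i
  have "\<exists>D. D \<in> sets circle_measure \<and> measure circle_measure D \<le> \<epsilon> i \<and>
    (\<forall>\<zeta> r. cmod \<zeta> = 1 \<longrightarrow> \<zeta> \<notin> D \<longrightarrow> 0 \<le> r \<longrightarrow> r < 1 \<longrightarrow>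
       cmod (\<theta> (of_real r * \<zeta>) - g i (of_real r * \<zeta>)) \<le> \<epsilon> i)" for i
  proof -
    have "\<exists>D. D \<in> sets circle_measure \<and> measure circle_measure D \<le> 32 / (\<epsilon> i)\<^sup>2 * \<eta> (\<sigma> i) \<and>
      (\<forall>\<zeta> r. cmod \<zeta> = 1 \<longrightarrow> \<zeta> \<notin> D \<longrightarrow> 0 \<le> r \<longrightarrow> r < 1 \<longrightarrow>
         cmod (\<theta> (of_real r * \<zeta>) - finite_blaschke l (F (\<sigma> i)) (of_real r * \<zeta>)) \<le> \<epsilon> i)"
      by (rule blaschke_tail_exceptional_set[OF F(1,2) F(3) \<eta>(1) lim \<epsilon>])
    then obtain D where "D \<in> sets circle_measure" "measure circle_measure D \<le> 32 / (\<epsilon> i)\<^sup>2 * \<eta> (\<sigma> i)"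
      "\<forall>\<zeta> r. cmod \<zeta> = 1 \<longrightarrow> \<zeta> \<notin> D \<longrightarrow> 0 \<le> r \<longrightarrow> r < 1 \<longrightarrow>
         cmod (\<theta> (of_real r * \<zeta>) - g i (of_real r * \<zeta>)) \<le> \<epsilon> i" unfolding g_def by blast
    thus ?thesis using order_trans[OF _ \<sigma>[of i]] by blast
  qed
  hence "\<forall>i. \<exists>D. D \<in> sets circle_measure \<and> measure circle_measure D \<le> \<epsilon> i \<and>
    (\<forall>\<zeta> r. cmod \<zeta> = 1 \<longrightarrow> \<zeta> \<notin> D \<longrightarrow> 0 \<le> r \<longrightarrow> r < 1 \<longrightarrow>
       cmod (\<theta> (of_real r * \<zeta>) - g i (of_real r * \<zeta>)) \<le> \<epsilon> i)" by blast
  from choice[OF this] obtain D where D: "\<And>i. D i \<in> sets circle_measure" "\<And>i. measure circle_measure (D i) \<le> \<epsilon> i"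
    "\<And>i \<zeta> r. cmod \<zeta> = 1 \<Longrightarrow> \<zeta> \<notin> D i \<Longrightarrow> 0 \<le> r \<Longrightarrow> r < 1 \<Longrightarrow>
       cmod (\<theta> (of_real r * \<zeta>) - g i (of_real r * \<zeta>)) \<le> \<epsilon> i" by blast
  have "summable (\<lambda>i. measure circle_measure (D i))"
  proof (rule summable_comparison_test'[of \<epsilon> 0])
    show "summable \<epsilon>" unfolding \<epsilon>_def by (rule summable_geometric) simp
  qed (use D(2) in auto)
  hence AE: "AE \<zeta> in circle_measure. eventually (\<lambda>i. \<zeta> \<in> space circle_measure - D i) sequentially"
    using D(1) circle.emeasure_finite by (intro borel_cantelli_AE1) (auto simp: top.not_eq_extremum[symmetric])
  have "AE \<zeta> in circle_measure. (\<lambda>n. g n \<zeta>) \<longlonglongrightarrow> boundary_value \<theta> \<zeta>"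
    using AE
  proof eventually_elim
    case (elim \<zeta>)
    then obtain I where I: "\<And>i. i \<ge> I \<Longrightarrow> cmod \<zeta> = 1 \<and> \<zeta> \<notin> D i"
      unfolding eventually_sequentially by auto
    hence \<zeta>: "cmod \<zeta> = 1" by blast
    have close: "cmod (\<theta> (of_real r * \<zeta>) - g i (of_real r * \<zeta>)) \<le> \<epsilon> i" if "i \<ge> I" "0 \<le> r" "r < 1" for i r
      using D(3) I that by blast
    have ev: "eventually (\<lambda>r::real. 0 \<le> r \<and> r < 1) (at_left 1)"
      by (rule eventually_at_leftI[of 0]) auto
    have gl: "((\<lambda>r. g i (of_real r * \<zeta>)) \<longlongrightarrow> g i \<zeta>) (at_left 1)" for i
    proof -
      have "continuous_on (cball 0 1) (g i)" unfolding g_def using F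
        by (intro holomorphic_on_imp_continuous_on[OF analytic_imp_holomorphic[OF finite_blaschke_analytic]]) auto
      hence "continuous_on {0..1} (\<lambda>r. g i (of_real r * \<zeta>))"
        by (rule continuous_on_compose2) (use \<zeta> in \<open>auto simp: norm_mult intro!: continuous_intros\<close>)
      hence "((\<lambda>r. g i (of_real r * \<zeta>)) \<longlongrightarrow> g i (of_real 1 * \<zeta>)) (at 1 within {0..1})"
        by (rule continuous_on_def[THEN iffD1, rule_format]) simp
      moreover have "at 1 within {0..1} = at_left (1::real)" by (rule at_within_Icc_at_left) simp
      ultimately show ?thesis by simp
    qed
    have gg: "cmod (g i \<zeta> - g j \<zeta>) \<le> \<epsilon> i + \<epsilon> j" if "i \<ge> I" "j \<ge> I" for i j
    proof (rule tendsto_upperbound)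
      show "((\<lambda>r. cmod (g i (of_real r * \<zeta>) - g j (of_real r * \<zeta>))) \<longlongrightarrow> cmod (g i \<zeta> - g j \<zeta>)) (at_left 1)"
        by (intro tendsto_intros gl)
      show "eventually (\<lambda>r. cmod (g i (of_real r * \<zeta>) - g j (of_real r * \<zeta>)) \<le> \<epsilon> i + \<epsilon> j) (at_left 1)"
        using ev
      proof eventually_elim
        case (elim r)
        have "g i (of_real r * \<zeta>) - g j (of_real r * \<zeta>) =
          (\<theta> (of_real r * \<zeta>) - g j (of_real r * \<zeta>)) - (\<theta> (of_real r * \<zeta>) - g i (of_real r * \<zeta>))" by simp
        hence "cmod (g i (of_real r * \<zeta>) - g j (of_real r * \<zeta>)) \<le>
            cmod (\<theta> (of_real r * \<zeta>) - g j (of_real r * \<zeta>)) + cmod (\<theta> (of_real r * \<zeta>) - g i (of_real r * \<zeta>))"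
          by (metis norm_triangle_ineq4)
        thus ?case using close[OF that(1), of r] close[OF that(2), of r] elim by linarith
      qed
    qed simp
    have \<epsilon>0: "\<epsilon> \<longlonglongrightarrow> 0" unfolding \<epsilon>_def by (rule LIMSEQ_power_zero) simp
    have "Cauchy (\<lambda>i. g i \<zeta>)"
    proof (rule CauchyI)
      fix e :: real assume "e > 0"
      hence "eventually (\<lambda>i. \<epsilon> i < e / 2) sequentially" using order_tendstoD(2)[OF \<epsilon>0, of "e/2"] by simp
      then obtain J where J: "\<And>i. i \<ge> J \<Longrightarrow> \<epsilon> i < e / 2" by (auto simp: eventually_sequentially)
      have "cmod (g i \<zeta> - g j \<zeta>) < e" if "i \<ge> max I J" "j \<ge> max I J" for i j
        using gg[of i j] J[of i] J[of j] that by simp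
      thus "\<exists>M. \<forall>i\<ge>M. \<forall>j\<ge>M. cmod (g i \<zeta> - g j \<zeta>) < e" by blast
    qed
    then obtain L where L: "(\<lambda>i. g i \<zeta>) \<longlonglongrightarrow> L" using Cauchy_convergent convergent_def by blast
    have "((\<lambda>r. \<theta> (of_real r * \<zeta>)) \<longlongrightarrow> L) (at_left 1)"
    proof (rule tendstoI)
      fix e :: real assume e: "e > 0"
      have "eventually (\<lambda>i. \<epsilon> i < e / 3) sequentially" using e by (intro order_tendstoD(2)[OF \<epsilon>0]) auto
      moreover have "eventually (\<lambda>i. dist (g i \<zeta>) L < e / 3) sequentially" using e by (intro tendstoD[OF L]) auto
      ultimately have "eventually (\<lambda>i. i \<ge> I \<and> \<epsilon> i < e / 3 \<and> dist (g i \<zeta>) L < e / 3) sequentially"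
        by (intro eventually_conj eventually_ge_at_top)
      then obtain i where i: "i \<ge> I" "\<epsilon> i < e / 3" "dist (g i \<zeta>) L < e / 3"
        by (auto simp: eventually_sequentially)
      have "eventually (\<lambda>r. dist (g i (of_real r * \<zeta>)) (g i \<zeta>) < e / 3) (at_left 1)"
        using e by (intro tendstoD[OF gl]) auto
      thus "eventually (\<lambda>r. dist (\<theta> (of_real r * \<zeta>)) L < e) (at_left 1)"
        using ev
      proof eventually_elim
        case (elim r)
        have "dist (\<theta> (of_real r * \<zeta>)) (g i (of_real r * \<zeta>)) < e / 3"
          using close[OF i(1), of r] elim i(2) by (simp add: dist_norm)
        thus ?case using elim(1) i(3)
          dist_triangle[of "\<theta> (of_real r * \<zeta>)" L "g i (of_real r * \<zeta>)"]
          dist_triangle[of "g i (of_real r * \<zeta>)" L "g i \<zeta>"] by linarith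
      qed
    qed
    hence "boundary_value \<theta> \<zeta> = L" unfolding boundary_value_def by (intro tendsto_Lim) simp_all
    thus ?case using L by simp
  qed
  thus ?thesis using that \<sigma>_mono by (simp add: g_def)
qed

subsection \<open>Carleson sequences\<close>

text \<open>Termwise this is \<open>1 - x \<le> - ln x\<close> for the squared modulus
  \<open>x\<close>.\<close>

lemma sum_le_ln_finite_blaschke:
  assumes S: "finite S" "\<And>i. i \<in> S \<Longrightarrow> cmod (l i) < 1" and z: "cmod z < 1"
    and c: "c > 0" "c \<le> cmod (finite_blaschke l S z)"
  shows "(\<Sum>i\<in>S. 1 - (cmod (blaschke_factor (l i) z))\<^sup>2) \<le> - 2 * ln c"
proof -
  have "finite_blaschke l S z \<noteq> 0" using c by auto
  hence pos: "0 < cmod (blaschke_factor (l i) z)" if "i \<in> S" for i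
    using that S(1) by (auto simp: finite_blaschke_def)
  have "(\<Sum>i\<in>S. 1 - (cmod (blaschke_factor (l i) z))\<^sup>2) \<le> (\<Sum>i\<in>S. - 2 * ln (cmod (blaschke_factor (l i) z)))"
  proof (rule sum_mono)
    fix i assume i: "i \<in> S"
    have "ln ((cmod (blaschke_factor (l i) z))\<^sup>2) \<le> (cmod (blaschke_factor (l i) z))\<^sup>2 - 1"
      using pos[OF i] by (intro ln_le_minus_one) auto
    thus "1 - (cmod (blaschke_factor (l i) z))\<^sup>2 \<le> - 2 * ln (cmod (blaschke_factor (l i) z))"
      using pos[OF i] by (simp add: ln_realpow)
  qed
  also have "\<dots> = - 2 * ln (cmod (finite_blaschke l S z))"
    unfolding finite_blaschke_def prod_norm[symmetric]
    using pos by (subst ln_prod) (auto simp: S sum_distrib_left)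
  also have "\<dots> \<le> - 2 * ln c" using c \<open>finite_blaschke l S z \<noteq> 0\<close> by simp
  finally show ?thesis .
qed

text \<open>The reverse estimate \<open>- ln x \<le> (1 - x) / x\<close>, where
  \<open>x \<ge> d\<^sup>2\<close> keeps the quotient under control.\<close>

lemma finite_blaschke_lower_bound:
  assumes S: "finite S" and d: "d > 0" "\<And>i. i \<in> S \<Longrightarrow> d \<le> cmod (blaschke_factor (l i) z)"
    and K: "(\<Sum>i\<in>S. 1 - (cmod (blaschke_factor (l i) z))\<^sup>2) \<le> K"
    and le1: "\<And>i. i \<in> S \<Longrightarrow> cmod (blaschke_factor (l i) z) \<le> 1"
  shows "exp (- K / (2 * d\<^sup>2)) \<le> cmod (finite_blaschke l S z)"
proof -
  let ?r = "\<lambda>i. cmod (blaschke_factor (l i) z)"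
  have "exp (- K / (2 * d\<^sup>2)) \<le> exp (\<Sum>i\<in>S. - (1 - (?r i)\<^sup>2) / (2 * d\<^sup>2))"
    using K d unfolding minus_divide_left[symmetric] sum_negf sum_divide_distrib[symmetric]
    by (simp add: divide_right_mono)
  also have "\<dots> = (\<Prod>i\<in>S. exp (- (1 - (?r i)\<^sup>2) / (2 * d\<^sup>2)))" by (simp add: exp_sum S)
  also have "\<dots> \<le> (\<Prod>i\<in>S. ?r i)"
  proof (intro prod_mono conjI)
    fix i assume i: "i \<in> S"
    have r: "0 < ?r i" "d \<le> ?r i" "?r i \<le> 1" using d(1) d(2)[OF i] le1[OF i] by linarith+
    have "ln (1 / (?r i)\<^sup>2) \<le> 1 / (?r i)\<^sup>2 - 1" using r by (intro ln_le_minus_one) auto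
    hence "- 2 * ln (?r i) \<le> (1 - (?r i)\<^sup>2) / (?r i)\<^sup>2"
      using r by (simp add: ln_div ln_realpow diff_divide_distrib)
    also have "\<dots> \<le> (1 - (?r i)\<^sup>2) / d\<^sup>2"
      using r d by (intro divide_left_mono power_mono) (auto simp: power_le_one)
    finally have "- (1 - (?r i)\<^sup>2) / (2 * d\<^sup>2) \<le> ln (?r i)" using d by (simp add: field_simps)
    thus "exp (- (1 - (?r i)\<^sup>2) / (2 * d\<^sup>2)) \<le> ?r i" using r by (simp add: ln_ge_iff[symmetric])
  qed simp
  finally show ?thesis by (simp add: finite_blaschke_def prod_norm)
qed

text \<open>
  Outside the pseudohyperbolic disks about the zeros the modulus of the product is bounded below
  by the maximum modulus principle for its reciprocal.
\<close>

lemma carleson_lower_bound: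
  assumes S: "finite S" "\<And>i. i \<in> S \<Longrightarrow> cmod (l i) < 1"
    and \<delta>: "0 < \<delta>" "\<delta> \<le> 1" "\<And>n. n \<in> S \<Longrightarrow> \<delta> \<le> cmod (finite_blaschke l (S - {n}) (l n))"
    and z: "cmod z < 1"
  shows "(\<exists>n\<in>S. \<delta> / 2 \<le> cmod (finite_blaschke l (S - {n}) z)) \<or> \<delta>\<^sup>2 / 12 \<le> cmod (finite_blaschke l S z)"
proof -
  \<comment> \<open>The weak Schwarz-Pick inequality with its constant 3 then loses at most
    \<open>\<delta> / 2\<close> within pseudohyperbolic distance \<open>\<epsilon>\<close> of a
    zero, and on the boundary of these disks the product is at least
    \<open>\<epsilon> * (\<delta> / 2) = \<delta>\<^sup>2 / 12\<close>.\<close>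
  define \<epsilon> where "\<epsilon> = \<delta> / 6"
  have \<epsilon>: "\<epsilon> > 0" using \<delta> by (simp add: \<epsilon>_def)
  have an: "finite_blaschke l U analytic_on cball 0 1" if "U \<subseteq> S" for U
    using S that by (intro finite_blaschke_analytic) auto
  have near: "\<delta> / 2 \<le> cmod (finite_blaschke l (S - {n}) w)"
    if "n \<in> S" "cmod w < 1" "cmod (blaschke_factor (l n) w) \<le> \<epsilon>" for n w
  proof -
    have "cmod (finite_blaschke l (S - {n}) w - finite_blaschke l (S - {n}) (l n)) \<le> 3 * cmod (blaschke_factor (l n) w)"
    proof (rule schwarz_pick_weak)
      show "finite_blaschke l (S - {n}) holomorphic_on ball 0 1"
        by (rule holomorphic_on_subset[OF analytic_imp_holomorphic[OF an]]) auto
      show "cmod (finite_blaschke l (S - {n}) u) \<le> 1" if "cmod u < 1" for u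
        using S that by (intro cmod_finite_blaschke_le_1) auto
    qed (use S that in auto)
    also have "\<dots> \<le> \<delta> / 2" using that by (simp add: \<epsilon>_def)
    finally show ?thesis
      using \<delta>(3)[OF that(1)] norm_triangle_ineq3[of "finite_blaschke l (S - {n}) w" "finite_blaschke l (S - {n}) (l n)"]
      by linarith
  qed
  show ?thesis
  proof (cases "\<exists>n\<in>S. cmod (blaschke_factor (l n) z) \<le> \<epsilon>")
    case True
    thus ?thesis using near z by blast
  next
    case False
    define W where "W = {w \<in> cball 0 1. \<forall>n\<in>S. \<epsilon> \<le> cmod (blaschke_factor (l n) w)}"
    have cont: "continuous_on (cball 0 1) (\<lambda>w. cmod (blaschke_factor (l n) w))" if "n \<in> S" for n
      using S that by (intro continuous_intros holomorphic_on_imp_continuous_on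
          analytic_imp_holomorphic blaschke_factor_analytic)
    have "W = cball 0 1 \<inter> (\<Inter>n\<in>S. {w \<in> cball 0 1. \<epsilon> \<le> cmod (blaschke_factor (l n) w)})"
      by (auto simp: W_def)
    moreover have "closed {w \<in> cball 0 1. \<epsilon> \<le> cmod (blaschke_factor (l n) w)}" if "n \<in> S" for n
      by (intro continuous_on_closed_Collect_le cont that continuous_intros) auto
    ultimately have closed: "closed W" by auto
    have nz: "finite_blaschke l S w \<noteq> 0" if "w \<in> W" for w
      using that \<epsilon> S by (fastforce simp: W_def finite_blaschke_def)
    have "cmod (1 / finite_blaschke l S z) \<le> 12 / \<delta>\<^sup>2"
    proof (rule maximum_modulus_frontier[of "\<lambda>w. 1 / finite_blaschke l S w" W])
      have hol: "finite_blaschke l S holomorphic_on W"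
        by (rule holomorphic_on_subset[OF analytic_imp_holomorphic[OF an]]) (auto simp: W_def)
      hence hol': "(\<lambda>w. 1 / finite_blaschke l S w) holomorphic_on W"
        using nz by (intro holomorphic_intros) auto
      thus "(\<lambda>w. 1 / finite_blaschke l S w) holomorphic_on interior W"
        by (rule holomorphic_on_subset) (rule interior_subset)
      show "continuous_on (closure W) (\<lambda>w. 1 / finite_blaschke l S w)"
        using holomorphic_on_imp_continuous_on[OF hol'] closed by simp
      show "bounded W" by (rule bounded_subset[OF bounded_cball[of 0 1]]) (auto simp: W_def)
      show "z \<in> W" using False z by (auto simp: W_def not_le intro: less_imp_le)
      fix w assume "w \<in> frontier W"
      hence w: "w \<in> W" "w \<notin> interior W" using closed by (auto simp: frontier_def)
      have "cmod w = 1 \<or> (\<exists>n\<in>S. cmod (blaschke_factor (l n) w) = \<epsilon>)"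
      proof (rule ccontr)
        assume neg: "\<not> ?thesis"
        \<comment> \<open>If neither alternative held, \<open>V\<close> would be an open
          neighbourhood of \<open>w\<close> inside \<open>W\<close>.\<close>
        define V where "V = ball 0 1 \<inter> (\<Inter>n\<in>S. {w \<in> ball 0 1. \<epsilon> < cmod (blaschke_factor (l n) w)})"
        have "open {w \<in> ball 0 1. \<epsilon> < cmod (blaschke_factor (l n) w)}" if "n \<in> S" for n
        proof -
          have "open ((\<lambda>w. cmod (blaschke_factor (l n) w)) -` {\<epsilon><..} \<inter> ball 0 1)"
            using continuous_on_subset[OF cont[OF that] ball_subset_cball]
            by (simp add: continuous_on_open_vimage)
          moreover have "{w \<in> ball 0 1. \<epsilon> < cmod (blaschke_factor (l n) w)} =
              (\<lambda>w. cmod (blaschke_factor (l n) w)) -` {\<epsilon><..} \<inter> ball 0 1" by auto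
          ultimately show ?thesis by simp
        qed
        hence "open V" using S unfolding V_def by (intro open_Int open_INT) auto
        moreover have "w \<in> V" using w(1) neg by (force simp: V_def W_def)
        moreover have "V \<subseteq> W"
        proof
          fix v assume "v \<in> V"
          hence "cmod v < 1" "\<And>n. n \<in> S \<Longrightarrow> \<epsilon> < cmod (blaschke_factor (l n) v)" by (auto simp: V_def)
          thus "v \<in> W" by (simp add: W_def less_imp_le)
        qed
        ultimately show False using w(2) interiorI by blast
      qed
      thus "cmod (1 / finite_blaschke l S w) \<le> 12 / \<delta>\<^sup>2"
      proof
        assume "cmod w = 1"
        hence "cmod (finite_blaschke l S w) = 1" using S by (intro cmod_finite_blaschke_eq_1) auto
        moreover have "\<delta>\<^sup>2 \<le> 1" using \<delta> by (simp add: power_le_one)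
        ultimately show ?thesis using \<delta> by (simp add: norm_divide le_divide_eq)
      next
        assume "\<exists>n\<in>S. cmod (blaschke_factor (l n) w) = \<epsilon>"
        then obtain n where n: "n \<in> S" "cmod (blaschke_factor (l n) w) = \<epsilon>" by blast
        have "cmod w \<noteq> 1" 
          using cmod_blaschke_factor_eq_1[of "l n" w] S n \<delta> by (auto simp: \<epsilon>_def)
        hence "cmod w < 1" using w by (auto simp: W_def)
        have "finite_blaschke l S w = blaschke_factor (l n) w * finite_blaschke l (S - {n}) w"
          using finite_blaschke_mult_diff[of S "{n}" l w] S n by (simp add: finite_blaschke_def)
        hence "cmod (finite_blaschke l S w) = \<epsilon> * cmod (finite_blaschke l (S - {n}) w)"
          using n by (simp add: norm_mult)
        also have "\<dots> \<ge> \<epsilon> * (\<delta> / 2)"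
          using near[OF n(1) \<open>cmod w < 1\<close>] n \<epsilon> by (intro mult_left_mono) auto
        finally have "\<delta>\<^sup>2 / 12 \<le> cmod (finite_blaschke l S w)" by (simp add: \<epsilon>_def power2_eq_square)
        hence "1 / cmod (finite_blaschke l S w) \<le> 1 / (\<delta>\<^sup>2 / 12)"
          using \<delta> by (intro divide_left_mono) (auto intro!: mult_pos_pos intro: less_le_trans[of 0 "\<delta>\<^sup>2/12"])
        thus ?thesis by (simp add: norm_divide)
      qed
    qed
    moreover have "finite_blaschke l S z \<noteq> 0"
      using nz[of z] False z by (auto simp: W_def not_le intro: less_imp_le)
    ultimately have "\<delta>\<^sup>2 / 12 \<le> cmod (finite_blaschke l S z)"
      using \<delta> by (simp add: norm_divide field_simps)
    thus ?thesis ..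
  qed
qed

text \<open>An invariant form of the Carleson measure condition, uniform over the disk. The summand
  1 covers the single zero whose factor may be small at \<open>z\<close>.\<close>

lemma carleson_sum_bound:
  assumes S: "finite S" "\<And>i. i \<in> S \<Longrightarrow> cmod (l i) < 1"
    and \<delta>: "0 < \<delta>" "\<delta> \<le> 1" "\<And>n. n \<in> S \<Longrightarrow> \<delta> \<le> cmod (finite_blaschke l (S - {n}) (l n))"
    and z: "cmod z < 1"
  shows "(\<Sum>i\<in>S. 1 - (cmod (blaschke_factor (l i) z))\<^sup>2) \<le> 1 - 2 * ln (\<delta>\<^sup>2 / 12)"
proof -
  have le: "\<delta>\<^sup>2 / 12 \<le> \<delta> / 2" using \<delta> by (simp add: power2_eq_square field_simps)
  consider n where "n \<in> S" "\<delta> / 2 \<le> cmod (finite_blaschke l (S - {n}) z)"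
    | "\<delta>\<^sup>2 / 12 \<le> cmod (finite_blaschke l S z)"
    using carleson_lower_bound[OF S \<delta> z] by blast
  thus ?thesis
  proof cases
    case 1
    have "(\<Sum>i\<in>S - {n}. 1 - (cmod (blaschke_factor (l i) z))\<^sup>2) \<le> - 2 * ln (\<delta>\<^sup>2 / 12)"
      using S z \<delta> le 1 by (intro sum_le_ln_finite_blaschke) auto
    moreover have "1 - (cmod (blaschke_factor (l n) z))\<^sup>2 \<le> 1" by simp
    ultimately show ?thesis using sum.remove[OF S(1) 1(1), of "\<lambda>i. 1 - (cmod (blaschke_factor (l i) z))\<^sup>2"] by linarith
  next
    case 2
    have "(\<Sum>i\<in>S. 1 - (cmod (blaschke_factor (l i) z))\<^sup>2) \<le> - 2 * ln (\<delta>\<^sup>2 / 12)"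
      using S z \<delta> 2 by (intro sum_le_ln_finite_blaschke) auto
    thus ?thesis by simp
  qed
qed

text \<open>A lower Riemann sum of \<open>exp (- t)\<close>: with the indices ordered by decreasing
  \<open>w\<close>, the term of \<open>x\<close> is at most
  \<open>exp (- s) - exp (- (s + c x))\<close>, where \<open>s\<close> is the sum of the earlier
  coefficients. Equal weights only make the terms smaller.\<close>

lemma exp_weighted_sum_le:
  fixes c w :: "'i \<Rightarrow> real"
  assumes "finite S" "\<And>i. i \<in> S \<Longrightarrow> 0 \<le> c i"
  shows "(\<Sum>n\<in>S. c n * exp (- (\<Sum>k\<in>{k\<in>S. w n \<le> w k}. c k))) \<le> 1 - exp (- (\<Sum>k\<in>S. c k))"
  using assms
proof (induction S rule: finite_ranking_induct[where f = "\<lambda>i. - w i"])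
  case empty
  thus ?case by simp
next
  case (insert x S)
  show ?case
  proof (cases "x \<in> S")
    case True
    thus ?thesis using insert by (simp add: insert_absorb)
  next
    case False
    have all: "{k \<in> insert x S. w x \<le> w k} = insert x S" using insert.hyps by force
    have "(\<Sum>n\<in>S. c n * exp (- (\<Sum>k\<in>{k\<in>insert x S. w n \<le> w k}. c k)))
        \<le> (\<Sum>n\<in>S. c n * exp (- (\<Sum>k\<in>{k\<in>S. w n \<le> w k}. c k)))"
      using insert by (intro sum_mono mult_left_mono) (auto intro!: sum_mono2)
    also have "\<dots> \<le> 1 - exp (- (\<Sum>k\<in>S. c k))" using insert by simp
    finally have 1: "(\<Sum>n\<in>S. c n * exp (- (\<Sum>k\<in>{k\<in>insert x S. w n \<le> w k}. c k))) \<le> 1 - exp (- (\<Sum>k\<in>S. c k))" .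
    have "(1 + c x) * exp (- (c x + (\<Sum>k\<in>S. c k))) \<le> exp (c x) * exp (- (c x + (\<Sum>k\<in>S. c k)))"
      by (intro mult_right_mono) (auto simp: add.commute)
    also have "\<dots> = exp (- (\<Sum>k\<in>S. c k))" by (simp flip: exp_add)
    finally have "c x * exp (- (c x + (\<Sum>k\<in>S. c k))) \<le> exp (- (\<Sum>k\<in>S. c k)) - exp (- (c x + (\<Sum>k\<in>S. c k)))"
      by (simp add: algebra_simps)
    moreover have "(\<Sum>n\<in>insert x S. c n * exp (- (\<Sum>k\<in>{k\<in>insert x S. w n \<le> w k}. c k))) =
        c x * exp (- (\<Sum>k\<in>insert x S. c k)) +
        (\<Sum>n\<in>S. c n * exp (- (\<Sum>k\<in>{k\<in>insert x S. w n \<le> w k}. c k)))"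
      using sum.insert[OF insert.hyps(1) False, of "\<lambda>n. c n * exp (- (\<Sum>k\<in>{k\<in>insert x S. w n \<le> w k}. c k))"]
      by (simp only: all)
    ultimately show ?thesis using 1 unfolding sum.insert[OF insert.hyps(1) False, of c] by linarith
  qed
qed

lemma analytic_on_exp:
  assumes "f analytic_on S"
  shows "(\<lambda>z. exp (f z)) analytic_on S"
proof -
  have "exp analytic_on (f ` S)"
    by (rule analytic_on_subset[of _ UNIV]) (auto simp: analytic_on_open holomorphic_on_exp)
  from analytic_on_compose[OF assms this] show ?thesis by (simp add: o_def)
qed

text \<open>The functions of P. Jones, up to the Blaschke products.\<close>

definition jones :: "('i \<Rightarrow> complex) \<Rightarrow> 'i set \<Rightarrow> 'i \<Rightarrow> complex \<Rightarrow> complex" where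
  "jones l S n z = (of_real (1 - (cmod (l n))\<^sup>2) / (1 - cnj (l n) * z))\<^sup>2 *
     exp (- (\<Sum>k\<in>{k\<in>S. cmod (l n) \<le> cmod (l k)}. of_real (1 - (cmod (l k))\<^sup>2) * ((1 + cnj (l k) * z) / (1 - cnj (l k) * z))))"

lemma jones_analytic:
  assumes "\<And>i. i \<in> S \<Longrightarrow> cmod (l i) < 1" "n \<in> S"
  shows "jones l S n analytic_on cball 0 1"
  unfolding jones_def[abs_def] using one_minus_cnj_mult_neq_0 assms
  by (intro analytic_intros analytic_on_exp) auto

lemma cmod_jones:
  assumes S: "\<And>i. i \<in> S \<Longrightarrow> cmod (l i) < 1" and z: "cmod z \<le> 1"
  shows "cmod (jones l S n z) = (1 - (cmod (l n))\<^sup>2)\<^sup>2 / (cmod (1 - cnj (l n) * z))\<^sup>2 *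
     exp (- (\<Sum>k\<in>{k\<in>S. cmod (l n) \<le> cmod (l k)}. (1 - (cmod (l k))\<^sup>2) * poisson (l k) z))"
proof -
  have "Re (of_real (1 - (cmod (l k))\<^sup>2) * ((1 + cnj (l k) * z) / (1 - cnj (l k) * z)))
      = (1 - (cmod (l k))\<^sup>2) * poisson (l k) z" if "k \<in> S" for k
  proof -
    have "Re (of_real r * w) = r * Re w" for r w by simp
    thus ?thesis unfolding poisson_eq_Re[OF S[OF that] z] .
  qed
  hence "(\<Sum>k\<in>{k\<in>S. cmod (l n) \<le> cmod (l k)}. Re (of_real (1 - (cmod (l k))\<^sup>2) * ((1 + cnj (l k) * z) / (1 - cnj (l k) * z))))
      = (\<Sum>k\<in>{k\<in>S. cmod (l n) \<le> cmod (l k)}. (1 - (cmod (l k))\<^sup>2) * poisson (l k) z)"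
    by (intro sum.cong) auto
  thus ?thesis
    unfolding jones_def
    by (simp add: norm_mult norm_power norm_divide power_divide del: of_real_diff of_real_power of_real_1)
qed

text \<open>The moduli \<open>c k\<close> of the factors in front are at most the Poisson terms in
  the exponent. Putting them there instead makes coefficients and exponents match, as
  \<open>exp_weighted_sum_le\<close> demands.\<close>

lemma sum_jones_le:
  assumes S: "finite S" "\<And>i. i \<in> S \<Longrightarrow> cmod (l i) < 1" and z: "cmod z \<le> 1"
  shows "(\<Sum>n\<in>S. cmod (jones l S n z)) \<le> 1"
proof -
  define c where "c k = (1 - (cmod (l k))\<^sup>2)\<^sup>2 / (cmod (1 - cnj (l k) * z))\<^sup>2" for k
  have cp: "c k \<le> (1 - (cmod (l k))\<^sup>2) * poisson (l k) z" if "k \<in> S" for k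
  proof -
    have "cmod (l k) * cmod z \<le> cmod (l k)" using z by (simp add: mult_left_le)
    hence "(cmod (l k) * cmod z)\<^sup>2 \<le> (cmod (l k))\<^sup>2" by (intro power_mono) auto
    moreover have "(cmod (l k))\<^sup>2 \<le> 1" using S(2)[OF that] by (simp add: power_le_one)
    ultimately show ?thesis
      unfolding c_def poisson_def times_divide_eq_right power2_eq_square[of "1 - _"]
      by (intro divide_right_mono mult_left_mono) auto
  qed
  have "(\<Sum>n\<in>S. cmod (jones l S n z)) \<le> (\<Sum>n\<in>S. c n * exp (- (\<Sum>k\<in>{k\<in>S. cmod (l n) \<le> cmod (l k)}. c k)))"
  proof (rule sum_mono)
    fix n
    show "cmod (jones l S n z) \<le> c n * exp (- (\<Sum>k\<in>{k\<in>S. cmod (l n) \<le> cmod (l k)}. c k))"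
    proof -
      have eq: "cmod (jones l S n z) = c n * exp (- (\<Sum>k\<in>{k\<in>S. cmod (l n) \<le> cmod (l k)}. (1 - (cmod (l k))\<^sup>2) * poisson (l k) z))"
        unfolding c_def by (rule cmod_jones) (use S z in auto)
      have "(\<Sum>k\<in>{k\<in>S. cmod (l n) \<le> cmod (l k)}. c k) \<le>
        (\<Sum>k\<in>{k\<in>S. cmod (l n) \<le> cmod (l k)}. (1 - (cmod (l k))\<^sup>2) * poisson (l k) z)"
        by (intro sum_mono cp) auto
      thus ?thesis unfolding eq by (intro mult_left_mono) (auto simp: c_def)
    qed
  qed
  also have "\<dots> \<le> 1 - exp (- (\<Sum>k\<in>S. c k))"
    by (rule exp_weighted_sum_le) (auto simp: S c_def)
  finally show ?thesis by (smt (verit) exp_ge_zero)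
qed

text \<open>The exponent runs only over zeros at least as far from 0 as \<open>l n\<close>. For
  these \<open>1 - (cmod (l k) * cmod (l n))\<^sup>2 \<le> 2 * (1 - (cmod (l n))\<^sup>2)\<close>,
  so each term is at most twice a term of the Carleson sum. The factor in front has modulus 1 at
  \<open>l n\<close>.\<close>

lemma jones_lower_bound:
  assumes S: "finite S" "\<And>i. i \<in> S \<Longrightarrow> cmod (l i) < 1" and n: "n \<in> S"
    and K: "(\<Sum>i\<in>S. 1 - (cmod (blaschke_factor (l i) (l n)))\<^sup>2) \<le> K"
  shows "exp (- 2 * K) \<le> cmod (jones l S n (l n))"
proof -
  let ?a = "\<lambda>k. 1 - (cmod (blaschke_factor (l k) (l n)))\<^sup>2"
  have ln: "cmod (l n) < 1" using S n by blast
  have trm: "(1 - (cmod (l k))\<^sup>2) * poisson (l k) (l n) \<le> 2 * ?a k"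
    if k: "k \<in> S" "cmod (l n) \<le> cmod (l k)" for k
  proof -
    have "cmod (l n) * cmod (l n) \<le> cmod (l k) * cmod (l n)" using k by (intro mult_right_mono) auto
    hence "(cmod (l n) * cmod (l n))\<^sup>2 \<le> (cmod (l k) * cmod (l n))\<^sup>2" by (intro power_mono) auto
    moreover have "(1 - (cmod (l n))\<^sup>2) * (1 + (cmod (l n))\<^sup>2) \<le> (1 - (cmod (l n))\<^sup>2) * 2"
      using ln by (intro mult_left_mono) (auto simp: power_le_one)
    ultimately have "1 - (cmod (l k) * cmod (l n))\<^sup>2 \<le> 2 * (1 - (cmod (l n))\<^sup>2)"
      by (simp add: power2_eq_square algebra_simps)
    hence "(1 - (cmod (l k))\<^sup>2) * poisson (l k) (l n) \<le>
        (1 - (cmod (l k))\<^sup>2) * (2 * (1 - (cmod (l n))\<^sup>2)) / (cmod (1 - cnj (l k) * l n))\<^sup>2"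
      unfolding poisson_def times_divide_eq_right using S(2)[OF k(1)]
      by (intro divide_right_mono mult_left_mono) (auto simp: power_le_one)
    also have "\<dots> = 2 * ?a k"
      using one_minus_cmod_blaschke_factor[OF one_minus_cnj_mult_neq_0[OF S(2)[OF k(1)] less_imp_le[OF ln]]] by simp
    finally show ?thesis .
  qed
  have "(\<Sum>k\<in>{k\<in>S. cmod (l n) \<le> cmod (l k)}. (1 - (cmod (l k))\<^sup>2) * poisson (l k) (l n)) \<le>
      (\<Sum>k\<in>{k\<in>S. cmod (l n) \<le> cmod (l k)}. 2 * ?a k)"
    by (intro sum_mono trm) auto
  also have "\<dots> \<le> (\<Sum>k\<in>S. 2 * ?a k)"
    using S ln by (intro sum_mono2) (auto simp: power_le_one cmod_blaschke_factor_le_1)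
  also have "\<dots> \<le> 2 * K" using K unfolding sum_distrib_left[symmetric] by simp
  finally have *: "(\<Sum>k\<in>{k\<in>S. cmod (l n) \<le> cmod (l k)}. (1 - (cmod (l k))\<^sup>2) * poisson (l k) (l n)) \<le> 2 * K" .
  have "cnj (l n) * l n = of_real ((cmod (l n))\<^sup>2)" by (metis complex_norm_square mult.commute)
  hence "cmod (1 - cnj (l n) * l n) = \<bar>1 - (cmod (l n))\<^sup>2\<bar>" by (metis norm_of_real of_real_1 of_real_diff)
  moreover have "(cmod (l n))\<^sup>2 < 1" using ln by (simp add: abs_square_less_1)
  ultimately have "(1 - (cmod (l n))\<^sup>2)\<^sup>2 / (cmod (1 - cnj (l n) * l n))\<^sup>2 = 1" by simp
  thus ?thesis using * ln by (subst cmod_jones) (auto simp: S)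
qed

text \<open>Up to unimodular constants, the factor at \<open>c\<close> is the factor at
  \<open>a\<close> followed by the automorphism
  \<open>w \<mapsto> (w - \<mu>) / (1 - cnj \<mu> * w)\<close>, which is close to the identity
  because \<open>cmod \<mu> \<le> d\<close>.\<close>

lemma blaschke_factor_perturbation:
  assumes a: "cmod a < 1" and c: "cmod c < 1" and d: "cmod (blaschke_factor a c) \<le> d" "d < 1"
  obtains u where "cmod u = 1"
    "\<And>z. cmod z \<le> 1 \<Longrightarrow> cmod (blaschke_factor a z - u * blaschke_factor c z) \<le> 2 * d / (1 - d)"
proof -
  \<comment> \<open>The unimodular constant in \<open>blaschke_factor\<close>; it is -1 at 0 because
    there the factor is \<open>z\<close> rather than \<open>0 - z\<close>.\<close>
  define s where "s l = (if l = 0 then -1 else complex_of_real (cmod l) / l)" for l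
  have s: "cmod (s l) = 1" "blaschke_factor l z = s l * ((l - z) / (1 - cnj l * z))" for l z
    by (auto simp: s_def norm_divide blaschke_factor_def)
  define \<kappa> where "\<kappa> = (1 - cnj c * a) / (1 - cnj a * c)"
  have nz: "1 - cnj c * a \<noteq> 0" "1 - cnj a * c \<noteq> 0" "1 - cnj a * a \<noteq> 0"
    using one_minus_cnj_mult_neq_0 a c by auto
  have "cnj (1 - cnj a * c) = 1 - cnj c * a" by (simp add: mult.commute)
  hence "cmod (1 - cnj a * c) = cmod (1 - cnj c * a)" by (metis complex_mod_cnj)
  hence \<kappa>: "cmod \<kappa> = 1" using nz by (simp add: \<kappa>_def norm_divide)
  define \<mu> where "\<mu> = (a - c) / (1 - cnj a * c)"
  have \<mu>: "cmod \<mu> \<le> d" using d(1) by (simp add: \<mu>_def cmod_blaschke_factor norm_divide)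
  show ?thesis
  proof (rule that[of "s a * \<kappa> / s c"])
    show "cmod (s a * \<kappa> / s c) = 1" using s \<kappa> by (simp add: norm_mult norm_divide)
    fix z :: complex assume z: "cmod z \<le> 1"
    have nzz: "1 - cnj a * z \<noteq> 0" "1 - cnj c * z \<noteq> 0" using one_minus_cnj_mult_neq_0 a c z by auto
    define w where "w = (a - z) / (1 - cnj a * z)"
    have w: "cmod w \<le> 1" using cmod_blaschke_factor_le_1[OF a z] by (simp add: w_def cmod_blaschke_factor norm_divide)
    have "cmod (cnj \<mu> * w) \<le> d" using mult_mono[OF \<mu> w] d \<mu> by (simp add: norm_mult order_trans[OF norm_ge_zero \<mu>])
    hence den: "1 - d \<le> cmod (1 - cnj \<mu> * w)" using norm_triangle_ineq2[of 1 "cnj \<mu> * w"] by simp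
    have nd: "1 - cnj \<mu> * w \<noteq> 0" using den d by auto
    have 1: "w - \<mu> = (1 - cnj a * a) * (c - z) / ((1 - cnj a * z) * (1 - cnj a * c))"
      using nz nzz by (simp add: w_def \<mu>_def divide_simps) (simp add: algebra_simps)
    have cnj\<mu>: "cnj \<mu> = (cnj a - cnj c) / (1 - cnj c * a)" by (simp add: \<mu>_def mult.commute)
    have "1 - cnj \<mu> * w = ((1 - cnj c * a) * (1 - cnj a * z) - (cnj a - cnj c) * (a - z)) / ((1 - cnj c * a) * (1 - cnj a * z))"
      unfolding cnj\<mu> w_def times_divide_times_eq using nz(1) nzz(1) by (simp only: diff_divide_distrib divide_self mult_eq_0_iff) simp
    also have "(1 - cnj c * a) * (1 - cnj a * z) - (cnj a - cnj c) * (a - z) = (1 - cnj a * a) * (1 - cnj c * z)"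
      by (simp add: algebra_simps)
    finally have 2: "1 - cnj \<mu> * w = (1 - cnj a * a) * (1 - cnj c * z) / ((1 - cnj c * a) * (1 - cnj a * z))" .
    have cancel: "(p * q / (r * s)) / (p * t / (v * r)) = v / s * (q / t)" if "p \<noteq> 0" "r \<noteq> 0" for p q r s t v :: complex
      using that by (simp add: divide_simps)
    have "(w - \<mu>) / (1 - cnj \<mu> * w) = \<kappa> * ((c - z) / (1 - cnj c * z))"
      unfolding 1 2 \<kappa>_def by (rule cancel) (use nz nzz in auto)
    moreover have "w - (w - \<mu>) / (1 - cnj \<mu> * w) = (\<mu> - cnj \<mu> * w * w) / (1 - cnj \<mu> * w)"
    proof -
      have "w - (w - \<mu>) / (1 - cnj \<mu> * w) = (w * (1 - cnj \<mu> * w) - (w - \<mu>)) / (1 - cnj \<mu> * w)"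
        unfolding diff_divide_distrib[of _ _ "1 - cnj \<mu> * w"] nonzero_mult_div_cancel_right[OF nd] ..
      also have "w * (1 - cnj \<mu> * w) - (w - \<mu>) = \<mu> - cnj \<mu> * w * w" by (simp add: algebra_simps)
      finally show ?thesis .
    qed
    ultimately have w_eq: "w - \<kappa> * ((c - z) / (1 - cnj c * z)) = (\<mu> - cnj \<mu> * w * w) / (1 - cnj \<mu> * w)"
      by simp
    have "s c \<noteq> 0" using s(1)[of c] by auto
    hence "blaschke_factor a z - s a * \<kappa> / s c * blaschke_factor c z
        = s a * w - s a * (\<kappa> * ((c - z) / (1 - cnj c * z)))"
      unfolding s(2) w_def[symmetric] by simp
    also have "\<dots> = s a * ((\<mu> - cnj \<mu> * w * w) / (1 - cnj \<mu> * w))"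
      unfolding right_diff_distrib[symmetric] w_eq ..
    finally have "blaschke_factor a z - s a * \<kappa> / s c * blaschke_factor c z
        = s a * ((\<mu> - cnj \<mu> * w * w) / (1 - cnj \<mu> * w))" .
    hence "cmod (blaschke_factor a z - s a * \<kappa> / s c * blaschke_factor c z)
        = cmod (\<mu> - cnj \<mu> * w * w) / cmod (1 - cnj \<mu> * w)"
      by (simp add: norm_mult norm_divide s(1))
    also have "\<dots> \<le> 2 * d / (1 - d)"
    proof (intro frac_le)
      have "cmod (cnj \<mu> * w * w) \<le> d"
        using mult_mono[OF \<open>cmod (cnj \<mu> * w) \<le> d\<close> w] order_trans[OF norm_ge_zero \<mu>] by (simp add: norm_mult)
      thus "cmod (\<mu> - cnj \<mu> * w * w) \<le> 2 * d" using norm_triangle_ineq4[of \<mu> "cnj \<mu> * w * w"] \<mu> by linarith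
    qed (use den d order_trans[OF norm_ge_zero \<mu>] in auto)
    finally show "cmod (blaschke_factor a z - s a * \<kappa> / s c * blaschke_factor c z) \<le> 2 * d / (1 - d)" .
  qed
qed

subsection \<open>Square functions\<close>

text \<open>The signs are chosen one after another so that every cross term is nonnegative, a
  concrete substitute for the average over all signs.\<close>

lemma signs_exist:
  fixes v :: "'i \<Rightarrow> 'a::real_inner"
  assumes "finite S"
  shows "\<exists>\<epsilon>::'i \<Rightarrow> real. (\<forall>n. \<bar>\<epsilon> n\<bar> = 1) \<and> (\<Sum>n\<in>S. (norm (v n))\<^sup>2) \<le> (norm (\<Sum>n\<in>S. \<epsilon> n *\<^sub>R v n))\<^sup>2"
  using assms
proof (induction S rule: finite_induct)
  case empty
  show ?case by (intro exI[of _ "\<lambda>_. 1"]) simp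
next
  case (insert x S)
  then obtain \<epsilon> :: "'i \<Rightarrow> real" where \<epsilon>: "\<And>n. \<bar>\<epsilon> n\<bar> = 1"
    "(\<Sum>n\<in>S. (norm (v n))\<^sup>2) \<le> (norm (\<Sum>n\<in>S. \<epsilon> n *\<^sub>R v n))\<^sup>2" by blast
  define w where "w = (\<Sum>n\<in>S. \<epsilon> n *\<^sub>R v n)"
  define t where "t = (if inner (v x) w \<ge> 0 then 1 else - 1 :: real)"
  have t: "\<bar>t\<bar> = 1" "t * t = 1" "0 \<le> t * inner (v x) w" by (auto simp: t_def)
  have "(\<Sum>n\<in>insert x S. (\<epsilon>(x := t)) n *\<^sub>R v n) = t *\<^sub>R v x + w"
    using insert.hyps by (simp add: w_def) (intro sum.cong, auto)
  moreover have "(norm (t *\<^sub>R v x + w))\<^sup>2 = (norm (v x))\<^sup>2 + (norm w)\<^sup>2 + 2 * (t * inner (v x) w)"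
    using t(2) by (simp add: power2_norm_eq_inner inner_add_left inner_add_right inner_commute mult.assoc[symmetric])
  ultimately have "(\<Sum>n\<in>insert x S. (norm (v n))\<^sup>2) \<le> (norm (\<Sum>n\<in>insert x S. (\<epsilon>(x := t)) n *\<^sub>R v n))\<^sup>2"
    using \<epsilon>(2) t(3) insert.hyps by (simp add: w_def)
  moreover have "\<forall>n. \<bar>(\<epsilon>(x := t)) n\<bar> = 1" using \<epsilon>(1) t(1) by simp
  ultimately show ?case by blast
qed

context poly_bounded
begin

lemma norm_signed_sum_le:
  assumes f: "\<And>n. n \<in> S \<Longrightarrow> f n analytic_on cball 0 1"
    and B: "\<And>z. cmod z \<le> 1 \<Longrightarrow> (\<Sum>n\<in>S. cmod (f n z)) \<le> B" and \<epsilon>: "\<And>n. \<bar>\<epsilon> n\<bar> = (1::real)"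
  shows "norm (\<Sum>n\<in>S. \<epsilon> n *\<^sub>R calc (f n) x) \<le> M * B * norm x"
proof -
  have "(\<Sum>n\<in>S. \<epsilon> n *\<^sub>R calc (f n) x) = (\<Sum>n\<in>S. calc (\<lambda>z. of_real (\<epsilon> n) * f n z) x)"
    by (intro sum.cong refl) (simp add: calc_scale f scaleC_of_real)
  also have "\<dots> = calc (\<lambda>z. \<Sum>n\<in>S. of_real (\<epsilon> n) * f n z) x"
    using f by (intro calc_sum[symmetric] analytic_intros) auto
  also have "norm \<dots> \<le> M * B * norm x"
  proof (rule calc_bound)
    show "(\<lambda>z. \<Sum>n\<in>S. of_real (\<epsilon> n) * f n z) analytic_on cball 0 1"
      using f by (intro analytic_intros) auto
    fix z :: complex assume z: "cmod z \<le> 1"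
    have "cmod (\<Sum>n\<in>S. of_real (\<epsilon> n) * f n z) \<le> (\<Sum>n\<in>S. cmod (of_real (\<epsilon> n) * f n z))" by (rule norm_sum)
    also have "\<dots> = (\<Sum>n\<in>S. cmod (f n z))" by (simp add: norm_mult \<epsilon>)
    finally show "cmod (\<Sum>n\<in>S. of_real (\<epsilon> n) * f n z) \<le> B" using B[OF z] by simp
  qed
  finally show ?thesis .
qed

text \<open>The bound for the sum of moduli controls every signed sum, in particular one whose norm
  dominates the square function.\<close>

lemma square_function_upper:
  assumes "finite S" "\<And>n. n \<in> S \<Longrightarrow> f n analytic_on cball 0 1"
    and "\<And>z. cmod z \<le> 1 \<Longrightarrow> (\<Sum>n\<in>S. cmod (f n z)) \<le> B"
  shows "(\<Sum>n\<in>S. (norm (calc (f n) x))\<^sup>2) \<le> (M * B * norm x)\<^sup>2"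
proof -
  obtain \<epsilon> :: "'b \<Rightarrow> real" where \<epsilon>: "\<And>n. \<bar>\<epsilon> n\<bar> = 1"
    "(\<Sum>n\<in>S. (norm (calc (f n) x))\<^sup>2) \<le> (norm (\<Sum>n\<in>S. \<epsilon> n *\<^sub>R calc (f n) x))\<^sup>2"
    using signs_exist[OF assms(1), of "\<lambda>n. calc (f n) x"] by blast
  note \<epsilon>(2)
  also have "(norm (\<Sum>n\<in>S. \<epsilon> n *\<^sub>R calc (f n) x))\<^sup>2 \<le> (M * B * norm x)\<^sup>2"
    using norm_signed_sum_le[OF assms(2,3) \<epsilon>(1)] by (intro power_mono) auto
  finally show ?thesis .
qed

text \<open>The signs are applied to the adjoints, whose square function obeys the same bound, and
  Cauchy-Schwarz pairs it with the vectors \<open>v n\<close>.\<close>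

lemma square_function_dual:
  assumes S: "finite S" and f: "\<And>n. n \<in> S \<Longrightarrow> f n analytic_on cball 0 1"
    and B: "\<And>z. cmod z \<le> 1 \<Longrightarrow> (\<Sum>n\<in>S. cmod (f n z)) \<le> B"
  shows "norm (\<Sum>n\<in>S. calc (f n) (v n)) \<le> M * B * sqrt (\<Sum>n\<in>S. (norm (v n))\<^sup>2)"
proof -
  have "\<forall>n. \<exists>A'. n \<in> S \<longrightarrow> (\<forall>x y. inner (calc (f n) x) y = inner x (A' y))"
    using bounded_clinear_adjoint[OF calc_bounded_clinear[OF f]] by metis
  then obtain A' where A': "\<And>n x y. n \<in> S \<Longrightarrow> inner (calc (f n) x) y = inner x (A' n y)" by metis
  define y where "y = (\<Sum>n\<in>S. calc (f n) (v n))"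
  obtain \<epsilon> :: "'b \<Rightarrow> real" where \<epsilon>: "\<And>n. \<bar>\<epsilon> n\<bar> = 1"
    "(\<Sum>n\<in>S. (norm (A' n y))\<^sup>2) \<le> (norm (\<Sum>n\<in>S. \<epsilon> n *\<^sub>R A' n y))\<^sup>2"
    using signs_exist[OF S, of "\<lambda>n. A' n y"] by blast
  define z where "z = (\<Sum>n\<in>S. \<epsilon> n *\<^sub>R A' n y)"
  have B0: "0 \<le> B" using B[of 0] by (smt (verit) norm_ge_zero norm_zero sum_nonneg)
  have "norm z * norm z = (\<Sum>n\<in>S. \<epsilon> n * inner z (A' n y))"
    unfolding power2_eq_square[symmetric] power2_norm_eq_inner
    by (subst (2) z_def) (simp add: inner_sum_right)
  also have "\<dots> = inner (\<Sum>n\<in>S. \<epsilon> n *\<^sub>R calc (f n) z) y"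
    by (simp add: inner_sum_left A')
  also have "\<dots> \<le> norm (\<Sum>n\<in>S. \<epsilon> n *\<^sub>R calc (f n) z) * norm y" by (rule norm_cauchy_schwarz)
  also have "\<dots> \<le> (M * B * norm z) * norm y"
    using norm_signed_sum_le[OF f B \<epsilon>(1)] by (intro mult_right_mono) auto
  finally have z: "norm z \<le> M * B * norm y"
    using B0 M_pos by (cases "z = 0") (auto simp: mult_ac)
  have sq: "sqrt (\<Sum>n\<in>S. (norm (A' n y))\<^sup>2) \<le> M * B * norm y"
    using real_sqrt_le_mono[OF \<epsilon>(2)] z by (simp add: z_def)
  have "norm y * norm y = (\<Sum>n\<in>S. inner (v n) (A' n y))"
    unfolding power2_eq_square[symmetric] power2_norm_eq_inner
    by (subst (1) y_def) (simp add: inner_sum_left A')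
  also have "\<dots> \<le> (\<Sum>n\<in>S. \<bar>norm (v n)\<bar> * \<bar>norm (A' n y)\<bar>)"
    by (intro sum_mono) (simp add: norm_cauchy_schwarz)
  also have "\<dots> \<le> L2_set (\<lambda>n. norm (v n)) S * L2_set (\<lambda>n. norm (A' n y)) S"
    by (rule L2_set_mult_ineq)
  also have "\<dots> \<le> sqrt (\<Sum>n\<in>S. (norm (v n))\<^sup>2) * (M * B * norm y)"
    unfolding L2_set_def using sq by (intro mult_left_mono) (auto intro: sum_nonneg)
  finally have "norm y * norm y \<le> (M * B * sqrt (\<Sum>n\<in>S. (norm (v n))\<^sup>2)) * norm y" by (simp add: mult_ac)
  moreover have "0 \<le> M * B * sqrt (\<Sum>n\<in>S. (norm (v n))\<^sup>2)" using B0 M_pos by (simp add: sum_nonneg)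
  ultimately show ?thesis unfolding y_def[symmetric] by (cases "y = 0") auto
qed

text \<open>For \<open>x = y - cnj l *\<^sub>C T y\<close> the Blaschke factor of \<open>T\<close>
  sends \<open>x\<close> to a unimodular multiple of \<open>l *\<^sub>C y - T y\<close>. The
  identity \<open>id\<close> compares the two term by term, with the positive factor
  \<open>1 - (cmod l)\<^sup>2\<close>, so contractivity passes to \<open>T\<close> without any
  inversion.\<close>

lemma contraction_from_blaschke_factor:
  fixes A :: "'p \<Rightarrow> 'a \<Rightarrow> 'a"
  assumes l: "cmod l < 1" and A: "\<And>p. p \<in> P \<Longrightarrow> bounded_clinear (A p)"
    and V: "\<And>x. x \<in> V \<Longrightarrow> x - cnj l *\<^sub>C T x \<in> V"
    and le: "\<And>x. x \<in> V \<Longrightarrow> (\<Sum>p\<in>P. (norm (A p (calc (blaschke_factor l) x)))\<^sup>2) \<le> (\<Sum>p\<in>P. (norm (A p x))\<^sup>2)"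
    and y: "y \<in> V"
  shows "(\<Sum>p\<in>P. (norm (A p (T y)))\<^sup>2) \<le> (\<Sum>p\<in>P. (norm (A p y))\<^sup>2)"
proof -
  define s where "s = (if l = 0 then -1 else complex_of_real (cmod l) / l)"
  have s: "cmod s = 1" by (auto simp: s_def norm_divide)
  define x where "x = y - cnj l *\<^sub>C T y"
  have x_calc: "x = calc (\<lambda>z. 1 - cnj l * z) y"
  proof -
    have "calc (\<lambda>z. 1 - cnj l * z) y = calc (\<lambda>z. 1) y - calc (\<lambda>z. cnj l * z) y"
      by (intro calc_diff analytic_intros)
    also have "\<dots> = x" unfolding x_def
      by (simp add: calc_const calc_scale analytic_intros calc_ident)
    finally show ?thesis ..
  qed
  have "calc (blaschke_factor l) x = calc (\<lambda>z. blaschke_factor l z * (1 - cnj l * z)) y"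
    unfolding x_calc by (intro calc_mult[symmetric] blaschke_factor_analytic l analytic_intros)
  also have "calc (\<lambda>z. blaschke_factor l z * (1 - cnj l * z)) = calc (\<lambda>z. s * (l - z))"
  proof (rule calc_cong)
    fix z :: complex assume "cmod z \<le> 1"
    thus "blaschke_factor l z * (1 - cnj l * z) = s * (l - z)"
      using one_minus_cnj_mult_neq_0[OF l, of z] by (simp add: blaschke_factor_def s_def)
  qed
  also have "calc (\<lambda>z. s * (l - z)) y = s *\<^sub>C (calc (\<lambda>z. l) y - calc (\<lambda>z. z) y)"
    by (subst calc_scale, intro analytic_intros) (intro arg_cong[of _ _ "(*\<^sub>C) s"] calc_diff analytic_intros)
  finally have bx: "calc (blaschke_factor l) x = s *\<^sub>C (l *\<^sub>C y - T y)" by (simp add: calc_const calc_ident)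
  have id: "(norm (u - cnj l *\<^sub>C v))\<^sup>2 - (norm (l *\<^sub>C u - v))\<^sup>2 = (1 - (cmod l)\<^sup>2) * ((norm u)\<^sup>2 - (norm v)\<^sup>2)" for u v :: 'a
  proof -
    have e: "(norm (a - b))\<^sup>2 = (norm a)\<^sup>2 + (norm b)\<^sup>2 - 2 * inner a b" for a b :: 'a
      by (simp add: power2_norm_eq_inner inner_diff_left inner_diff_right inner_commute)
    have "inner u (cnj l *\<^sub>C v) = inner (l *\<^sub>C u) v"
      by (simp add: inner_eq_Re_cinner cinner_scaleC_left cinner_scaleC_right)
    thus ?thesis unfolding e by (simp add: power_mult_distrib algebra_simps)
  qed
  have "(\<Sum>p\<in>P. (norm (A p (calc (blaschke_factor l) x)))\<^sup>2) \<le> (\<Sum>p\<in>P. (norm (A p x))\<^sup>2)"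
    by (rule le) (use V y in \<open>simp add: x_def\<close>)
  moreover have "(norm (A p (calc (blaschke_factor l) x)))\<^sup>2 = (norm (l *\<^sub>C A p y - A p (T y)))\<^sup>2" if "p \<in> P" for p
    unfolding bx
    by (simp add: bounded_clinear_scaleC[OF A[OF that]] bounded_clinear_simps[OF A[OF that]] s)
  moreover have "(norm (A p x))\<^sup>2 = (norm (A p y - cnj l *\<^sub>C A p (T y)))\<^sup>2" if "p \<in> P" for p
    unfolding x_def
    by (simp add: bounded_clinear_scaleC[OF A[OF that]] bounded_clinear_simps[OF A[OF that]] s)
  ultimately have "0 \<le> (\<Sum>p\<in>P. (norm (A p y - cnj l *\<^sub>C A p (T y)))\<^sup>2 - (norm (l *\<^sub>C A p y - A p (T y)))\<^sup>2)"
    by (simp add: sum_subtractf)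
  hence "0 \<le> (1 - (cmod l)\<^sup>2) * (\<Sum>p\<in>P. (norm (A p y))\<^sup>2 - (norm (A p (T y)))\<^sup>2)"
    unfolding id sum_distrib_left .
  moreover have "0 < 1 - (cmod l)\<^sup>2" using l by (simp add: abs_square_less_1)
  ultimately have "0 \<le> (\<Sum>p\<in>P. (norm (A p y))\<^sup>2 - (norm (A p (T y)))\<^sup>2)" by (simp add: zero_le_mult_iff)
  thus ?thesis by (simp add: sum_subtractf)
qed

end

section \<open>Dividing out zeros of analytic functions\<close>

lemma analytic_factor_zero:
  assumes f: "f analytic_on cball 0 1" and a: "cmod a < 1" "f a = 0"
  obtains q where "q analytic_on cball 0 1" "\<And>z. cmod z \<le> 1 \<Longrightarrow> f z = blaschke_factor a z * q z"
proof -
  obtain S where S: "open S" "cball 0 1 \<subseteq> S" "f holomorphic_on S"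
    using f analytic_on_holomorphic by metis
  define g where "g z = (if z = a then deriv f a else (f z - f a) / (z - a))" for z
  define s where "s = (if a = 0 then 1 else - a / of_real (cmod a))"
  have "g holomorphic_on S" unfolding g_def by (rule pole_lemma_open[OF S(3,1)])
  hence g: "g analytic_on cball 0 1" using S(1,2) analytic_on_holomorphic by blast
  show ?thesis
  proof (rule that[of "\<lambda>z. g z * (s * (1 - cnj a * z))"])
    show "(\<lambda>z. g z * (s * (1 - cnj a * z))) analytic_on cball 0 1" by (intro analytic_intros g)
    fix z :: complex assume "cmod z \<le> 1"
    hence nz: "1 - cnj a * z \<noteq> 0" by (rule one_minus_cnj_mult_neq_0[OF a(1)])
    have "f z = (z - a) * g z" using a by (simp add: g_def)
    moreover have "blaschke_factor a z * (s * (1 - cnj a * z)) = z - a"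
    proof (cases "a = 0")
      case False
      have "blaschke_factor a z * (s * (1 - cnj a * z)) =
          ((of_real (cmod a) / a) * s) * ((a - z) / (1 - cnj a * z) * (1 - cnj a * z))"
        using False by (simp only: blaschke_factor_def if_False mult_ac)
      also have "(of_real (cmod a) / a) * s = -1" using False by (simp add: s_def)
      also have "(a - z) / (1 - cnj a * z) * (1 - cnj a * z) = a - z" using nz by simp
      finally show ?thesis by simp
    qed (simp add: s_def blaschke_factor_def)
    ultimately show "f z = blaschke_factor a z * (g z * (s * (1 - cnj a * z)))" by (metis mult.assoc mult.commute)
  qed
qed

lemma analytic_factor_zeros:
  assumes "finite F" "inj_on l F" "\<And>n. n \<in> F \<Longrightarrow> cmod (l n) < 1"
    and "f analytic_on cball 0 1" "\<And>n. n \<in> F \<Longrightarrow> f (l n) = 0"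
  shows "\<exists>q. q analytic_on cball 0 1 \<and> (\<forall>z. cmod z \<le> 1 \<longrightarrow> f z = finite_blaschke l F z * q z)"
  using assms
proof (induction F arbitrary: f rule: finite_induct)
  case empty
  thus ?case by (intro exI[of _ f]) (simp add: finite_blaschke_def)
next
  case (insert n F)
  obtain q where q: "q analytic_on cball 0 1" "\<And>z. cmod z \<le> 1 \<Longrightarrow> f z = blaschke_factor (l n) z * q z"
    using analytic_factor_zero[of f "l n"] insert.prems by auto
  have "q (l m) = 0" if m: "m \<in> F" for m
  proof -
    have "l m \<noteq> l n" using insert.prems(1) insert.hyps(2) m by (auto simp: inj_on_def)
    hence "cmod (blaschke_factor (l n) (l m)) \<noteq> 0"
      using one_minus_cnj_mult_neq_0[of "l n" "l m"] less_imp_le[OF insert.prems(2)[of m]] insert.prems(2) m by (simp add: cmod_blaschke_factor)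
    moreover have "f (l m) = 0" "cmod (l m) \<le> 1" using insert.prems m by (auto intro: less_imp_le)
    ultimately show ?thesis using q(2)[of "l m"] by auto
  qed
  then obtain p where "p analytic_on cball 0 1" "\<And>z. cmod z \<le> 1 \<Longrightarrow> q z = finite_blaschke l F z * p z"
    using insert.IH[OF _ _ q(1)] insert.prems by (auto simp: inj_on_insert)
  thus ?case using q(2) insert.hyps by (intro exI[of _ p]) (simp add: finite_blaschke_def mult_ac)
qed

subsection \<open>Equivalent quadratic forms for finite Blaschke products\<close>

text \<open>\<open>col\<close> tells which interpolating sequence a zero comes from; only zeros of
  one colour are separated. The condition \<open>8 * K * M * d \<le> 1\<close> serves the comparison
  of powers: at most \<open>2 * K\<close> zeros lie within \<open>d\<close> of a given one, and
  replacing one Blaschke factor by another costs at most \<open>2 * d / (1 - d) \<le> 4 * d\<close>,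
  so the total error is at most \<open>1 / M\<close>.\<close>

locale carleson_form = poly_bounded T M
  for T :: "'a::complex_hilbert_space \<Rightarrow> 'a" and M :: real +
  fixes S :: "'i set" and l :: "'i \<Rightarrow> complex" and col :: "'i \<Rightarrow> nat" and N :: nat and K d :: real
  assumes finite_S: "finite S" and l_less_1: "\<And>n. n \<in> S \<Longrightarrow> cmod (l n) < 1"
    and col_less: "\<And>n. n \<in> S \<Longrightarrow> col n < N"
    and sum_le_K: "\<And>z. cmod z < 1 \<Longrightarrow> (\<Sum>n\<in>S. 1 - (cmod (blaschke_factor (l n) z))\<^sup>2) \<le> K"
    and d: "0 < d" "d \<le> 1 / 2" "8 * K * M * d \<le> 1"
    and separated: "\<And>k n. k \<in> S \<Longrightarrow> n \<in> S \<Longrightarrow> k \<noteq> n \<Longrightarrow> col k = col n \<Longrightarrow>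
      d \<le> cmod (blaschke_factor (l k) (l n))"
begin

definition near :: "'i \<Rightarrow> 'i set" where
  "near n = {k\<in>S. cmod (blaschke_factor (l k) (l n)) < d}"

text \<open>The factors of the zeros near \<open>n\<close> are left out so that the value at
  \<open>l n\<close> stays bounded below.\<close>

definition G :: "'i \<Rightarrow> complex \<Rightarrow> complex" where
  "G n z = finite_blaschke l (S - near n) z * jones l S n z"

definition form_ops :: "'i \<times> nat \<Rightarrow> 'a \<Rightarrow> 'a" where
  "form_ops p x = calc (\<lambda>z. G (fst p) z * blaschke_factor (l (fst p)) z ^ snd p) x"

text \<open>The powers stop just before \<open>card (near n)\<close>; that power is compared with
  the power 0 in \<open>norm_calc_power_card_near_le\<close>.\<close>

definition form_index :: "('i \<times> nat) set" where
  "form_index = Sigma S (\<lambda>n. {..<card (near n)})"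

definition form :: "'a \<Rightarrow> real" where
  "form x = (\<Sum>p\<in>form_index. (norm (form_ops p x))\<^sup>2)"

lemma near_self: "n \<in> S \<Longrightarrow> n \<in> near n"
  using d by (simp add: near_def blaschke_factor_self)

lemma near_subset: "near n \<subseteq> S" by (auto simp: near_def)

lemma finite_near: "finite (near n)" using near_subset finite_S finite_subset by blast

text \<open>Each nearby zero contributes at least \<open>1 - d\<^sup>2 \<ge> 1 / 2\<close> to the
  Carleson sum at \<open>l n\<close>.\<close>

lemma card_near_le:
  assumes "n \<in> S"
  shows "real (card (near n)) \<le> 2 * K"
proof -
  have "real (card (near n)) = 2 * (\<Sum>k\<in>near n. 1 / 2)" by simp
  also have "(\<Sum>k\<in>near n. 1 / 2) \<le> (\<Sum>k\<in>near n. 1 - (cmod (blaschke_factor (l k) (l n)))\<^sup>2)"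
  proof (rule sum_mono)
    fix k assume "k \<in> near n"
    hence "cmod (blaschke_factor (l k) (l n)) \<le> 1 / 2" using d by (auto simp: near_def)
    hence "(cmod (blaschke_factor (l k) (l n)))\<^sup>2 \<le> (1 / 2)\<^sup>2" by (intro power_mono) auto
    thus "1 / 2 \<le> 1 - (cmod (blaschke_factor (l k) (l n)))\<^sup>2" by (simp add: power2_eq_square)
  qed
  also have "\<dots> \<le> (\<Sum>k\<in>S. 1 - (cmod (blaschke_factor (l k) (l n)))\<^sup>2)"
    using l_less_1 assms
    by (intro sum_mono2 finite_S near_subset) (auto simp: power_le_one cmod_blaschke_factor_le_1 less_imp_le)
  also have "\<dots> \<le> K" using sum_le_K l_less_1 assms by blast
  finally show ?thesis by simp
qed

lemma bf_analytic: "n \<in> S \<Longrightarrow> blaschke_factor (l n) analytic_on cball 0 1"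
  by (intro blaschke_factor_analytic l_less_1)

lemma fb_analytic: "U \<subseteq> S \<Longrightarrow> finite_blaschke l U analytic_on cball 0 1"
  by (rule finite_blaschke_analytic) (auto intro: l_less_1)

lemma jones_analytic': "n \<in> S \<Longrightarrow> jones l S n analytic_on cball 0 1"
  by (rule jones_analytic) (auto intro: l_less_1)

lemma G_analytic: "n \<in> S \<Longrightarrow> G n analytic_on cball 0 1"
  unfolding G_def[abs_def] by (intro analytic_intros fb_analytic jones_analytic') auto

lemma sum_jones_le': "cmod z \<le> 1 \<Longrightarrow> (\<Sum>n\<in>S. cmod (jones l S n z)) \<le> 1"
  by (rule sum_jones_le) (auto intro: finite_S l_less_1)

lemma cmod_G_le: "cmod z \<le> 1 \<Longrightarrow> cmod (G n z) \<le> cmod (jones l S n z)"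
  using cmod_finite_blaschke_le_1[of "S - near n" l z] l_less_1
  by (simp add: G_def norm_mult mult_left_le_one_le)

lemma K_nonneg: "0 \<le> K"
proof -
  have "0 \<le> (\<Sum>n\<in>S. 1 - (cmod (blaschke_factor (l n) 0))\<^sup>2)"
    by (intro sum_nonneg) (use l_less_1 in \<open>auto simp: power_le_one cmod_blaschke_factor_le_1\<close>)
  also have "\<dots> \<le> K" by (rule sum_le_K) simp
  finally show ?thesis .
qed

lemma form_ops_clinear: "p \<in> form_index \<Longrightarrow> bounded_clinear (form_ops p)"
  unfolding form_ops_def[abs_def] form_index_def
  by (intro calc_bounded_clinear analytic_intros G_analytic bf_analytic) auto

lemma form_upper: "form x \<le> real (nat \<lceil>2 * K\<rceil>) * (M * norm x)\<^sup>2"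
proof -
  let ?D = "nat \<lceil>2 * K\<rceil>"
  have card: "card (near n) \<le> ?D" if "n \<in> S" for n
    using card_near_le[OF that] by linarith
  have "form x = (\<Sum>n\<in>S. \<Sum>m<card (near n). (norm (form_ops (n, m) x))\<^sup>2)"
    unfolding form_def form_index_def by (subst sum.Sigma) (auto simp: finite_S)
  \<comment> \<open>A common range of powers allows the sums to be interchanged; each fixed power
    then gives a square function over \<open>S\<close>.\<close>
  also have "\<dots> \<le> (\<Sum>n\<in>S. \<Sum>m<?D. (norm (form_ops (n, m) x))\<^sup>2)"
    using card by (intro sum_mono sum_mono2) auto
  also have "\<dots> = (\<Sum>m<?D. \<Sum>n\<in>S. (norm (form_ops (n, m) x))\<^sup>2)" by (rule sum.swap)
  also have "\<dots> \<le> (\<Sum>m<?D. (M * norm x)\<^sup>2)"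
  proof (rule sum_mono)
    fix m
    have "(\<Sum>n\<in>S. (norm (calc (\<lambda>z. G n z * blaschke_factor (l n) z ^ m) x))\<^sup>2) \<le> (M * 1 * norm x)\<^sup>2"
    proof (rule square_function_upper[OF finite_S])
      show "(\<lambda>z. G n z * blaschke_factor (l n) z ^ m) analytic_on cball 0 1" if "n \<in> S" for n
        using that by (intro analytic_intros G_analytic bf_analytic)
      fix z :: complex assume z: "cmod z \<le> 1"
      have "(\<Sum>n\<in>S. cmod (G n z * blaschke_factor (l n) z ^ m)) \<le> (\<Sum>n\<in>S. cmod (jones l S n z))"
      proof (rule sum_mono)
        fix n assume n: "n \<in> S"
        have "cmod (blaschke_factor (l n) z ^ m) \<le> 1"
          using cmod_blaschke_factor_le_1[OF l_less_1[OF n] z] by (simp add: norm_power power_le_one)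
        hence "cmod (G n z * blaschke_factor (l n) z ^ m) \<le> cmod (G n z) * 1"
          unfolding norm_mult by (intro mult_left_mono) auto
        thus "cmod (G n z * blaschke_factor (l n) z ^ m) \<le> cmod (jones l S n z)"
          using cmod_G_le[OF z, of n] by simp
      qed
      thus "(\<Sum>n\<in>S. cmod (G n z * blaschke_factor (l n) z ^ m)) \<le> 1" using sum_jones_le'[OF z] by simp
    qed
    thus "(\<Sum>n\<in>S. (norm (form_ops (n, m) x))\<^sup>2) \<le> (M * norm x)\<^sup>2" by (simp add: form_ops_def)
  qed
  finally show ?thesis by simp
qed

definition null_space :: "'a set" where
  "null_space = {x. calc (finite_blaschke l S) x = 0}"

lemma calc_eq_0_on_null_space:
  assumes "x \<in> null_space" "f analytic_on cball 0 1" "q analytic_on cball 0 1"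
    and "\<And>z. cmod z \<le> 1 \<Longrightarrow> f z = q z * finite_blaschke l S z"
  shows "calc f x = 0"
proof -
  have "calc f x = calc (\<lambda>z. q z * finite_blaschke l S z) x"
    using calc_cong[of f "\<lambda>z. q z * finite_blaschke l S z"] assms(4) by simp
  also have "\<dots> = calc q (calc (finite_blaschke l S) x)" by (intro calc_mult assms(3) fb_analytic) auto
  also have "\<dots> = 0" using assms(1)
    by (simp add: null_space_def bounded_clinear_simps[OF calc_bounded_clinear[OF assms(3)]])
  finally show ?thesis .
qed

text \<open>
  On the null space, the power \<open>card (near n)\<close> of the Blaschke factor at \<open>l n\<close> may be replaced by its small difference from a unimodular multiple of the product over \<open>near n\<close>.
\<close>

lemma norm_calc_power_card_near_le:
  assumes n: "n \<in> S" and x: "x \<in> null_space"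
  shows "norm (calc (\<lambda>z. G n z * blaschke_factor (l n) z ^ card (near n)) x) \<le> norm (calc (G n) x)"
proof -
  let ?b = "blaschke_factor (l n)"
  have "\<forall>k\<in>near n. \<exists>u. cmod u = 1 \<and> (\<forall>z. cmod z \<le> 1 \<longrightarrow> cmod (?b z - u * blaschke_factor (l k) z) \<le> 2 * d / (1 - d))"
  proof
    fix k assume k: "k \<in> near n"
    hence kS: "k \<in> S" and kd: "cmod (blaschke_factor (l n) (l k)) \<le> d"
      using cmod_blaschke_factor_commute[of "l n" "l k"] by (auto simp: near_def)
    show "\<exists>u. cmod u = 1 \<and> (\<forall>z. cmod z \<le> 1 \<longrightarrow> cmod (?b z - u * blaschke_factor (l k) z) \<le> 2 * d / (1 - d))"
    proof -
      have "d < 1" using d by simp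
      from blaschke_factor_perturbation[OF l_less_1[OF n] l_less_1[OF kS] kd this] show ?thesis by blast
    qed
  qed
  then obtain u where u: "\<And>k. k \<in> near n \<Longrightarrow> cmod (u k) = 1"
    "\<And>k z. k \<in> near n \<Longrightarrow> cmod z \<le> 1 \<Longrightarrow> cmod (?b z - u k * blaschke_factor (l k) z) \<le> 2 * d / (1 - d)" by metis
  define \<beta> where "\<beta> z = (\<Prod>k\<in>near n. u k * blaschke_factor (l k) z)" for z
  define r where "r z = ?b z ^ card (near n) - \<beta> z" for z
  have \<beta>: "\<beta> analytic_on cball 0 1" unfolding \<beta>_def[abs_def]
    using near_subset by (intro analytic_intros bf_analytic) auto
  have r: "r analytic_on cball 0 1" unfolding r_def[abs_def] by (intro analytic_intros bf_analytic n \<beta>)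
  have r_le: "cmod (r z) \<le> 1 / M" if z: "cmod z \<le> 1" for z
  proof -
    have le1: "cmod (blaschke_factor (l k) z) \<le> 1" if "k \<in> S" for k
      using cmod_blaschke_factor_le_1[OF l_less_1[OF that] z] .
    have "r z = (\<Prod>k\<in>near n. ?b z) - (\<Prod>k\<in>near n. u k * blaschke_factor (l k) z)"
      by (simp add: r_def \<beta>_def)
    also have "cmod \<dots> \<le> (\<Sum>k\<in>near n. cmod (?b z - u k * blaschke_factor (l k) z))"
      using le1 n near_subset u(1) by (intro norm_prod_diff) (auto simp: norm_mult)
    also have "\<dots> \<le> (\<Sum>k\<in>near n. 2 * d / (1 - d))" by (intro sum_mono u z)
    also have "\<dots> = real (card (near n)) * (2 * d / (1 - d))" by simp
    also have "\<dots> \<le> (2 * K) * (4 * d)"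
      using card_near_le[OF n] K_nonneg d by (intro mult_mono) (auto simp: field_simps)
    also have "\<dots> \<le> 1 / M" using d M_pos by (simp add: field_simps)
    finally show ?thesis .
  qed
  \<comment> \<open>\<open>G n\<close> contains the factors outside \<open>near n\<close> and
    \<open>\<beta>\<close> those inside, so together they are a multiple of the full Blaschke
    product.\<close>
  have "calc (\<lambda>z. G n z * \<beta> z) x = 0"
  proof (rule calc_eq_0_on_null_space[OF x])
    show "(\<lambda>z. G n z * \<beta> z) analytic_on cball 0 1" by (intro analytic_intros G_analytic n \<beta>)
    show "(\<lambda>z. (\<Prod>k\<in>near n. u k) * jones l S n z) analytic_on cball 0 1"
      by (intro analytic_intros jones_analytic' n)
    fix z
    show "G n z * \<beta> z = (\<Prod>k\<in>near n. u k) * jones l S n z * finite_blaschke l S z"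
      using finite_blaschke_mult_diff[OF finite_S near_subset[of n], of l z]
      by (simp add: G_def \<beta>_def prod.distrib finite_blaschke_def mult_ac)
  qed
  moreover have "(\<lambda>z. G n z * ?b z ^ card (near n)) = (\<lambda>z. r z * G n z + G n z * \<beta> z)"
    by (simp add: r_def algebra_simps)
  moreover have "calc (\<lambda>z. r z * G n z + G n z * \<beta> z) x = calc (\<lambda>z. r z * G n z) x + calc (\<lambda>z. G n z * \<beta> z) x"
    by (intro calc_add analytic_intros r G_analytic n \<beta>)
  ultimately have "calc (\<lambda>z. G n z * ?b z ^ card (near n)) x = calc r (calc (G n) x)"
    by (simp add: calc_mult r G_analytic n)
  also have "norm \<dots> \<le> M * (1 / M) * norm (calc (G n) x)" by (rule calc_bound[OF r r_le])
  finally show ?thesis using M_pos by simp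
qed

lemma null_space_diff_T:
  assumes "x \<in> null_space"
  shows "x - c *\<^sub>C T x \<in> null_space"
proof -
  note b = fb_analytic[OF order_refl]
  have "calc (finite_blaschke l S) (T x) = T (calc (finite_blaschke l S) x)"
    using calc_commute[OF b analytic_on_ident, of x] by (simp add: calc_ident)
  thus ?thesis using assms bounded_clinear_scaleC[OF calc_bounded_clinear[OF b]]
    by (simp add: null_space_def bounded_clinear_simps[OF calc_bounded_clinear[OF b]]
        bounded_clinear_simps[OF clinear_T])
qed

text \<open>For each \<open>n\<close> the Blaschke factor shifts the powers by one: the sum gains
  the power \<open>card (near n)\<close> and loses the power 0, which dominates it by
  \<open>norm_calc_power_card_near_le\<close>. Then \<open>contraction_from_blaschke_factor\<close>
  passes to \<open>T\<close>.\<close>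

lemma form_contraction:
  assumes "x \<in> null_space"
  shows "form (T x) \<le> form x"
proof -
  have split: "form x = (\<Sum>n\<in>S. \<Sum>m<card (near n). (norm (form_ops (n, m) x))\<^sup>2)" for x
    unfolding form_def form_index_def by (subst sum.Sigma) (auto simp: finite_S)
  have "(\<Sum>m<card (near n). (norm (form_ops (n, m) (T x)))\<^sup>2) \<le> (\<Sum>m<card (near n). (norm (form_ops (n, m) x))\<^sup>2)"
    if n: "n \<in> S" for n
  proof (rule contraction_from_blaschke_factor[where V = null_space, OF l_less_1[OF n] _ null_space_diff_T _ assms])
    show "bounded_clinear (form_ops (n, m))" if "m \<in> {..<card (near n)}" for m
      using that n by (intro form_ops_clinear) (simp add: form_index_def)
    fix y assume y: "y \<in> null_space"
    let ?b = "blaschke_factor (l n)"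
    have step: "form_ops (n, m) (calc ?b y) = form_ops (n, Suc m) y" for m
      unfolding form_ops_def fst_conv snd_conv
      by (subst calc_mult[symmetric], intro analytic_intros G_analytic bf_analytic n, rule bf_analytic[OF n])
         (simp add: mult_ac)
    have "(\<Sum>m<card (near n). (norm (form_ops (n, m) (calc ?b y)))\<^sup>2) + (norm (form_ops (n, 0) y))\<^sup>2 =
        (\<Sum>m<Suc (card (near n)). (norm (form_ops (n, m) y))\<^sup>2)"
      unfolding step by (simp only: sum.lessThan_Suc_shift add.commute)
    also have "\<dots> = (\<Sum>m<card (near n). (norm (form_ops (n, m) y))\<^sup>2) + (norm (form_ops (n, card (near n)) y))\<^sup>2"
      by simp
    finally have "(\<Sum>m<card (near n). (norm (form_ops (n, m) (calc ?b y)))\<^sup>2) + (norm (form_ops (n, 0) y))\<^sup>2 =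
        (\<Sum>m<card (near n). (norm (form_ops (n, m) y))\<^sup>2) + (norm (form_ops (n, card (near n)) y))\<^sup>2" .
    moreover have "norm (form_ops (n, card (near n)) y) \<le> norm (form_ops (n, 0) y)"
      using norm_calc_power_card_near_le[OF n y] by (simp add: form_ops_def)
    hence "(norm (form_ops (n, card (near n)) y))\<^sup>2 \<le> (norm (form_ops (n, 0) y))\<^sup>2"
      by (intro power_mono) auto
    ultimately show "(\<Sum>m<card (near n). (norm (form_ops (n, m) (calc ?b y)))\<^sup>2) \<le> (\<Sum>m<card (near n). (norm (form_ops (n, m) y))\<^sup>2)"
      by linarith
  qed
  thus ?thesis unfolding split by (rule sum_mono)
qed

text \<open>The reciprocal of the lower bound for \<open>G n * jones l S n\<close> at
  \<open>l n\<close>: \<open>exp (K / (2 * d\<^sup>2))\<close> for the Blaschke factors that are not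
  near, and \<open>exp (2 * K)\<close> for each of the two Jones functions, one of them hidden in
  \<open>G n\<close>.\<close>

definition C where "C = exp (K / (2 * d\<^sup>2) + 4 * K)"

text \<open>An interpolating sum over one colour. The second Jones function belongs to the
  coefficient of \<open>G n\<close>: it gives the coefficients a bounded sum of moduli, which
  \<open>square_function_dual\<close> requires.\<close>

definition g :: "nat \<Rightarrow> complex \<Rightarrow> complex" where
  "g j z = (\<Sum>n\<in>{n\<in>S. col n = j}. jones l S n z / (G n (l n) * jones l S n (l n)) * G n z)"

lemma C_pos: "C > 0" by (simp add: C_def)

lemma G_jones_lower:
  assumes n: "n \<in> S"
  shows "1 / C \<le> cmod (G n (l n) * jones l S n (l n))"
proof -
  have ln: "cmod (l n) < 1" by (rule l_less_1[OF n])
  have le1: "cmod (blaschke_factor (l i) (l n)) \<le> 1" if "i \<in> S" for i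
    using l_less_1[OF that] ln by (intro cmod_blaschke_factor_le_1) auto
  have j: "exp (- 2 * K) \<le> cmod (jones l S n (l n))"
    by (rule jones_lower_bound) (auto intro: finite_S l_less_1 n sum_le_K)
  have "exp (- K / (2 * d\<^sup>2)) \<le> cmod (finite_blaschke l (S - near n) (l n))"
  proof (rule finite_blaschke_lower_bound[OF _ d(1)])
    have "(\<Sum>i\<in>S - near n. 1 - (cmod (blaschke_factor (l i) (l n)))\<^sup>2) \<le> (\<Sum>i\<in>S. 1 - (cmod (blaschke_factor (l i) (l n)))\<^sup>2)"
      using le1 by (intro sum_mono2 finite_S) (auto simp: power_le_one)
    thus "(\<Sum>i\<in>S - near n. 1 - (cmod (blaschke_factor (l i) (l n)))\<^sup>2) \<le> K"
      using sum_le_K[OF ln] by simp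
  qed (use le1 finite_S in \<open>auto simp: near_def not_less\<close>)
  hence "exp (- K / (2 * d\<^sup>2)) * exp (- 2 * K) * exp (- 2 * K) \<le>
      cmod (finite_blaschke l (S - near n) (l n)) * cmod (jones l S n (l n)) * cmod (jones l S n (l n))"
    using j by (intro mult_mono) auto
  moreover have "exp (- K / (2 * d\<^sup>2)) * exp (- 2 * K) * exp (- 2 * K) = 1 / C"
  proof -
    have "exp (- K / (2 * d\<^sup>2)) * exp (- 2 * K) * exp (- 2 * K) = exp (- K / (2 * d\<^sup>2) + - 2 * K + - 2 * K)"
      by (simp only: exp_add)
    also have "\<dots> = exp (- (K / (2 * d\<^sup>2) + 4 * K))" by (rule arg_cong[of _ _ exp]) simp
    also have "\<dots> = 1 / C" unfolding C_def exp_minus by (rule inverse_eq_divide)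
    finally show ?thesis .
  qed
  ultimately show ?thesis by (simp add: G_def norm_mult)
qed

lemma G_jones_nonzero:
  assumes "n \<in> S"
  shows "G n (l n) * jones l S n (l n) \<noteq> 0"
proof
  assume "G n (l n) * jones l S n (l n) = 0"
  hence "1 / C \<le> 0" using G_jones_lower[OF assms] by (simp only: norm_zero)
  thus False using C_pos by simp
qed

lemma g_coeff_le:
  assumes "n \<in> S"
  shows "cmod (jones l S n z / (G n (l n) * jones l S n (l n))) \<le> C * cmod (jones l S n z)"
proof -
  have "cmod (jones l S n z) / cmod (G n (l n) * jones l S n (l n)) \<le> cmod (jones l S n z) / (1 / C)"
    using G_jones_lower[OF assms] C_pos
    by (intro divide_left_mono mult_pos_pos) (auto intro: less_le_trans[of 0 "1 / C"])
  thus ?thesis by (simp add: norm_divide mult.commute)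
qed

lemma g_coeff_analytic:
  "n \<in> S \<Longrightarrow> (\<lambda>z. jones l S n z / (G n (l n) * jones l S n (l n))) analytic_on cball 0 1"
  by (intro analytic_intros jones_analytic' G_jones_nonzero)

lemma g_analytic: "g j analytic_on cball 0 1"
  unfolding g_def[abs_def] by (intro analytic_on_sum analytic_on_mult g_coeff_analytic G_analytic) auto

lemma sum_coeff_le:
  assumes "cmod z \<le> 1"
  shows "(\<Sum>n\<in>{n\<in>S. col n = j}. cmod (jones l S n z / (G n (l n) * jones l S n (l n)))) \<le> C"
proof -
  have "(\<Sum>n\<in>{n\<in>S. col n = j}. cmod (jones l S n z / (G n (l n) * jones l S n (l n)))) \<le>
      (\<Sum>n\<in>{n\<in>S. col n = j}. C * cmod (jones l S n z))" by (intro sum_mono g_coeff_le) auto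
  also have "\<dots> \<le> (\<Sum>n\<in>S. C * cmod (jones l S n z))"
    using C_pos by (intro sum_mono2 finite_S) auto
  also have "\<dots> \<le> C * 1"
    unfolding sum_distrib_left[symmetric] using C_pos sum_jones_le'[OF assms] by (intro mult_left_mono) auto
  finally show ?thesis by simp
qed

lemma cmod_g_le:
  assumes z: "cmod z \<le> 1"
  shows "cmod (g j z) \<le> C"
proof -
  have "cmod (g j z) \<le> (\<Sum>n\<in>{n\<in>S. col n = j}. cmod (jones l S n z / (G n (l n) * jones l S n (l n)) * G n z))"
    unfolding g_def by (rule norm_sum)
  also have "\<dots> \<le> (\<Sum>n\<in>{n\<in>S. col n = j}. cmod (jones l S n z / (G n (l n) * jones l S n (l n))))"
  proof (rule sum_mono)
    fix n assume "n \<in> {n\<in>S. col n = j}"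
    hence n: "n \<in> S" by simp
    have "cmod (jones l S n z) \<le> (\<Sum>n\<in>S. cmod (jones l S n z))"
      using n by (intro member_le_sum finite_S) auto
    hence "cmod (G n z) \<le> 1" using cmod_G_le[OF z, of n] sum_jones_le'[OF z] by linarith
    thus "cmod (jones l S n z / (G n (l n) * jones l S n (l n)) * G n z) \<le>
        cmod (jones l S n z / (G n (l n) * jones l S n (l n)))"
      unfolding norm_mult by (intro mult_left_le) auto
  qed
  also have "\<dots> \<le> C" by (rule sum_coeff_le[OF z])
  finally show ?thesis .
qed

text \<open>Another zero of the same colour is not near, so its function \<open>G n\<close> vanishes
  at \<open>l m\<close>; only the summand of \<open>m\<close> survives, normalised to 1.\<close>

lemma g_eq_1:
  assumes m: "m \<in> S"
  shows "g (col m) (l m) = 1"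
proof -
  note nz = G_jones_nonzero[OF m]
  have 0: "G n (l m) = 0" if n: "n \<in> S" "col n = col m" "n \<noteq> m" for n
  proof -
    have "m \<in> S - near n" using separated[OF m n(1)] n m by (auto simp: near_def)
    hence "finite_blaschke l (S - near n) (l m) = 0"
      unfolding finite_blaschke_def using finite_S by (subst prod_zero_iff) (auto simp: blaschke_factor_self intro!: bexI[of _ m])
    thus ?thesis by (simp add: G_def)
  qed
  have "g (col m) (l m) = (\<Sum>n\<in>{n\<in>S. col n = col m}. if n = m then 1 else 0)"
    unfolding g_def using 0 nz by (intro sum.cong refl) auto
  also have "\<dots> = 1" using m finite_S by (subst sum.delta) auto
  finally show ?thesis .
qed

text \<open>The terms of power 0 in \<open>form\<close> are the squared norms of the vectors
  \<open>calc (G n) x\<close>, to which the dual estimate is applied with the coefficients of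
  \<open>g j\<close>.\<close>

lemma norm_calc_g_le: "norm (calc (g j) x) \<le> M * C * sqrt (form x)"
proof -
  have "calc (g j) x = (\<Sum>n\<in>{n\<in>S. col n = j}. calc (\<lambda>z. jones l S n z / (G n (l n) * jones l S n (l n))) (calc (G n) x))"
  proof -
    have "calc (g j) x = (\<Sum>n\<in>{n\<in>S. col n = j}. calc (\<lambda>z. jones l S n z / (G n (l n) * jones l S n (l n)) * G n z) x)"
      unfolding g_def[abs_def] by (intro calc_sum analytic_on_mult g_coeff_analytic G_analytic) auto
    also have "\<dots> = (\<Sum>n\<in>{n\<in>S. col n = j}. calc (\<lambda>z. jones l S n z / (G n (l n) * jones l S n (l n))) (calc (G n) x))"
      by (intro sum.cong refl calc_mult g_coeff_analytic G_analytic) auto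
    finally show ?thesis .
  qed
  also have "norm \<dots> \<le> M * C * sqrt (\<Sum>n\<in>{n\<in>S. col n = j}. (norm (calc (G n) x))\<^sup>2)"
    by (rule square_function_dual) (auto simp: finite_S intro: g_coeff_analytic sum_coeff_le)
  also have "\<dots> \<le> M * C * sqrt (form x)"
  proof (intro mult_left_mono real_sqrt_le_mono)
    have "(\<Sum>n\<in>{n\<in>S. col n = j}. (norm (calc (G n) x))\<^sup>2) \<le> (\<Sum>n\<in>S. (norm (form_ops (n, 0) x))\<^sup>2)"
      using finite_S by (simp add: form_ops_def) (intro sum_mono2, auto)
    also have "\<dots> = (\<Sum>p\<in>(\<lambda>n. (n, 0)) ` S. (norm (form_ops p x))\<^sup>2)"
      by (subst sum.reindex) (auto simp: inj_on_def)
    also have "\<dots> \<le> form x" unfolding form_def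
    proof (rule sum_mono2)
      show "finite form_index" by (simp add: form_index_def finite_S)
      show "(\<lambda>n. (n, 0)) ` S \<subseteq> form_index"
      proof (rule image_subsetI)
        fix n assume n: "n \<in> S"
        hence "near n \<noteq> {}" using near_self by blast
        thus "(n, 0) \<in> form_index" using n finite_near by (simp add: form_index_def card_gt_0_iff)
      qed
    qed auto
    finally show "(\<Sum>n\<in>{n\<in>S. col n = j}. (norm (calc (G n) x))\<^sup>2) \<le> form x" .
  qed (use M_pos C_pos in auto)
  finally show ?thesis .
qed

text \<open>Each \<open>1 - g j\<close> vanishes at the zeros of colour \<open>j\<close>, which are
  distinct; as every colour is below \<open>N\<close>, the product over \<open>j\<close> contains
  all factors, with coinciding zeros of different colours counted separately.\<close>

lemma prod_one_minus_g_factor: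
  "\<exists>q. q analytic_on cball 0 1 \<and> (\<forall>z. cmod z \<le> 1 \<longrightarrow> (\<Prod>j<N. 1 - g j z) = q z * finite_blaschke l S z)"
proof -
  have "\<exists>q. q analytic_on cball 0 1 \<and> (\<forall>z. cmod z \<le> 1 \<longrightarrow> 1 - g j z = finite_blaschke l {n\<in>S. col n = j} z * q z)" for j
  proof (rule analytic_factor_zeros)
    show "inj_on l {n\<in>S. col n = j}"
    proof (rule inj_onI, rule ccontr)
      fix k n assume kn: "k \<in> {n\<in>S. col n = j}" "n \<in> {n\<in>S. col n = j}" "l k = l n" "k \<noteq> n"
      hence "d \<le> cmod (blaschke_factor (l k) (l n))" by (intro separated) auto
      thus False using kn(3) d(1) by (simp add: blaschke_factor_self)
    qed
    show "(\<lambda>z. 1 - g j z) analytic_on cball 0 1" by (intro analytic_intros g_analytic)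
  qed (use finite_S l_less_1 g_eq_1 in auto)
  then obtain q where q: "\<And>j. q j analytic_on cball 0 1"
    "\<And>j z. cmod z \<le> 1 \<Longrightarrow> 1 - g j z = finite_blaschke l {n\<in>S. col n = j} z * q j z" by metis
  have "(\<Prod>j<N. finite_blaschke l {n\<in>S. col n = j} z) = finite_blaschke l S z" for z
    unfolding finite_blaschke_def using col_less by (intro prod.group finite_S) auto
  hence "(\<Prod>j<N. 1 - g j z) = (\<Prod>j<N. q j z) * finite_blaschke l S z" if "cmod z \<le> 1" for z
    using that by (simp add: q(2) prod.distrib mult.commute)
  moreover have "(\<lambda>z. \<Prod>j<N. q j z) analytic_on cball 0 1" by (intro analytic_intros q)
  ultimately show ?thesis by blast
qed

text \<open>The telescoping identity \<open>1 = (\<Sum>k<N. h k z * g k z) + h N z\<close>: the last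
  term annihilates \<open>x\<close>, and the others are bounded by
  \<open>norm_calc_g_le\<close>.\<close>

lemma form_lower:
  assumes x: "x \<in> null_space"
  shows "norm x \<le> real N * (M * (1 + C) ^ N * (M * C)) * sqrt (form x)"
proof -
  define h where "h k z = (\<Prod>j<k. 1 - g j z)" for k z
  have h: "h k analytic_on cball 0 1" for k
    unfolding h_def[abs_def] by (intro analytic_intros g_analytic)
  have h_le: "cmod (h k z) \<le> (1 + C) ^ k" if "cmod z \<le> 1" for k z
  proof -
    have "cmod (h k z) = (\<Prod>j<k. cmod (1 - g j z))" by (simp add: h_def prod_norm)
    also have "\<dots> \<le> (\<Prod>j<k. 1 + C)"
    proof (intro prod_mono conjI)
      show "cmod (1 - g j z) \<le> 1 + C" for j
        using norm_triangle_ineq4[of 1 "g j z"] cmod_g_le[OF that, of j] by simp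
    qed auto
    finally show ?thesis by simp
  qed
  have step: "norm (calc (h k) x) \<le> norm (calc (h (Suc k)) x) + M * (1 + C) ^ N * (M * C) * sqrt (form x)" if "k < N" for k
  proof -
    have "h (Suc k) = (\<lambda>z. h k z - h k z * g k z)"
      by (rule ext) (simp add: h_def algebra_simps)
    hence "calc (h (Suc k)) x = calc (\<lambda>z. h k z - h k z * g k z) x" by (rule arg_cong)
    also have "\<dots> = calc (h k) x - calc (h k) (calc (g k) x)"
      by (subst calc_diff, intro h, intro analytic_intros h g_analytic) (simp add: calc_mult h g_analytic)
    finally have "calc (h k) x = calc (h (Suc k)) x + calc (h k) (calc (g k) x)" by simp
    hence "norm (calc (h k) x) \<le> norm (calc (h (Suc k)) x) + norm (calc (h k) (calc (g k) x))"
      by (metis norm_triangle_ineq)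
    also have "norm (calc (h k) (calc (g k) x)) \<le> M * (1 + C) ^ k * norm (calc (g k) x)"
      by (rule calc_bound[OF h h_le])
    also have "\<dots> \<le> M * (1 + C) ^ N * (M * C * sqrt (form x))"
      using norm_calc_g_le[of k x] M_pos C_pos that
      by (intro mult_mono power_increasing) auto
    finally show ?thesis by (simp add: mult_ac)
  qed
  have "norm (calc (h 0) x) \<le> norm (calc (h k) x) + real k * (M * (1 + C) ^ N * (M * C) * sqrt (form x))" if "k \<le> N" for k
    using that
  proof (induction k)
    case (Suc k)
    thus ?case using step[of k] by (simp add: algebra_simps)
  qed simp
  from this[of N] have "norm (calc (h 0) x) \<le> norm (calc (h N) x) + real N * (M * (1 + C) ^ N * (M * C) * sqrt (form x))"
    by simp
  moreover have "calc (h N) x = 0"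
  proof -
    obtain q where "q analytic_on cball 0 1" "\<And>z. cmod z \<le> 1 \<Longrightarrow> (\<Prod>j<N. 1 - g j z) = q z * finite_blaschke l S z"
      using prod_one_minus_g_factor by blast
    thus ?thesis by (intro calc_eq_0_on_null_space[OF x h]) (auto simp: h_def)
  qed
  moreover have "calc (h 0) x = x"
  proof -
    have "h 0 = (\<lambda>_. 1)" by (simp add: h_def fun_eq_iff)
    thus ?thesis by (simp add: calc_const)
  qed
  ultimately show ?thesis by (simp add: mult_ac)
qed

end

text \<open>Collects the bounds with constants that depend on \<open>N\<close>, \<open>M\<close>,
  \<open>K\<close> and \<open>d\<close> only, not on the finite set \<open>S\<close>.\<close>

lemma (in carleson_form) form_summary:
  defines "Q \<equiv> real N * (M * (1 + exp (K / (2 * d\<^sup>2) + 4 * K)) ^ N * (M * exp (K / (2 * d\<^sup>2) + 4 * K)))"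
  shows "\<exists>P (A :: 'i \<times> nat \<Rightarrow> 'a \<Rightarrow> 'a). finite P \<and> (\<forall>p\<in>P. bounded_clinear (A p)) \<and>
    (\<forall>x. (\<Sum>p\<in>P. (norm (A p x))\<^sup>2) \<le> real (nat \<lceil>2 * K\<rceil>) * M\<^sup>2 * (norm x)\<^sup>2) \<and>
    (\<forall>x. calc (finite_blaschke l S) x = 0 \<longrightarrow> 1 / (1 + Q\<^sup>2) * (norm x)\<^sup>2 \<le> (\<Sum>p\<in>P. (norm (A p x))\<^sup>2)) \<and>
    (\<forall>x. calc (finite_blaschke l S) x = 0 \<longrightarrow>
       (\<Sum>p\<in>P. (norm (A p (T x)))\<^sup>2) \<le> (\<Sum>p\<in>P. (norm (A p x))\<^sup>2))"
proof (rule exI[of _ form_index], rule exI[of _ form_ops], intro conjI ballI allI impI)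
  show "finite form_index" by (simp add: form_index_def finite_S)
  show "bounded_clinear (form_ops p)" if "p \<in> form_index" for p by (rule form_ops_clinear[OF that])
  show "(\<Sum>p\<in>form_index. (norm (form_ops p x))\<^sup>2) \<le> real (nat \<lceil>2 * K\<rceil>) * M\<^sup>2 * (norm x)\<^sup>2" for x
    using form_upper[of x] by (simp add: form_def power_mult_distrib mult.assoc)
  fix x assume "calc (finite_blaschke l S) x = 0"
  hence x: "x \<in> null_space" by (simp add: null_space_def)
  show "(\<Sum>p\<in>form_index. (norm (form_ops p (T x)))\<^sup>2) \<le> (\<Sum>p\<in>form_index. (norm (form_ops p x))\<^sup>2)"
    using form_contraction[OF x] by (simp add: form_def)
  have f0: "0 \<le> form x" by (simp add: form_def sum_nonneg)
  have "norm x \<le> Q * sqrt (form x)" using form_lower[OF x] by (simp add: Q_def C_def)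
  hence "(norm x)\<^sup>2 \<le> (Q * sqrt (form x))\<^sup>2" by (intro power_mono) auto
  also have "\<dots> = Q\<^sup>2 * form x" using f0 by (simp add: power_mult_distrib)
  \<comment> \<open>Adding 1 keeps the constant positive when \<open>Q = 0\<close>.\<close>
  also have "\<dots> \<le> (1 + Q\<^sup>2) * form x" using f0 by (intro mult_right_mono) auto
  finally have "(norm x)\<^sup>2 \<le> (1 + Q\<^sup>2) * form x" .
  moreover have "0 < 1 + Q\<^sup>2" by (simp add: add_pos_nonneg)
  ultimately have "(norm x)\<^sup>2 / (1 + Q\<^sup>2) \<le> form x" by (simp only: pos_divide_le_eq mult.commute)
  thus "1 / (1 + Q\<^sup>2) * (norm x)\<^sup>2 \<le> (\<Sum>p\<in>form_index. (norm (form_ops p x))\<^sup>2)"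
    by (simp add: form_def)
qed

subsection \<open>Limits of quadratic forms\<close>

text \<open>By Tychonoff's theorem the forms lie in a compact product of intervals. A cluster point
  of the filter takes the place of a convergent subsequence, which a possibly uncountable product
  need not provide; closed conditions that hold eventually pass to it.\<close>

lemma bounded_forms_cluster_point:
  fixes s :: "nat \<Rightarrow> 'b \<Rightarrow> real"
  assumes "\<And>n p. \<bar>s n p\<bar> \<le> B p"
  obtains s0 where "\<And>\<Phi>. closed {t. \<Phi> t} \<Longrightarrow> eventually (\<lambda>n. \<Phi> (s n)) sequentially \<Longrightarrow> \<Phi> s0"
proof -
  let ?U = "PiE UNIV (\<lambda>p. {- B p..B p})"
  have "compactin (product_topology (\<lambda>_. euclidean) UNIV) ?U"
    unfolding compactin_PiE by (auto simp: compactin_euclidean_iff)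
  hence "compact ?U" by (simp add: euclidean_product_topology compactin_euclidean_iff)
  moreover have "eventually (\<lambda>t. t \<in> ?U) (filtermap s sequentially)"
    using assms by (auto simp: eventually_filtermap abs_le_iff minus_le_iff intro!: always_eventually)
  moreover have "filtermap s sequentially \<noteq> bot" by (simp add: filtermap_bot_iff)
  ultimately obtain s0 where s0: "inf (nhds s0) (filtermap s sequentially) \<noteq> bot"
    unfolding compact_filter by blast
  show ?thesis
  proof (rule that[of s0])
    fix \<Phi> assume cl: "closed {t. \<Phi> t}" and ev: "eventually (\<lambda>n. \<Phi> (s n)) sequentially"
    show "\<Phi> s0"
    proof (rule ccontr)
      assume "\<not> \<Phi> s0"
      hence "eventually (\<lambda>t. t \<in> - {t. \<Phi> t}) (nhds s0)"
        using cl by (intro eventually_nhds_in_open) auto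
      hence "eventually (\<lambda>t. \<not> \<Phi> t) (inf (nhds s0) (filtermap s sequentially))"
        by (intro filter_leD[OF inf_le1]) auto
      moreover have "eventually \<Phi> (inf (nhds s0) (filtermap s sequentially))"
        by (intro filter_leD[OF inf_le2]) (simp add: eventually_filtermap ev)
      ultimately have "eventually (\<lambda>_. False) (inf (nhds s0) (filtermap s sequentially))"
        by eventually_elim simp
      thus False using s0 by (simp add: trivial_limit_def)
    qed
  qed
qed

text \<open>The algebraic identities and the upper bound hold for every form, the lower bound and
  contractivity at a vector of \<open>V m\<close> for all \<open>n \<ge> m\<close>; all of them pass
  to the cluster point. Continuity of the limit form then extends the last two from the dense union
  to the whole space.\<close>

lemma similar_to_contraction_limit_forms:
  fixes T :: "'a::complex_hilbert_space \<Rightarrow> 'a" and A :: "nat \<Rightarrow> 'p \<Rightarrow> 'a \<Rightarrow> 'a"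
  assumes T: "bounded_clinear T" and P: "\<And>n. finite (P n)"
    and A: "\<And>n p. p \<in> P n \<Longrightarrow> bounded_clinear (A n p)"
    and V: "incseq V" "closure (\<Union>n. V n) = UNIV"
    and upper: "\<And>n x. (\<Sum>p\<in>P n. (norm (A n p x))\<^sup>2) \<le> C * (norm x)\<^sup>2"
    and lower: "\<And>n x. x \<in> V n \<Longrightarrow> c * (norm x)\<^sup>2 \<le> (\<Sum>p\<in>P n. (norm (A n p x))\<^sup>2)"
    and contr: "\<And>n x. x \<in> V n \<Longrightarrow> (\<Sum>p\<in>P n. (norm (A n p (T x)))\<^sup>2) \<le> (\<Sum>p\<in>P n. (norm (A n p x))\<^sup>2)"
    and c: "c > 0"
  shows "similar_to_contraction T"
proof -
  define s where "s n xy = (\<Sum>p\<in>P n. inner (A n p (fst xy)) (A n p (snd xy)))" for n xy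
  have diag: "s n (x, x) = (\<Sum>p\<in>P n. (norm (A n p x))\<^sup>2)" for n x
    by (simp add: s_def power2_norm_eq_inner)
  have C0: "0 \<le> C * (norm x)\<^sup>2" for x :: 'a
    by (rule order_trans[OF _ upper[of 0 x]]) (simp add: sum_nonneg)
  have L2: "L2_set (\<lambda>p. norm (A n p x)) (P n) \<le> sqrt C * norm x" for n x
    unfolding L2_set_def using real_sqrt_le_mono[OF upper[of n x]] by (simp add: real_sqrt_mult)
  have bound: "\<bar>s n xy\<bar> \<le> C * (norm (fst xy) * norm (snd xy))" for n xy
  proof -
    have "\<bar>s n xy\<bar> \<le> (\<Sum>p\<in>P n. \<bar>inner (A n p (fst xy)) (A n p (snd xy))\<bar>)"
      unfolding s_def by (rule sum_abs)
    also have "\<dots> \<le> (\<Sum>p\<in>P n. \<bar>norm (A n p (fst xy))\<bar> * \<bar>norm (A n p (snd xy))\<bar>)"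
      by (intro sum_mono) (simp add: Cauchy_Schwarz_ineq2)
    also have "\<dots> \<le> L2_set (\<lambda>p. norm (A n p (fst xy))) (P n) * L2_set (\<lambda>p. norm (A n p (snd xy))) (P n)"
      by (rule L2_set_mult_ineq)
    also have "\<dots> \<le> (sqrt C * norm (fst xy)) * (sqrt C * norm (snd xy))"
      by (rule mult_mono[OF L2 L2 order_trans[OF L2_set_nonneg L2] L2_set_nonneg])
    also have "\<dots> = sqrt C * sqrt C * (norm (fst xy) * norm (snd xy))" by (simp add: mult_ac)
    \<comment> \<open>\<open>C\<close> is known to be nonnegative only if there is a nonzero
      vector.\<close>
    also have "\<dots> = C * (norm (fst xy) * norm (snd xy))"
    proof (cases "\<exists>x::'a. x \<noteq> 0")
      case True
      then obtain x :: 'a where "x \<noteq> 0" by blast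
      hence "0 \<le> C" using C0[of x] by (simp add: zero_le_mult_iff)
      thus ?thesis by simp
    next
      case False
      hence "fst xy = 0" by blast
      thus ?thesis by simp
    qed
    finally show ?thesis .
  qed
  obtain t where t: "\<And>\<Phi>. closed {u. \<Phi> u} \<Longrightarrow> eventually (\<lambda>n. \<Phi> (s n)) sequentially \<Longrightarrow> \<Phi> t"
    using bounded_forms_cluster_point[of s, OF bound] by blast
  note coord = continuous_on_product_coordinates
  have t_add: "t (x + y, z) = t (x, z) + t (y, z)" for x y z
  proof (rule t[of "\<lambda>u. u (x + y, z) = u (x, z) + u (y, z)"])
    show "closed {u::'a \<times> 'a \<Rightarrow> real. u (x + y, z) = u (x, z) + u (y, z)}"
      by (intro closed_Collect_eq continuous_intros coord)
  qed (simp add: s_def bounded_clinear_simps(1)[OF A] inner_add_left sum.distrib)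
  have t_scale: "t (r *\<^sub>R x, z) = r * t (x, z)" for r x z
  proof (rule t[of "\<lambda>u. u (r *\<^sub>R x, z) = r * u (x, z)"])
    show "closed {u::'a \<times> 'a \<Rightarrow> real. u (r *\<^sub>R x, z) = r * u (x, z)}"
      by (intro closed_Collect_eq continuous_intros coord)
    have "A n p (r *\<^sub>R x) = r *\<^sub>R A n p x" if "p \<in> P n" for n p
      using bounded_clinear_scaleC[OF A[OF that], of "of_real r" x] by (simp add: scaleC_of_real)
    thus "eventually (\<lambda>n. s n (r *\<^sub>R x, z) = r * s n (x, z)) sequentially"
      by (simp add: s_def sum_distrib_left)
  qed
  have t_sym: "t (x, y) = t (y, x)" for x y
  proof (rule t[of "\<lambda>u. u (x, y) = u (y, x)"])
    show "closed {u::'a \<times> 'a \<Rightarrow> real. u (x, y) = u (y, x)}"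
      by (intro closed_Collect_eq coord)
  qed (simp add: s_def inner_commute)
  have t_rot: "t (\<i> *\<^sub>C x, \<i> *\<^sub>C y) = t (x, y)" for x y
  proof (rule t[of "\<lambda>u. u (\<i> *\<^sub>C x, \<i> *\<^sub>C y) = u (x, y)"])
    show "closed {u::'a \<times> 'a \<Rightarrow> real. u (\<i> *\<^sub>C x, \<i> *\<^sub>C y) = u (x, y)}"
      by (intro closed_Collect_eq coord)
  qed (simp add: s_def bounded_clinear_scaleC[OF A] inner_scaleC_scaleC)
  have t_bound: "\<bar>t (x, y)\<bar> \<le> C * (norm x * norm y)" for x y
  proof (rule t[of "\<lambda>u. \<bar>u (x, y)\<bar> \<le> C * (norm x * norm y)"])
    show "closed {u::'a \<times> 'a \<Rightarrow> real. \<bar>u (x, y)\<bar> \<le> C * (norm x * norm y)}"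
      by (intro closed_Collect_le continuous_intros coord)
  qed (use bound[of _ "(x, y)"] in simp)
  have t_diag_cont: "continuous_on UNIV (\<lambda>x. t (x, x))"
  proof -
    have "bounded_bilinear (\<lambda>x y. t (x, y))"
    proof
      show "t (a + a', b) = t (a, b) + t (a', b)" for a a' b by (rule t_add)
      show "t (a, b + b') = t (a, b) + t (a, b')" for a b b' by (simp add: t_sym[of a] t_add)
      show "t (r *\<^sub>R a, b) = r *\<^sub>R t (a, b)" for r a b by (simp add: t_scale)
      show "t (a, r *\<^sub>R b) = r *\<^sub>R t (a, b)" for r a b by (simp add: t_sym[of a] t_scale)
      show "\<exists>K. \<forall>a b. norm (t (a, b)) \<le> norm a * norm b * K"
        using t_bound by (intro exI[of _ C]) (simp add: mult_ac)
    qed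
    thus ?thesis by (rule bounded_bilinear.continuous_on[OF _ continuous_on_id continuous_on_id])
  qed
  have dense: "\<Phi> x" if cl: "closed {x. \<Phi> x}" and ev: "\<And>n x. x \<in> V n \<Longrightarrow> \<Phi> x" for \<Phi> and x :: 'a
  proof -
    have "closure (\<Union>n. V n) \<subseteq> {x. \<Phi> x}" using ev by (intro closure_minimal cl) auto
    thus ?thesis using V(2) by auto
  qed
  have ev: "eventually (\<lambda>n. x \<in> V n) sequentially" if "x \<in> V m" for x m
    using that V(1) unfolding eventually_sequentially incseq_def by blast
  have t_lower: "c * (norm x)\<^sup>2 \<le> t (x, x)" for x
  proof (rule dense[of "\<lambda>x. c * (norm x)\<^sup>2 \<le> t (x, x)"])
    show "closed {x. c * (norm x)\<^sup>2 \<le> t (x, x)}"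
      by (intro closed_Collect_le continuous_intros t_diag_cont)
    fix m x assume x: "x \<in> V m"
    show "c * (norm x)\<^sup>2 \<le> t (x, x)"
    proof (rule t[of "\<lambda>u. c * (norm x)\<^sup>2 \<le> u (x, x)"])
      show "closed {u::'a \<times> 'a \<Rightarrow> real. c * (norm x)\<^sup>2 \<le> u (x, x)}"
        by (intro closed_Collect_le continuous_intros coord)
      show "eventually (\<lambda>n. c * (norm x)\<^sup>2 \<le> s n (x, x)) sequentially"
        using ev[OF x] by eventually_elim (simp add: diag lower)
    qed
  qed
  have T_cont: "continuous_on UNIV T"
    using linear_continuous_on[OF bounded_clinear_linear[OF T]] .
  have t_contr: "t (T x, T x) \<le> t (x, x)" for x
  proof (rule dense[of "\<lambda>x. t (T x, T x) \<le> t (x, x)"])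
    show "closed {x. t (T x, T x) \<le> t (x, x)}"
      by (intro closed_Collect_le t_diag_cont continuous_on_compose2[OF t_diag_cont T_cont]) auto
    fix m x assume x: "x \<in> V m"
    show "t (T x, T x) \<le> t (x, x)"
    proof (rule t[of "\<lambda>u. u (T x, T x) \<le> u (x, x)"])
      show "closed {u::'a \<times> 'a \<Rightarrow> real. u (T x, T x) \<le> u (x, x)}"
        by (intro closed_Collect_le coord)
      show "eventually (\<lambda>n. s n (T x, T x) \<le> s n (x, x)) sequentially"
        using ev[OF x] by eventually_elim (simp add: diag contr)
    qed
  qed
  show ?thesis
    by (rule similar_to_contraction_if_equivalent_form[of T "\<lambda>x y. t (x, y)" c C])
      (fact T t_add t_scale t_sym t_rot t_lower t_bound t_contr c)+
qed

subsection \<open>Blaschke products of absolutely continuous operators\<close>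

lemma subspace_closure:
  fixes W :: "'a::real_normed_vector set"
  assumes "subspace W"
  shows "subspace (closure W)"
  unfolding subspace_def
proof (intro conjI ballI allI)
  show "0 \<in> closure W" using subspace_0[OF assms] closure_subset by blast
  fix x assume "x \<in> closure W"
  then obtain u where u: "\<And>n. u n \<in> W" "u \<longlonglongrightarrow> x" by (auto simp: closure_sequential)
  show "c *\<^sub>R x \<in> closure W" for c
    unfolding closure_sequential using u
    by (intro exI[of _ "\<lambda>n. c *\<^sub>R u n"]) (auto intro: subspace_scale[OF assms] tendsto_intros)
  fix y assume "y \<in> closure W"
  then obtain v where v: "\<And>n. v n \<in> W" "v \<longlonglongrightarrow> y" by (auto simp: closure_sequential)
  show "x + y \<in> closure W"
    unfolding closure_sequential using u v
    by (intro exI[of _ "\<lambda>n. u n + v n"]) (auto intro: subspace_add[OF assms] tendsto_intros)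
qed

section \<open>Integral representations on the circle\<close>

lemma integrable_circle_mult:
  fixes g h :: "complex \<Rightarrow> complex"
  assumes "integrable circle_measure h" "g \<in> borel_measurable circle_measure"
    and "\<And>\<zeta>. cmod \<zeta> = 1 \<Longrightarrow> cmod (g \<zeta>) \<le> K"
  shows "integrable circle_measure (\<lambda>\<zeta>. g \<zeta> * h \<zeta>)"
proof (rule Bochner_Integration.integrable_bound)
  show "integrable circle_measure (\<lambda>\<zeta>. of_real K * h \<zeta>)" using assms(1) by simp
  show "(\<lambda>\<zeta>. g \<zeta> * h \<zeta>) \<in> borel_measurable circle_measure"
    by (intro borel_measurable_times assms(2) borel_measurable_integrable assms(1))
  show "AE \<zeta> in circle_measure. cmod (g \<zeta> * h \<zeta>) \<le> cmod (of_real K * h \<zeta>)"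
  proof (rule AE_I2)
    fix \<zeta> assume "\<zeta> \<in> space circle_measure"
    hence "cmod (g \<zeta>) \<le> \<bar>K\<bar>" using assms(3)[of \<zeta>] by simp
    thus "cmod (g \<zeta> * h \<zeta>) \<le> cmod (of_real K * h \<zeta>)" by (simp add: norm_mult mult_right_mono)
  qed
qed

lemma integral_circle_bounded_convergence:
  fixes g :: "complex \<Rightarrow> complex" and h :: "complex \<Rightarrow> complex"
  assumes h: "integrable circle_measure h"
    and f: "\<And>n. f n \<in> borel_measurable circle_measure" "\<And>n \<zeta>. cmod \<zeta> = 1 \<Longrightarrow> cmod (f n \<zeta>) \<le> 1"
    and g: "g \<in> borel_measurable circle_measure"
    and lim: "AE \<zeta> in circle_measure. (\<lambda>n. f n \<zeta>) \<longlonglongrightarrow> g \<zeta>"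
  shows "(\<lambda>n. LINT \<zeta>|circle_measure. f n \<zeta> * h \<zeta>) \<longlonglongrightarrow> (LINT \<zeta>|circle_measure. g \<zeta> * h \<zeta>)"
proof (rule integral_dominated_convergence[where w = "\<lambda>\<zeta>. cmod (h \<zeta>)"])
  show "(\<lambda>\<zeta>. g \<zeta> * h \<zeta>) \<in> borel_measurable circle_measure"
    by (intro borel_measurable_times g borel_measurable_integrable h)
  show "(\<lambda>\<zeta>. f n \<zeta> * h \<zeta>) \<in> borel_measurable circle_measure" for n
    by (intro borel_measurable_times f borel_measurable_integrable h)
  show "integrable circle_measure (\<lambda>\<zeta>. cmod (h \<zeta>))" using h by simp
  show "AE \<zeta> in circle_measure. (\<lambda>n. f n \<zeta> * h \<zeta>) \<longlonglongrightarrow> g \<zeta> * h \<zeta>"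
    using lim by eventually_elim (intro tendsto_intros)
  show "AE \<zeta> in circle_measure. cmod (f n \<zeta> * h \<zeta>) \<le> cmod (h \<zeta>)" for n
    by (rule AE_I2) (simp add: norm_mult mult_left_le_one_le f)
qed

text \<open>Polynomials approximating \<open>f\<close> uniformly pass to the limit on both sides,
  \<open>h\<close> being integrable.\<close>

lemma (in poly_bounded) represents_calc:
  assumes h: "represents h T x y" and f: "f analytic_on cball 0 1"
  shows "cinner (calc f x) y = (LINT \<zeta>|circle_measure. f \<zeta> * h \<zeta>)"
proof -
  obtain p where p: "poly_approx p f" using poly_approx_exists[OF f] ..
  have hi: "integrable circle_measure h" using h by (simp add: represents_def)
  have int: "integrable circle_measure (\<lambda>\<zeta>. g \<zeta> * h \<zeta>)" if g: "g analytic_on cball 0 1" for g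
  proof -
    have cont: "continuous_on (sphere 0 1) g"
      by (rule continuous_on_subset[OF holomorphic_on_imp_continuous_on[OF analytic_imp_holomorphic[OF g]]]) auto
    have "compact (g ` sphere 0 1)" using cont by (intro compact_continuous_image) auto
    then obtain K where "\<And>\<zeta>. cmod \<zeta> = 1 \<Longrightarrow> cmod (g \<zeta>) \<le> K"
      using compact_imp_bounded[of "g ` sphere 0 1"] unfolding bounded_iff by fastforce
    thus ?thesis by (intro integrable_circle_mult[OF hi] borel_measurable_circle_continuous cont)
  qed
  define I where "I = (LINT \<zeta>|circle_measure. cmod (h \<zeta>))"
  have I0: "I \<ge> 0" unfolding I_def by (rule Bochner_Integration.integral_nonneg) simp
  have "(\<lambda>n. LINT \<zeta>|circle_measure. poly (p n) \<zeta> * h \<zeta>) \<longlonglongrightarrow> (LINT \<zeta>|circle_measure. f \<zeta> * h \<zeta>)"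
  proof (rule LIMSEQ_I)
    fix r :: real assume r: "r > 0"
    define e where "e = r / (I + 1)"
    have e: "e > 0" "e * I < r" using r I0 by (auto simp: e_def field_simps)
    have "eventually (\<lambda>n. \<forall>z\<in>cball 0 1. dist (poly (p n) z) (f z) < e) sequentially"
      using uniform_limitD[OF p[unfolded poly_approx_def] e(1)] .
    then obtain n0 where n0: "\<And>n z. n \<ge> n0 \<Longrightarrow> cmod z \<le> 1 \<Longrightarrow> dist (poly (p n) z) (f z) < e"
      unfolding eventually_sequentially by (metis mem_cball_0)
    have "cmod ((LINT \<zeta>|circle_measure. poly (p n) \<zeta> * h \<zeta>) - (LINT \<zeta>|circle_measure. f \<zeta> * h \<zeta>)) < r"
      if n: "n \<ge> n0" for n
    proof -
      have "(LINT \<zeta>|circle_measure. poly (p n) \<zeta> * h \<zeta>) - (LINT \<zeta>|circle_measure. f \<zeta> * h \<zeta>) =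
          (LINT \<zeta>|circle_measure. poly (p n) \<zeta> * h \<zeta> - f \<zeta> * h \<zeta>)"
        by (intro Bochner_Integration.integral_diff[symmetric] int f poly_analytic)
      also have "cmod \<dots> \<le> (LINT \<zeta>|circle_measure. cmod (poly (p n) \<zeta> * h \<zeta> - f \<zeta> * h \<zeta>))"
        by (rule integral_norm_bound)
      also have "\<dots> \<le> (LINT \<zeta>|circle_measure. e * cmod (h \<zeta>))"
      proof (rule integral_mono)
        show "integrable circle_measure (\<lambda>\<zeta>. cmod (poly (p n) \<zeta> * h \<zeta> - f \<zeta> * h \<zeta>))"
          by (intro integrable_norm Bochner_Integration.integrable_diff int f poly_analytic)
        show "integrable circle_measure (\<lambda>\<zeta>. e * cmod (h \<zeta>))" using hi by simp
        fix \<zeta> assume "\<zeta> \<in> space circle_measure"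
        hence "cmod (poly (p n) \<zeta> - f \<zeta>) \<le> e" using n0[OF n, of \<zeta>] by (simp add: dist_norm)
        thus "cmod (poly (p n) \<zeta> * h \<zeta> - f \<zeta> * h \<zeta>) \<le> e * cmod (h \<zeta>)"
          unfolding left_diff_distrib[symmetric] norm_mult by (rule mult_right_mono) simp
      qed
      also have "\<dots> = e * I" by (simp add: I_def)
      finally show ?thesis using e(2) by simp
    qed
    thus "\<exists>n0. \<forall>n\<ge>n0. cmod ((LINT \<zeta>|circle_measure. poly (p n) \<zeta> * h \<zeta>) - (LINT \<zeta>|circle_measure. f \<zeta> * h \<zeta>)) < r"
      by blast
  qed
  moreover have "(\<lambda>n. cinner (poly_op (p n) T x) y) \<longlonglongrightarrow> cinner (calc f x) y"
    by (intro tendsto_cinner_left calc_limit f p)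
  moreover have "cinner (poly_op (p n) T x) y = (LINT \<zeta>|circle_measure. poly (p n) \<zeta> * h \<zeta>)" for n
    using h by (simp add: represents_def)
  ultimately show ?thesis using LIMSEQ_unique by auto
qed

text \<open>\<open>b\<close> stands for the boundary function; only its values on the circle enter,
  as almost everywhere limits of the finite products. The sets \<open>F n\<close> increase, so
  quotients of later by earlier partial products are again Blaschke products.\<close>

locale ac_blaschke = poly_bounded T M
  for T :: "'a::complex_hilbert_space \<Rightarrow> 'a" and M :: real +
  fixes F :: "nat \<Rightarrow> 'i set" and l :: "'i \<Rightarrow> complex" and b :: "complex \<Rightarrow> complex"
  assumes ac: "absolutely_continuous_operator T"
    and F: "\<And>n. finite (F n)" "incseq F" "\<And>n i. i \<in> F n \<Longrightarrow> cmod (l i) < 1"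
    and conv: "AE \<zeta> in circle_measure. (\<lambda>n. finite_blaschke l (F n) \<zeta>) \<longlonglongrightarrow> b \<zeta>"
    and b_m: "b \<in> borel_measurable circle_measure"
begin

lemma fb_an: "finite_blaschke l (F n - U) analytic_on cball 0 1"
  by (rule finite_blaschke_analytic) (use F in auto)

lemma fb_le: "cmod z \<le> 1 \<Longrightarrow> cmod (finite_blaschke l (F n - U) z) \<le> 1"
  by (rule cmod_finite_blaschke_le_1) (use F in auto)

lemma fb_m: "finite_blaschke l (F n - U) \<in> borel_measurable circle_measure"
  by (rule borel_measurable_circle_continuous, rule continuous_on_subset[OF
      holomorphic_on_imp_continuous_on[OF analytic_imp_holomorphic[OF fb_an]]]) auto

text \<open>\<open>U\<close> is empty for the operator of \<open>b\<close> itself and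
  \<open>F n\<close> for that of its quotient by the partial product over \<open>F n\<close>.
  Bounded convergence against the representing functions gives the weak limit.\<close>

lemma weak_limit:
  assumes g: "g \<in> borel_measurable circle_measure"
    and lim: "AE \<zeta> in circle_measure. (\<lambda>k. finite_blaschke l (F k - U) \<zeta>) \<longlonglongrightarrow> g \<zeta>"
  obtains L where "bounded_clinear L"
    "\<And>x y h. represents h T x y \<Longrightarrow> cinner (L x) y = (LINT \<zeta>|circle_measure. g \<zeta> * h \<zeta>)"
    "\<And>x y. (\<lambda>k. cinner (calc (finite_blaschke l (F k - U)) x) y) \<longlonglongrightarrow> cinner (L x) y"
proof -
  have cv: "(\<lambda>k. cinner (calc (finite_blaschke l (F k - U)) x) y) \<longlonglongrightarrow> (LINT \<zeta>|circle_measure. g \<zeta> * h \<zeta>)"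
    if h: "represents h T x y" for x y h
    unfolding represents_calc[OF h fb_an]
    by (rule integral_circle_bounded_convergence) (use h g lim fb_m fb_le in \<open>auto simp: represents_def\<close>)
  obtain L where L: "bounded_clinear L"
    "\<And>x y. (\<lambda>k. cinner (calc (finite_blaschke l (F k - U)) x) y) \<longlonglongrightarrow> cinner (L x) y"
  proof (rule weak_limit_operator)
    show "bounded_clinear (calc (finite_blaschke l (F k - U)))" for k by (rule calc_bounded_clinear[OF fb_an])
    show "norm (calc (finite_blaschke l (F k - U)) x) \<le> M * 1 * norm x" for k x
      by (rule calc_bound[OF fb_an fb_le])
    show "convergent (\<lambda>k. cinner (calc (finite_blaschke l (F k - U)) x) y)" for x y
      using ac cv unfolding absolutely_continuous_operator_def convergent_def by blast
  qed blast
  show ?thesis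
  proof (rule that[OF L(1) _ L(2)])
    fix x y h assume "represents h T x y"
    from LIMSEQ_unique[OF L(2) cv[OF this]]
    show "cinner (L x) y = (LINT \<zeta>|circle_measure. g \<zeta> * h \<zeta>)" .
  qed
qed

lemma operator_exists:
  obtains L where "bounded_clinear L"
    "\<And>x y h. represents h T x y \<Longrightarrow> cinner (L x) y = (LINT \<zeta>|circle_measure. b \<zeta> * h \<zeta>)"
proof -
  have "AE \<zeta> in circle_measure. (\<lambda>k. finite_blaschke l (F k - {}) \<zeta>) \<longlonglongrightarrow> b \<zeta>" using conv by simp
  from weak_limit[OF b_m this] show ?thesis using that by metis
qed

lemma finite_blaschke_split:
  assumes "n \<le> k"
  shows "finite_blaschke l (F k) z = finite_blaschke l (F n) z * finite_blaschke l (F k - F n) z"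
  by (intro finite_blaschke_mult_diff F(1) incseqD[OF F(2) assms])

lemma null_spaces_incseq: "incseq (\<lambda>n. {x. calc (finite_blaschke l (F n)) x = 0})"
  unfolding incseq_def
proof (intro allI impI subsetI)
  fix n k x assume nk: "n \<le> k" and x: "x \<in> {x. calc (finite_blaschke l (F n)) x = 0}"
  have an: "finite_blaschke l (F n) analytic_on cball 0 1" using fb_an[of n "{}"] by simp
  have "calc (finite_blaschke l (F k)) x = calc (\<lambda>z. finite_blaschke l (F k - F n) z * finite_blaschke l (F n) z) x"
    using calc_cong[of "finite_blaschke l (F k)" "\<lambda>z. finite_blaschke l (F k - F n) z * finite_blaschke l (F n) z"]
      finite_blaschke_split[OF nk] by (simp add: mult.commute)
  also have "\<dots> = calc (finite_blaschke l (F k - F n)) (calc (finite_blaschke l (F n)) x)"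
    by (intro calc_mult fb_an an)
  also have "\<dots> = 0" using x by (simp add: bounded_clinear_simps(3)[OF calc_bounded_clinear[OF fb_an]])
  finally show "x \<in> {x. calc (finite_blaschke l (F k)) x = 0}" by simp
qed

text \<open>On the circle, division by a finite Blaschke product is multiplication by its conjugate.
  The operator \<open>L\<close> with boundary function \<open>b * cnj \<Theta>\<^sub>n\<close>
  satisfies \<open>\<Theta>\<^sub>n(T) L = 0\<close>, so its range lies in the null space. For
  \<open>y\<close> orthogonal to all null spaces, the integrals of
  \<open>b * cnj \<Theta>\<^sub>n\<close> against a function representing \<open>T\<close> at
  \<open>y, y\<close> have real part 0, while they tend to the squared norm of
  \<open>y\<close>.\<close>

lemma dense_null_spaces:
  assumes zero: "\<And>x y h. represents h T x y \<Longrightarrow> (LINT \<zeta>|circle_measure. b \<zeta> * h \<zeta>) = 0"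
  shows "closure (\<Union>n. {x. calc (finite_blaschke l (F n)) x = 0}) = UNIV"
proof -
  define V where "V n = {x. calc (finite_blaschke l (F n)) x = 0}" for n
  have an: "finite_blaschke l (F n) analytic_on cball 0 1" for n using fb_an[of n "{}"] by simp
  note split = finite_blaschke_split
  have V_mono: "V n \<subseteq> V k" if "n \<le> k" for n k
    using incseqD[OF null_spaces_incseq that] by (simp add: V_def)
  have V_sub: "subspace (V n)" for n
  proof -
    note bc = calc_bounded_clinear[OF an[of n]]
    have "calc (finite_blaschke l (F n)) (r *\<^sub>R x) = r *\<^sub>R calc (finite_blaschke l (F n)) x" for r x
      using bounded_clinear_scaleC[OF bc, of "of_real r" x] by (simp add: scaleC_of_real)
    thus ?thesis by (auto simp: V_def subspace_def bounded_clinear_simps[OF bc])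
  qed
  have "subspace (\<Union>n. V n)"
    unfolding subspace_def
  proof safe
    show "0 \<in> (\<Union>n. V n)" using subspace_0[OF V_sub] by blast
    show "x + y \<in> (\<Union>n. V n)" if "x \<in> V m" "y \<in> V n" for x y m n
      using subspace_add[OF V_sub[of "max m n"], of x y] V_mono[of m "max m n"] V_mono[of n "max m n"] that by auto
    show "c *\<^sub>R x \<in> (\<Union>n. V n)" if "x \<in> V n" for c x n
      using subspace_scale[OF V_sub that] by blast
  qed
  hence W: "subspace (closure (\<Union>n. V n))" by (rule subspace_closure)
  have conj_lim: "AE \<zeta> in circle_measure. (\<lambda>k. finite_blaschke l (F k - F n) \<zeta>) \<longlonglongrightarrow> b \<zeta> * cnj (finite_blaschke l (F n) \<zeta>)" for n
    using conv AE_circle_norm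
  proof eventually_elim
    case (elim \<zeta>)
    have "(\<lambda>k. finite_blaschke l (F k) \<zeta> * cnj (finite_blaschke l (F n) \<zeta>)) \<longlonglongrightarrow> b \<zeta> * cnj (finite_blaschke l (F n) \<zeta>)"
      by (intro tendsto_intros elim)
    moreover have "eventually (\<lambda>k. finite_blaschke l (F k) \<zeta> * cnj (finite_blaschke l (F n) \<zeta>) = finite_blaschke l (F k - F n) \<zeta>) sequentially"
      using eventually_ge_at_top[of n]
    proof eventually_elim
      fix k assume "n \<le> k"
      have "cmod (finite_blaschke l (F n) \<zeta>) = 1" using elim F by (intro cmod_finite_blaschke_eq_1) auto
      hence "finite_blaschke l (F n) \<zeta> * cnj (finite_blaschke l (F n) \<zeta>) = 1" by (simp add: complex_norm_square[symmetric])
      thus "finite_blaschke l (F k) \<zeta> * cnj (finite_blaschke l (F n) \<zeta>) = finite_blaschke l (F k - F n) \<zeta>"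
        unfolding split[OF \<open>n \<le> k\<close>] by (metis mult.assoc mult.commute mult.right_neutral)
    qed
    ultimately show ?case by (rule Lim_transform_eventually)
  qed
  have g_m: "(\<lambda>\<zeta>. b \<zeta> * cnj (finite_blaschke l (F n) \<zeta>)) \<in> borel_measurable circle_measure" for n
  proof -
    have cnj_m: "cnj \<in> borel_measurable borel"
      by (intro borel_measurable_continuous_onI continuous_intros)
    have "finite_blaschke l (F n) \<in> borel_measurable circle_measure" using fb_m[of n "{}"] by simp
    from measurable_compose[OF this cnj_m] show ?thesis by (intro borel_measurable_times b_m)
  qed
  have orth: "y = 0" if y: "\<And>w. w \<in> closure (\<Union>n. V n) \<Longrightarrow> inner w y = 0" for y
  proof -
    have zero_n: "Re (LINT \<zeta>|circle_measure. (b \<zeta> * cnj (finite_blaschke l (F n) \<zeta>)) * h \<zeta>) = 0"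
      if h: "represents h T x y" for n x h
    proof -
      obtain L where L: "bounded_clinear L"
        "\<And>x y h. represents h T x y \<Longrightarrow> cinner (L x) y = (LINT \<zeta>|circle_measure. b \<zeta> * cnj (finite_blaschke l (F n) \<zeta>) * h \<zeta>)"
        "\<And>x y. (\<lambda>k. cinner (calc (finite_blaschke l (F k - F n)) x) y) \<longlonglongrightarrow> cinner (L x) y"
        using weak_limit[OF g_m conj_lim] by blast
      \<comment> \<open>The adjoint moves \<open>\<Theta>\<^sub>n(T)\<close> to the other side,
        where the weak limit can be taken.\<close>
      obtain B where B: "\<And>x y. cinner (calc (finite_blaschke l (F n)) x) y = cinner x (B y)"
        using bounded_clinear_adjoint[OF calc_bounded_clinear[OF an]] by metis
      have "cinner (calc (finite_blaschke l (F n)) (L x)) v = 0" for v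
      proof -
        obtain h' where h': "represents h' T x v" using ac by (auto simp: absolutely_continuous_operator_def)
        have "(\<lambda>k. cinner (calc (finite_blaschke l (F k - F n)) x) (B v)) \<longlonglongrightarrow> cinner (L x) (B v)" by (rule L(3))
        hence "(\<lambda>k. cinner (calc (finite_blaschke l (F n)) (calc (finite_blaschke l (F k - F n)) x)) v)
            \<longlonglongrightarrow> cinner (calc (finite_blaschke l (F n)) (L x)) v" by (simp only: B)
        moreover have "eventually (\<lambda>k. cinner (calc (finite_blaschke l (F n)) (calc (finite_blaschke l (F k - F n)) x)) v =
            (LINT \<zeta>|circle_measure. finite_blaschke l (F k) \<zeta> * h' \<zeta>)) sequentially"
          using eventually_ge_at_top[of n]
        proof eventually_elim
          fix k assume k: "n \<le> k"
          have "calc (finite_blaschke l (F n)) (calc (finite_blaschke l (F k - F n)) x) =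
              calc (\<lambda>z. finite_blaschke l (F n) z * finite_blaschke l (F k - F n) z) x"
            by (intro calc_mult[symmetric] an fb_an)
          also have "\<dots> = calc (finite_blaschke l (F k)) x"
            using calc_cong[of "finite_blaschke l (F k)"] split[OF k] by metis
          finally show "cinner (calc (finite_blaschke l (F n)) (calc (finite_blaschke l (F k - F n)) x)) v =
            (LINT \<zeta>|circle_measure. finite_blaschke l (F k) \<zeta> * h' \<zeta>)" by (simp add: represents_calc[OF h' an])
        qed
        ultimately have "(\<lambda>k. LINT \<zeta>|circle_measure. finite_blaschke l (F k) \<zeta> * h' \<zeta>)
            \<longlonglongrightarrow> cinner (calc (finite_blaschke l (F n)) (L x)) v" by (rule Lim_transform_eventually)
        moreover have "(\<lambda>k. LINT \<zeta>|circle_measure. finite_blaschke l (F k) \<zeta> * h' \<zeta>) \<longlonglongrightarrow> (LINT \<zeta>|circle_measure. b \<zeta> * h' \<zeta>)"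
          using fb_m[of _ "{}"] fb_le[of _ _ "{}"] h' conv b_m
          by (intro integral_circle_bounded_convergence) (auto simp: represents_def)
        ultimately have "cinner (calc (finite_blaschke l (F n)) (L x)) v = (LINT \<zeta>|circle_measure. b \<zeta> * h' \<zeta>)"
          by (rule LIMSEQ_unique)
        thus ?thesis using zero[OF h'] by simp
      qed
      from this[of "calc (finite_blaschke l (F n)) (L x)"]
      have "calc (finite_blaschke l (F n)) (L x) = 0"
        by (metis inner_eq_Re_cinner inner_eq_zero_iff zero_complex.simps(1))
      hence "L x \<in> (\<Union>n. V n)" by (auto simp: V_def)
      hence "inner (L x) y = 0" using closure_subset y by blast
      thus ?thesis using L(2)[OF h] by (simp add: inner_eq_Re_cinner)
    qed
    obtain h where h: "represents h T y y" using ac by (auto simp: absolutely_continuous_operator_def)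
    have hi: "integrable circle_measure h" using h by (simp add: represents_def)
    \<comment> \<open>Limits of unimodular numbers are unimodular, so \<open>b * cnj b = 1\<close>
      almost everywhere.\<close>
    have bb: "AE \<zeta> in circle_measure. (\<lambda>n. b \<zeta> * cnj (finite_blaschke l (F n) \<zeta>)) \<longlonglongrightarrow> 1 \<and> cmod (b \<zeta>) = 1"
      using conv AE_circle_norm
    proof eventually_elim
      case (elim \<zeta>)
      have 1: "cmod (finite_blaschke l (F n) \<zeta>) = 1" for n using elim F by (intro cmod_finite_blaschke_eq_1) auto
      have "(\<lambda>n. cmod (finite_blaschke l (F n) \<zeta>)) \<longlonglongrightarrow> cmod (b \<zeta>)" by (intro tendsto_intros elim)
      hence n: "cmod (b \<zeta>) = 1" unfolding 1 by (simp add: LIMSEQ_const_iff)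
      have "(\<lambda>n. b \<zeta> * cnj (finite_blaschke l (F n) \<zeta>)) \<longlonglongrightarrow> b \<zeta> * cnj (b \<zeta>)" by (intro tendsto_intros elim)
      moreover have "b \<zeta> * cnj (b \<zeta>) = 1" using n by (simp add: complex_norm_square[symmetric])
      ultimately show ?case using n by simp
    qed
    have "(\<lambda>n. LINT \<zeta>|circle_measure. (b \<zeta> * cnj (finite_blaschke l (F n) \<zeta>)) * h \<zeta>) \<longlonglongrightarrow> (LINT \<zeta>|circle_measure. h \<zeta>)"
    proof (rule integral_dominated_convergence[where w = "\<lambda>\<zeta>. cmod (h \<zeta>)"])
      show "h \<in> borel_measurable circle_measure" using hi by simp
      show "(\<lambda>\<zeta>. (b \<zeta> * cnj (finite_blaschke l (F n) \<zeta>)) * h \<zeta>) \<in> borel_measurable circle_measure" for n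
        by (intro borel_measurable_times[OF g_m] borel_measurable_integrable hi)
      show "integrable circle_measure (\<lambda>\<zeta>. cmod (h \<zeta>))" using hi by simp
      show "AE \<zeta> in circle_measure. (\<lambda>n. (b \<zeta> * cnj (finite_blaschke l (F n) \<zeta>)) * h \<zeta>) \<longlonglongrightarrow> h \<zeta>"
        using bb
      proof eventually_elim
        case (elim \<zeta>)
        have "(\<lambda>n. (b \<zeta> * cnj (finite_blaschke l (F n) \<zeta>)) * h \<zeta>) \<longlonglongrightarrow> 1 * h \<zeta>"
          using elim by (intro tendsto_mult tendsto_const) auto
        thus ?case by simp
      qed
      show "AE \<zeta> in circle_measure. cmod ((b \<zeta> * cnj (finite_blaschke l (F n) \<zeta>)) * h \<zeta>) \<le> cmod (h \<zeta>)" for n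
        using bb AE_circle_norm
      proof eventually_elim
        case (elim \<zeta>)
        have "cmod (finite_blaschke l (F n) \<zeta>) = 1" using elim F by (intro cmod_finite_blaschke_eq_1) auto
        thus ?case using elim by (simp add: norm_mult)
      qed
    qed
    from tendsto_Re[OF this] have "Re (LINT \<zeta>|circle_measure. h \<zeta>) = 0"
      unfolding zero_n[OF h] by (simp add: LIMSEQ_const_iff)
    moreover have "cinner y y = (LINT \<zeta>|circle_measure. h \<zeta>)"
      using represents_calc[OF h, of "\<lambda>_. 1"] by (simp add: calc_const analytic_intros)
    ultimately have "inner y y = 0" by (simp add: inner_eq_Re_cinner)
    thus "y = 0" by simp
  qed
  have "x \<in> closure (\<Union>n. V n)" for x
  proof (rule ccontr)
    assume "x \<notin> closure (\<Union>n. V n)"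
    then obtain y where "y \<noteq> 0" "\<And>w. w \<in> closure (\<Union>n. V n) \<Longrightarrow> inner w y = 0"
      using closed_subspace_orthogonal[OF W closed_closure] by metis
    thus False using orth by blast
  qed
  thus ?thesis unfolding V_def by blast
qed

end

subsection \<open>Measurability of radial boundary values\<close>

text \<open>Outside the set \<open>C\<close> of points with a radial limit,
  \<open>boundary_value\<close> is the fixed default of \<open>Lim\<close>, so \<open>C\<close>
  itself must be shown measurable. It is given by a Cauchy condition whose exceptional sets
  \<open>U m n\<close> are relatively open, being unions of open sets over arbitrary radii.\<close>

lemma boundary_value_measurable:
  assumes cont: "continuous_on (ball 0 1) \<theta>"
  shows "boundary_value \<theta> \<in> borel_measurable circle_measure"
proof -
  define U where "U m n = (\<Union>r\<in>{1 - 1 / Suc n<..<1}. \<Union>s\<in>{1 - 1 / Suc n<..<1}.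
    {\<zeta> \<in> sphere 0 1. 1 / Suc m < dist (\<theta> (of_real r * \<zeta>)) (\<theta> (of_real s * \<zeta>))})" for m n
  define C where "C = (\<Inter>m. \<Union>n. sphere 0 1 - U m n)"
  have rad_cont: "continuous_on (sphere 0 1) (\<lambda>\<zeta>. \<theta> (of_real r * \<zeta>))" if "0 \<le> r" "r < 1" for r
    by (rule continuous_on_compose2[OF cont]) (use that in \<open>auto simp: norm_mult intro!: continuous_intros\<close>)
  have bnd: "0 \<le> r" if "r \<in> {1 - 1 / Suc n<..<1}" for r and n :: nat
  proof -
    have "1 / real (Suc n) \<le> 1" by simp
    thus ?thesis using that unfolding greaterThanLessThan_iff by linarith
  qed
  have open1: "openin (top_of_set (sphere 0 1))
        {\<zeta> \<in> sphere 0 1. 1 / Suc m < dist (\<theta> (of_real r * \<zeta>)) (\<theta> (of_real s * \<zeta>))}"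
    if rs: "r \<in> {1 - 1 / Suc n<..<1}" "s \<in> {1 - 1 / Suc n<..<1}" for r s :: real and m n :: nat
  proof -
    have c: "continuous_on (sphere 0 1) (\<lambda>\<zeta>. dist (\<theta> (of_real r * \<zeta>)) (\<theta> (of_real s * \<zeta>)))"
      using bnd[OF rs(1)] bnd[OF rs(2)] rs by (intro continuous_on_dist rad_cont) auto
    have "openin (top_of_set (sphere 0 1))
        (sphere 0 1 \<inter> (\<lambda>\<zeta>. dist (\<theta> (of_real r * \<zeta>)) (\<theta> (of_real s * \<zeta>))) -` {1 / Suc m<..})"
      by (rule continuous_openin_preimage_gen[OF c]) simp
    moreover have "sphere 0 1 \<inter> (\<lambda>\<zeta>. dist (\<theta> (of_real r * \<zeta>)) (\<theta> (of_real s * \<zeta>))) -` {1 / Suc m<..} =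
        {\<zeta> \<in> sphere 0 1. 1 / Suc m < dist (\<theta> (of_real r * \<zeta>)) (\<theta> (of_real s * \<zeta>))}" by auto
    ultimately show ?thesis by simp
  qed
  have "openin (top_of_set (sphere 0 1)) (\<Union>s\<in>{1 - 1 / Suc n<..<1}.
      {\<zeta> \<in> sphere 0 1. 1 / Suc m < dist (\<theta> (of_real r * \<zeta>)) (\<theta> (of_real s * \<zeta>))})"
    if "r \<in> {1 - 1 / Suc n<..<1}" for r :: real and m n :: nat
    using open1[OF that] by (intro openin_Union) blast
  hence "openin (top_of_set (sphere 0 1)) (U m n)" for m n
    unfolding U_def by (intro openin_Union) blast
  hence U_ex: "\<exists>V. open V \<and> U m n = sphere 0 1 \<inter> V" for m n unfolding openin_open .
  have "U m n \<in> sets circle_measure" for m n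
  proof -
    obtain V where "open V" "U m n = sphere 0 1 \<inter> V" using U_ex by blast
    thus ?thesis unfolding sets_circle sets_restrict_space by (auto intro!: image_eqI[of _ _ V])
  qed
  moreover have "sphere 0 1 \<in> sets circle_measure" using sets.top[of circle_measure] by simp
  ultimately have C: "C \<in> sets circle_measure" unfolding C_def by auto
  \<comment> \<open>On \<open>C\<close> the radial limit may be computed along any sequence of radii
    tending to 1 from below.\<close>
  define r where "r n = 1 - inverse (real (Suc n))" for n :: nat
  have r: "0 \<le> r n" "r n < 1" for n by (auto simp: r_def inverse_eq_divide)
  have r_lim: "r \<longlonglongrightarrow> 1" unfolding r_def using tendsto_diff[OF tendsto_const LIMSEQ_inverse_real_of_nat, of 1] by simp
  have r_filter: "filterlim r (at_left 1) sequentially"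
    unfolding filterlim_at using r_lim r by (auto simp: less_imp_neq intro!: always_eventually)
  have ex: "\<exists>L. ((\<lambda>r. \<theta> (of_real r * \<zeta>)) \<longlongrightarrow> L) (at_left 1)" if \<zeta>: "\<zeta> \<in> C" for \<zeta>
  proof -
    have osc: "\<exists>n. \<forall>r s. r \<in> {1 - 1 / Suc n<..<1} \<longrightarrow> s \<in> {1 - 1 / Suc n<..<1} \<longrightarrow>
        dist (\<theta> (of_real r * \<zeta>)) (\<theta> (of_real s * \<zeta>)) < e" if e: "e > 0" for e :: real
    proof -
      obtain m where m: "1 / Suc m < e" using reals_Archimedean[OF e] by (auto simp: inverse_eq_divide)
      obtain n where n: "\<zeta> \<in> sphere 0 1 - U m n" using \<zeta> by (auto simp: C_def)
      hence "dist (\<theta> (of_real r * \<zeta>)) (\<theta> (of_real s * \<zeta>)) \<le> 1 / Suc m"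
        if "r \<in> {1 - 1 / Suc n<..<1}" "s \<in> {1 - 1 / Suc n<..<1}" for r s
        using that unfolding U_def by (metis (no_types, lifting) DiffE UN_I mem_Collect_eq not_le)
      thus ?thesis using m by (intro exI[of _ n]) (meson le_less_trans)
    qed
    have ev: "eventually (\<lambda>k. r k \<in> {1 - 1 / Suc n<..<1}) sequentially" for n
      using order_tendstoD(1)[OF r_lim, of "1 - 1 / Suc n"] r(2) by simp
    have "Cauchy (\<lambda>k. \<theta> (of_real (r k) * \<zeta>))"
    proof (rule metric_CauchyI)
      fix e :: real assume "e > 0"
      then obtain n where n: "\<And>r s. r \<in> {1 - 1 / Suc n<..<1} \<Longrightarrow> s \<in> {1 - 1 / Suc n<..<1} \<Longrightarrow>
        dist (\<theta> (of_real r * \<zeta>)) (\<theta> (of_real s * \<zeta>)) < e" using osc by blast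
      obtain k where "\<And>j. j \<ge> k \<Longrightarrow> r j \<in> {1 - 1 / Suc n<..<1}"
        using ev[of n] unfolding eventually_sequentially by blast
      thus "\<exists>k. \<forall>i\<ge>k. \<forall>j\<ge>k. dist (\<theta> (of_real (r i) * \<zeta>)) (\<theta> (of_real (r j) * \<zeta>)) < e" using n by blast
    qed
    then obtain L where L: "(\<lambda>k. \<theta> (of_real (r k) * \<zeta>)) \<longlonglongrightarrow> L" using Cauchy_convergent convergent_def by blast
    have "((\<lambda>r. \<theta> (of_real r * \<zeta>)) \<longlongrightarrow> L) (at_left 1)"
    proof (rule tendstoI)
      fix e :: real assume e: "e > 0"
      then obtain n where n: "\<And>r s. r \<in> {1 - 1 / Suc n<..<1} \<Longrightarrow> s \<in> {1 - 1 / Suc n<..<1} \<Longrightarrow>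
        dist (\<theta> (of_real r * \<zeta>)) (\<theta> (of_real s * \<zeta>)) < e / 2" using osc[of "e / 2"] by auto
      have "eventually (\<lambda>k. r k \<in> {1 - 1 / Suc n<..<1} \<and> dist (\<theta> (of_real (r k) * \<zeta>)) L < e / 2) sequentially"
        using e by (intro eventually_conj ev tendstoD[OF L]) auto
      then obtain k where k: "r k \<in> {1 - 1 / Suc n<..<1}" "dist (\<theta> (of_real (r k) * \<zeta>)) L < e / 2"
        by (auto simp: eventually_sequentially)
      have "eventually (\<lambda>s. s \<in> {1 - 1 / Suc n<..<1}) (at_left (1::real))"
        by (rule eventually_at_leftI[of "1 - 1 / Suc n"]) (auto simp del: of_nat_Suc)
      thus "eventually (\<lambda>s. dist (\<theta> (of_real s * \<zeta>)) L < e) (at_left 1)"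
      proof eventually_elim
        case (elim s)
        show ?case using dist_triangle[of "\<theta> (of_real s * \<zeta>)" L "\<theta> (of_real (r k) * \<zeta>)"] n[OF elim k(1)] k(2) by linarith
      qed
    qed
    thus ?thesis by blast
  qed
  have in_C: "\<zeta> \<in> C" if L: "((\<lambda>r. \<theta> (of_real r * \<zeta>)) \<longlongrightarrow> L) (at_left 1)" and \<zeta>: "cmod \<zeta> = 1" for \<zeta> L
    unfolding C_def
  proof
    fix m
    have "eventually (\<lambda>r. dist (\<theta> (of_real r * \<zeta>)) L < 1 / Suc m / 2) (at_left 1)"
      by (rule tendstoD[OF L]) simp
    then obtain a where a: "a < 1" "\<And>r. a < r \<Longrightarrow> r < 1 \<Longrightarrow> dist (\<theta> (of_real r * \<zeta>)) L < 1 / Suc m / 2"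
      unfolding eventually_at_left_field by auto
    obtain n where n: "1 / Suc n < 1 - a" using reals_Archimedean[of "1 - a"] a(1) by (auto simp: inverse_eq_divide)
    have "\<zeta> \<notin> U m n"
    proof
      assume "\<zeta> \<in> U m n"
      then obtain r s where rs: "r \<in> {1 - 1 / Suc n<..<1}" "s \<in> {1 - 1 / Suc n<..<1}"
        "1 / Suc m < dist (\<theta> (of_real r * \<zeta>)) (\<theta> (of_real s * \<zeta>))" unfolding U_def by blast
      have ars: "a < r" "r < 1" "a < s" "s < 1" using rs n by auto
      show False
        using a(2)[OF ars(1,2)] a(2)[OF ars(3,4)] rs(3)
          dist_triangle2[of "\<theta> (of_real r * \<zeta>)" "\<theta> (of_real s * \<zeta>)" L] by linarith
    qed
    thus "\<zeta> \<in> (\<Union>n. sphere 0 1 - U m n)" using \<zeta> by auto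
  qed
  have m1: "(\<lambda>\<zeta>. lim (\<lambda>n. \<theta> (of_real (r n) * \<zeta>))) \<in> borel_measurable circle_measure"
    by (intro borel_measurable_lim_metric borel_measurable_circle_continuous rad_cont r)
  \<comment> \<open>\<open>THE L. False\<close> is the value of \<open>Lim\<close> where no limit
    exists, since its defining condition is then equivalent to \<open>False\<close>.\<close>
  have "(\<lambda>\<zeta>. if \<zeta> \<in> C then lim (\<lambda>n. \<theta> (of_real (r n) * \<zeta>)) else (THE L::complex. False)) \<in> borel_measurable circle_measure"
    using C by (intro measurable_If_set m1 borel_measurable_const) (use sets.Int_space_eq2[OF C] in simp)
  moreover have "boundary_value \<theta> \<zeta> = (if \<zeta> \<in> C then lim (\<lambda>n. \<theta> (of_real (r n) * \<zeta>)) else (THE L. False))"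
    if "\<zeta> \<in> space circle_measure" for \<zeta>
  proof (cases "\<zeta> \<in> C")
    case True
    then obtain L where L: "((\<lambda>r. \<theta> (of_real r * \<zeta>)) \<longlongrightarrow> L) (at_left 1)" using ex by blast
    have "boundary_value \<theta> \<zeta> = L" unfolding boundary_value_def by (intro tendsto_Lim L) simp
    moreover have "lim (\<lambda>n. \<theta> (of_real (r n) * \<zeta>)) = L"
      by (intro limI filterlim_compose[OF L r_filter])
    ultimately show ?thesis using True by simp
  next
    case False
    hence "\<not> ((\<lambda>r. \<theta> (of_real r * \<zeta>)) \<longlongrightarrow> L) (at_left 1)" for L using in_C[of \<zeta> L] that by auto
    thus ?thesis using False by (simp add: boundary_value_def Topological_Spaces.Lim_def)
  qed
  ultimately show ?thesis by (rule measurable_cong[THEN iffD2, rotated])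
qed

subsection \<open>Infinite Blaschke products\<close>

lemma blaschke_sequence_summable:
  assumes "blaschke_sequence I a"
  shows "summable (\<lambda>k. if k \<in> I then 1 - cmod (a k) else 0)"
proof -
  have "(\<lambda>k. if k \<in> I then 1 - cmod (a k) else 0) summable_on UNIV \<longleftrightarrow> (\<lambda>k. 1 - cmod (a k)) summable_on I"
    by (rule summable_on_cong_neutral) auto
  hence "(\<lambda>k. if k \<in> I then 1 - cmod (a k) else 0) summable_on UNIV"
    using assms by (simp add: blaschke_sequence_def)
  thus ?thesis by (rule summable_on_imp_summable)
qed

text \<open>The subset \<open>J\<close> covers the products with a deleted zero along with the full
  one.\<close>

lemma blaschke_product_limit:
  assumes I: "blaschke_sequence I a" and J: "J \<subseteq> I" and z: "cmod z < 1"
  shows "(\<lambda>n. finite_blaschke a (J \<inter> {..<n}) z) \<longlonglongrightarrow> blaschke_product J a z"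
proof -
  let ?f = "\<lambda>n. if n \<in> J then blaschke_factor (a n) z else 1"
  have le: "norm (?f n - 1) \<le> 2 / (1 - cmod z) * (if n \<in> I then 1 - cmod (a n) else 0)" for n
  proof (cases "n \<in> J")
    case True
    hence "cmod (a n) < 1" "n \<in> I" using I J by (auto simp: blaschke_sequence_def)
    thus ?thesis using cmod_one_minus_blaschke_factor_le[of "a n" z] z True by (simp add: norm_minus_commute)
  next
    case False
    thus ?thesis using I z by (auto simp: blaschke_sequence_def intro!: divide_nonneg_nonneg mult_nonneg_nonneg less_imp_le)
  qed
  have "summable (\<lambda>n. norm (?f n - 1))"
    by (rule summable_comparison_test'[OF summable_mult[OF blaschke_sequence_summable[OF I]], of 0])
      (subst real_norm_def, subst abs_norm_cancel, rule le)
  hence "convergent_prod ?f"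
    by (intro abs_convergent_prod_imp_convergent_prod summable_imp_abs_convergent_prod)
  from convergent_prod_LIMSEQ[OF this] have "(\<lambda>n. \<Prod>k<n. ?f k) \<longlonglongrightarrow> blaschke_product J a z"
    unfolding blaschke_product_def by (simp add: LIMSEQ_lessThan_iff_atMost)
  moreover have "finite_blaschke a (J \<inter> {..<n}) z = (\<Prod>k<n. ?f k)" for n
    unfolding finite_blaschke_def Int_commute[of J] by (rule prod.inter_restrict) simp
  ultimately show ?thesis by simp
qed

text \<open>The factors missing from a finite subproduct have modulus at most 1, so passing to
  finite sets can only increase the modulus.\<close>

lemma carleson_condition_finite:
  assumes I: "blaschke_sequence I a" and c: "carleson_condition I a"
  obtains \<delta> where "0 < \<delta>" "\<delta> \<le> 1"
    "\<And>U n. finite U \<Longrightarrow> U \<subseteq> I \<Longrightarrow> n \<in> I \<Longrightarrow> \<delta> \<le> cmod (finite_blaschke a (U - {n}) (a n))"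
proof -
  obtain e where e: "0 < ereal e" "ereal e < (INF n\<in>I. ereal (cmod (blaschke_product (I - {n}) a (a n))))"
    using c unfolding carleson_condition_def by (meson ereal_dense2 less_ereal.simps ereal_less(2) ereal_dense3)
  have prod: "e \<le> cmod (blaschke_product (I - {n}) a (a n))" if "n \<in> I" for n
  proof -
    have "ereal e \<le> ereal (cmod (blaschke_product (I - {n}) a (a n)))"
      using e(2) INF_lower[OF that, of "\<lambda>n. ereal (cmod (blaschke_product (I - {n}) a (a n)))"]
      by (meson less_le_trans less_imp_le)
    thus ?thesis by simp
  qed
  have a1: "cmod (a k) < 1" if "k \<in> I" for k using I that by (simp add: blaschke_sequence_def)
  have "e \<le> cmod (finite_blaschke a (U - {n}) (a n))" if U: "finite U" "U \<subseteq> I" and n: "n \<in> I" for U n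
  proof -
    have lim: "(\<lambda>m. cmod (finite_blaschke a ((I - {n}) \<inter> {..<m}) (a n))) \<longlonglongrightarrow> cmod (blaschke_product (I - {n}) a (a n))"
      by (intro tendsto_norm blaschke_product_limit[OF I] a1 n) auto
    obtain m0 where m0: "\<And>k. k \<in> U \<Longrightarrow> k < m0" using U(1) by (meson finite_nat_set_iff_bounded)
    have "cmod (finite_blaschke a ((I - {n}) \<inter> {..<m}) (a n)) \<le> cmod (finite_blaschke a (U - {n}) (a n))"
      if m: "m \<ge> m0" for m
    proof -
      have "U - {n} \<subseteq> (I - {n}) \<inter> {..<m}" using U(2) m0 m by (auto intro: less_le_trans)
      hence "finite_blaschke a ((I - {n}) \<inter> {..<m}) (a n) =
          finite_blaschke a (U - {n}) (a n) * finite_blaschke a ((I - {n}) \<inter> {..<m} - (U - {n})) (a n)"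
        by (intro finite_blaschke_mult_diff) auto
      moreover have "cmod (finite_blaschke a ((I - {n}) \<inter> {..<m} - (U - {n})) (a n)) \<le> 1"
        using a1 n by (intro cmod_finite_blaschke_le_1) (auto intro: less_imp_le)
      ultimately show ?thesis by (simp add: norm_mult mult_left_le)
    qed
    hence "cmod (blaschke_product (I - {n}) a (a n)) \<le> cmod (finite_blaschke a (U - {n}) (a n))"
      by (intro LIMSEQ_le_const2[OF lim]) blast
    thus ?thesis using prod[OF n] by simp
  qed
  \<comment> \<open>For an empty index set the infimum is infinite and \<open>e\<close> may exceed
    1; the minimum restores \<open>\<delta> \<le> 1\<close>.\<close>
  thus ?thesis using that[of "min e 1"] e(1) by (auto simp: min_le_iff_disj)
qed

theorem theorem3p2:
  fixes N :: nat
    and I :: "nat \<Rightarrow> nat set"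
    and a :: "nat \<Rightarrow> nat \<Rightarrow> complex"
    and B :: "nat \<Rightarrow> complex \<Rightarrow> complex"
    and \<theta> :: "complex \<Rightarrow> complex"
    and T :: "'a::complex_hilbert_space \<Rightarrow> 'a"
  assumes "\<And>j. j \<in> {1..N} \<Longrightarrow> blaschke_sequence (I j) (a j)"
    and "\<And>j. j \<in> {1..N} \<Longrightarrow> inj_on (a j) (I j)"
    and "\<And>j. j \<in> {1..N} \<Longrightarrow> carleson_condition (I j) (a j)"
    and "\<And>j z. j \<in> {1..N} \<Longrightarrow> z \<in> ball 0 1 \<Longrightarrow> B j z = blaschke_product (I j) (a j) z"
    and "\<And>z. z \<in> ball 0 1 \<Longrightarrow> \<theta> z = (\<Prod>j\<in>{1..N}. B j z)"
    and "polynomially_bounded T"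
    and "absolutely_continuous_operator T"
    and "hinf_calculus \<theta> T = (\<lambda>x. 0)"
  shows "similar_to_contraction T"
proof -
  note seq = assms(1) and carl = assms(3)
  \<comment> \<open>Zeros are indexed by pairs of sequence number and position; the first component
    is the colour, and a zero common to two sequences has two indices.\<close>
  define l where "l i = a (fst i) (snd i)" for i :: "nat \<times> nat"
  define F where "F n = Sigma {1..N} (\<lambda>j. I j \<inter> {..<n})" for n
  have F_fin: "finite (F n)" for n by (simp add: F_def)
  have F_inc: "incseq F" by (auto simp: F_def incseq_def)
  have l1: "cmod (l i) < 1" if "i \<in> F n" for i n
    using that seq by (force simp: F_def l_def blaschke_sequence_def)
  have prod_F: "finite_blaschke l (F n) z = (\<Prod>j\<in>{1..N}. finite_blaschke (a j) (I j \<inter> {..<n}) z)" for n z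
    unfolding finite_blaschke_def F_def l_def by (subst prod.Sigma) (auto simp: case_prod_unfold)
  have sum_F: "(\<Sum>i\<in>F n. g (l i)) = (\<Sum>j\<in>{1..N}. \<Sum>k\<in>I j \<inter> {..<n}. g (a j k))" for n and g :: "complex \<Rightarrow> real"
    unfolding F_def l_def by (subst sum.Sigma) (auto simp: case_prod_unfold)
  have lim: "(\<lambda>n. finite_blaschke l (F n) z) \<longlonglongrightarrow> \<theta> z" if z: "cmod z < 1" for z
  proof -
    have "(\<lambda>n. \<Prod>j\<in>{1..N}. finite_blaschke (a j) (I j \<inter> {..<n}) z) \<longlonglongrightarrow> (\<Prod>j\<in>{1..N}. blaschke_product (I j) (a j) z)"
      by (intro tendsto_prod blaschke_product_limit[OF seq _ z]) auto
    also have "(\<Prod>j\<in>{1..N}. blaschke_product (I j) (a j) z) = \<theta> z" using assms(4,5) z by simp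
    finally show ?thesis by (simp only: prod_F)
  qed
  define f where "f j k = (if k \<in> I j then 1 - cmod (a j k) else 0)" for j k
  have f_sum: "summable (f j)" if "j \<in> {1..N}" for j
    unfolding f_def by (rule blaschke_sequence_summable[OF seq[OF that]])
  have f0: "0 \<le> f j k" if "j \<in> {1..N}" for j k
    using seq[OF that] by (auto simp: f_def blaschke_sequence_def less_imp_le)
  define t where "t n = (\<Sum>j\<in>{1..N}. \<Sum>k<n. f j k)" for n
  have t_F: "(\<Sum>i\<in>F n. 1 - cmod (l i)) = t n" for n
  proof -
    have "(\<Sum>k\<in>I j \<inter> {..<n}. 1 - cmod (a j k)) = (\<Sum>k<n. f j k)" for j
      unfolding f_def Int_commute[of "I j"] by (rule sum.inter_restrict) simp
    thus ?thesis using sum_F[where g = "\<lambda>w. 1 - cmod w"] by (simp add: t_def)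
  qed
  \<comment> \<open>The part of the total sum of the numbers \<open>1 - cmod (l i)\<close> that
    \<open>F n\<close> does not yet reach.\<close>
  define \<eta> where "\<eta> n = (\<Sum>j\<in>{1..N}. suminf (f j)) - t n" for n
  have \<eta>: "(\<Sum>i\<in>F k - F n. 1 - cmod (l i)) \<le> \<eta> n" if "k \<ge> n" for n k
  proof -
    have "(\<Sum>i\<in>F k - F n. 1 - cmod (l i)) = t k - t n"
      unfolding t_F[symmetric] by (rule sum_diff[OF F_fin incseqD[OF F_inc that]])
    moreover have "t k \<le> (\<Sum>j\<in>{1..N}. suminf (f j))"
      unfolding t_def by (intro sum_mono sum_le_suminf f_sum) (auto simp: f0)
    ultimately show ?thesis by (simp add: \<eta>_def)
  qed
  have "t \<longlonglongrightarrow> (\<Sum>j\<in>{1..N}. suminf (f j))"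
    unfolding t_def by (intro tendsto_sum summable_LIMSEQ f_sum)
  hence \<eta>0: "\<eta> \<longlonglongrightarrow> 0" unfolding \<eta>_def by (auto intro!: tendsto_eq_intros)
  obtain \<sigma> where \<sigma>: "strict_mono \<sigma>"
    "AE \<zeta> in circle_measure. (\<lambda>n. finite_blaschke l (F (\<sigma> n)) \<zeta>) \<longlonglongrightarrow> boundary_value \<theta> \<zeta>"
    by (rule blaschke_radial_limits[OF F_fin F_inc l1 \<eta> \<eta>0 lim])
  have \<theta>_cont: "continuous_on (ball 0 1) \<theta>" by (rule blaschke_limit_continuous[OF l1 lim])
  obtain M where M: "M > 0" "\<And>p. onorm (poly_op p T) \<le> M * (SUP z\<in>cball 0 1. cmod (poly p z))"
    and T: "bounded_clinear T" using assms(6) unfolding polynomially_bounded_def by blast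
  \<comment> \<open>The subsequence is again an increasing exhaustion by finite sets, now with
    convergence almost everywhere on the circle.\<close>
  define F' where "F' n = F (\<sigma> n)" for n
  have F'_inc: "incseq F'"
    using F_inc \<sigma>(1) unfolding F'_def incseq_def strict_mono_def by (metis monoD strict_mono_mono \<sigma>(1))
  interpret ac_blaschke T M F' l "boundary_value \<theta>"
    by unfold_locales
      (use T M assms(7) F_fin l1 F'_inc \<sigma>(2) boundary_value_measurable[OF \<theta>_cont] in \<open>auto simp: F'_def\<close>)
  obtain L where L: "bounded_clinear L"
    "\<And>x y h. represents h T x y \<Longrightarrow> cinner (L x) y = (LINT \<zeta>|circle_measure. boundary_value \<theta> \<zeta> * h \<zeta>)"
    using operator_exists by blast
  \<comment> \<open>\<open>L\<close> meets the description of the calculus, and any other such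
    operator \<open>A\<close> agrees with it at \<open>x\<close>, as the choice
    \<open>y = A x - L x\<close> shows; so the hypothesis says \<open>L = 0\<close>.\<close>
  have "hinf_calculus \<theta> T = L"
    unfolding hinf_calculus_def
  proof (rule the_equality)
    show "bounded_clinear L \<and> (\<forall>x y h. represents h T x y \<longrightarrow>
        cinner (L x) y = (LINT \<zeta>|circle_measure. boundary_value \<theta> \<zeta> * h \<zeta>))" using L by blast
    fix A assume A: "bounded_clinear A \<and> (\<forall>x y h. represents h T x y \<longrightarrow>
        cinner (A x) y = (LINT \<zeta>|circle_measure. boundary_value \<theta> \<zeta> * h \<zeta>))"
    show "A = L"
    proof
      fix x
      obtain h where "represents h T x (A x - L x)" using ac by (auto simp: absolutely_continuous_operator_def)
      hence "cinner (A x - L x) (A x - L x) = 0" using A L(2) by (simp add: cinner_diff_left)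
      hence "inner (A x - L x) (A x - L x) = 0" by (simp add: inner_eq_Re_cinner)
      thus "A x = L x" by simp
    qed
  qed
  hence L0: "L = (\<lambda>x. 0)" using assms(8) by metis
  have "(LINT \<zeta>|circle_measure. boundary_value \<theta> \<zeta> * h \<zeta>) = 0" if "represents h T x y" for x y h
    using L(2)[OF that] by (simp add: L0)
  hence dense: "closure (\<Union>n. {x. calc (finite_blaschke l (F' n)) x = 0}) = UNIV" by (rule dense_null_spaces)
  have "\<forall>j. \<exists>\<delta>. j \<in> {1..N} \<longrightarrow> 0 < \<delta> \<and> \<delta> \<le> 1 \<and>
      (\<forall>U n. finite U \<longrightarrow> U \<subseteq> I j \<longrightarrow> n \<in> I j \<longrightarrow> \<delta> \<le> cmod (finite_blaschke (a j) (U - {n}) (a j n)))"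
    using carleson_condition_finite[OF seq carl] by metis
  then obtain \<delta> where \<delta>: "\<And>j. j \<in> {1..N} \<Longrightarrow> 0 < \<delta> j" "\<And>j. j \<in> {1..N} \<Longrightarrow> \<delta> j \<le> 1"
    "\<And>j U n. j \<in> {1..N} \<Longrightarrow> finite U \<Longrightarrow> U \<subseteq> I j \<Longrightarrow> n \<in> I j \<Longrightarrow> \<delta> j \<le> cmod (finite_blaschke (a j) (U - {n}) (a j n))"
    by metis
  \<comment> \<open>The Carleson sum over all zeros is the sum of those of the single sequences, and
    so is its bound.\<close>
  define K where "K = (\<Sum>j\<in>{1..N}. 1 - 2 * ln ((\<delta> j)\<^sup>2 / 12))"
  have K0: "0 \<le> K" unfolding K_def
  proof (rule sum_nonneg)
    fix j assume j: "j \<in> {1..N}"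
    have "(\<delta> j)\<^sup>2 \<le> 1" using \<delta>(1,2)[OF j] by (simp add: power_le_one)
    hence "ln ((\<delta> j)\<^sup>2 / 12) \<le> 0" using \<delta>(1)[OF j] by (intro ln_le_zero_iff[THEN iffD2]) auto
    thus "0 \<le> 1 - 2 * ln ((\<delta> j)\<^sup>2 / 12)" by simp
  qed
  \<comment> \<open>At most each \<open>\<delta> j\<close>, so that the Carleson condition gives
    separation within a colour, and small enough for \<open>8 * K * M * d \<le> 1\<close>; the added
    1 keeps the denominator positive also for \<open>K = 0\<close>.\<close>
  define d where "d = Min (insert (1/2) (insert (1 / (8 * K * M + 1)) (\<delta> ` {1..N})))"
  have KM: "0 < 8 * K * M + 1" using K0 M(1) by (simp add: add_nonneg_pos)
  have d: "0 < d" "d \<le> 1/2" "d \<le> 1 / (8 * K * M + 1)" "\<And>j. j \<in> {1..N} \<Longrightarrow> d \<le> \<delta> j"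
  proof -
    let ?S = "insert (1/2) (insert (1 / (8 * K * M + 1)) (\<delta> ` {1..N}))"
    have "d \<in> ?S" unfolding d_def by (rule Min_in) auto
    thus "0 < d" using \<delta>(1) KM by auto
    have le: "d \<le> u" if "u \<in> ?S" for u unfolding d_def using that by (intro Min_le) auto
    show "d \<le> 1/2" "d \<le> 1 / (8 * K * M + 1)" "\<And>j. j \<in> {1..N} \<Longrightarrow> d \<le> \<delta> j"
      by (rule le; blast)+
  qed
  have "8 * K * M * d \<le> (8 * K * M + 1) * d" using d(1) by (simp add: algebra_simps)
  also have "\<dots> \<le> 1" using d(3) KM by (simp add: field_simps)
  finally have d1: "8 * K * M * d \<le> 1" .
  \<comment> \<open>Colours run from 1 to \<open>N\<close>, hence the strict bound
    \<open>Suc N\<close>. No zero has colour 0, so the sum \<open>g 0\<close> is empty and its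
    factor \<open>1 - g 0\<close> equals 1.\<close>
  have form: "carleson_form T M (F' n) l fst (Suc N) K d" for n
  proof unfold_locales
    show "fst i < Suc N" if "i \<in> F' n" for i using that by (auto simp: F'_def F_def)
    show "(\<Sum>i\<in>F' n. 1 - (cmod (blaschke_factor (l i) z))\<^sup>2) \<le> K" if z: "cmod z < 1" for z
    proof -
      have "(\<Sum>i\<in>F' n. 1 - (cmod (blaschke_factor (l i) z))\<^sup>2) =
          (\<Sum>j\<in>{1..N}. \<Sum>k\<in>I j \<inter> {..<\<sigma> n}. 1 - (cmod (blaschke_factor (a j k) z))\<^sup>2)"
        unfolding F'_def using sum_F[where g = "\<lambda>w. 1 - (cmod (blaschke_factor w z))\<^sup>2"] .
      also have "\<dots> \<le> K" unfolding K_def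
      proof (rule sum_mono)
        fix j assume j: "j \<in> {1..N}"
        show "(\<Sum>k\<in>I j \<inter> {..<\<sigma> n}. 1 - (cmod (blaschke_factor (a j k) z))\<^sup>2) \<le> 1 - 2 * ln ((\<delta> j)\<^sup>2 / 12)"
          by (rule carleson_sum_bound[where l = "a j"])
            (use \<delta>[OF j] z seq[OF j] in \<open>auto simp: blaschke_sequence_def\<close>)
      qed
      finally show ?thesis .
    qed
    show "d \<le> cmod (blaschke_factor (l k) (l m))"
      if km: "k \<in> F' n" "m \<in> F' n" "k \<noteq> m" "fst k = fst m" for k m
    proof -
      have j: "fst k \<in> {1..N}" "snd k \<in> I (fst k)" "snd m \<in> I (fst k)" "snd k \<noteq> snd m"
        using km by (auto simp: F'_def F_def prod_eq_iff)
      have "d \<le> \<delta> (fst k)" using d(4) j(1) by blast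
      \<comment> \<open>For the one-element set containing \<open>snd k\<close>, the finite Carleson
        bound is the separation of two zeros.\<close>
      also have "\<delta> (fst k) \<le> cmod (finite_blaschke (a (fst k)) ({snd k} - {snd m}) (a (fst k) (snd m)))"
        using j by (intro \<delta>(3)) auto
      also have "{snd k} - {snd m} = {snd k}" using j by auto
      finally show ?thesis using km(4) by (simp add: finite_blaschke_def l_def)
    qed
  qed (use d d1 F_fin l1 in \<open>auto simp: F'_def\<close>)
  define Q where "Q = real (Suc N) * (M * (1 + exp (K / (2 * d\<^sup>2) + 4 * K)) ^ Suc N * (M * exp (K / (2 * d\<^sup>2) + 4 * K)))"
  have "\<forall>n. \<exists>P (A :: (nat \<times> nat) \<times> nat \<Rightarrow> 'a \<Rightarrow> 'a). finite P \<and> (\<forall>p\<in>P. bounded_clinear (A p)) \<and>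
    (\<forall>x. (\<Sum>p\<in>P. (norm (A p x))\<^sup>2) \<le> real (nat \<lceil>2 * K\<rceil>) * M\<^sup>2 * (norm x)\<^sup>2) \<and>
    (\<forall>x. calc (finite_blaschke l (F' n)) x = 0 \<longrightarrow> 1 / (1 + Q\<^sup>2) * (norm x)\<^sup>2 \<le> (\<Sum>p\<in>P. (norm (A p x))\<^sup>2)) \<and>
    (\<forall>x. calc (finite_blaschke l (F' n)) x = 0 \<longrightarrow>
       (\<Sum>p\<in>P. (norm (A p (T x)))\<^sup>2) \<le> (\<Sum>p\<in>P. (norm (A p x))\<^sup>2))"
    unfolding Q_def using carleson_form.form_summary[OF form] by blast
  then obtain P and A :: "nat \<Rightarrow> (nat \<times> nat) \<times> nat \<Rightarrow> 'a \<Rightarrow> 'a" where PA: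
    "\<forall>n. finite (P n) \<and> (\<forall>p\<in>P n. bounded_clinear (A n p)) \<and>
    (\<forall>x. (\<Sum>p\<in>P n. (norm (A n p x))\<^sup>2) \<le> real (nat \<lceil>2 * K\<rceil>) * M\<^sup>2 * (norm x)\<^sup>2) \<and>
    (\<forall>x. calc (finite_blaschke l (F' n)) x = 0 \<longrightarrow> 1 / (1 + Q\<^sup>2) * (norm x)\<^sup>2 \<le> (\<Sum>p\<in>P n. (norm (A n p x))\<^sup>2)) \<and>
    (\<forall>x. calc (finite_blaschke l (F' n)) x = 0 \<longrightarrow>
       (\<Sum>p\<in>P n. (norm (A n p (T x)))\<^sup>2) \<le> (\<Sum>p\<in>P n. (norm (A n p x))\<^sup>2))"
    unfolding choice_iff by blast
  show ?thesis
  proof (rule similar_to_contraction_limit_forms[OF T, of P A "\<lambda>n. {x. calc (finite_blaschke l (F' n)) x = 0}"])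
    show "incseq (\<lambda>n. {x. calc (finite_blaschke l (F' n)) x = 0})" by (rule null_spaces_incseq)
    show "0 < 1 / (1 + Q\<^sup>2)" by (simp add: add_pos_nonneg)
    show "closure (\<Union>n. {x. calc (finite_blaschke l (F' n)) x = 0}) = UNIV" by (rule dense)
  qed (use PA in \<open>blast+\<close>)
qed

end
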